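(* Let $A_N$ be an $N\times N$ matrix sampled from the Gaussian Orthogonal Ensemble and $B_N$ an $N\times N$ matrix ($N$ even) sampled, independently of $A_N$, from the real symmetric palindromic Toeplitz ensemble. Let $\{A_N,B_N\}=A_NB_N+B_NA_N$ and $$M_{2m}=\lim_{N\to\infty}\frac{1}{N^{2m+1}}\mathbb{E}\left[\mathrm{Tr}\left(\{A_N,B_N\}^{2m}\right)\right].$$ Then $M_{2m}=\sigma_{m,0}$, where the array $(\sigma_{n,s})_{n,s\ge0}$ satisfies the initial conditions $\sigma_{0,0}=1$ and $\sigma_{0,s}=(2s-1)!!$ for $s\ge1$, and the recurrence relation, for $n\ge1$ and $s\ge0$, $$\sigma_{n,s}=\sum_{k=1}^n\left(\sigma_{k-1,1}\,\sigma_{n-k,s}+\sigma_{k-1,0}\,\sigma_{n-k,s+1}\right).$$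
   Context: The $N\times N$ Gaussian Orthogonal Ensemble (GOE) consists of real symmetric matrices $(a_{ij})$ whose entries $a_{ij}$, $i\le j$, are independent with $a_{ij}=a_{ji}\sim N(0,1)$ for $i\neq j$ and $a_{ii}\sim N(0,2)$. The $N\times N$ real symmetric palindromic Toeplitz ensemble (PTE), with $N$ even, consists of matrices $(a_{ij})$ with entries parametrized by $b_0,b_1,\dots,b_{N/2-1}$, which are i.i.d. random variables with mean $0$, variance $1$ and finite higher moments: $$a_{ij}=\begin{cases} b_{|i-j|} & \text{if } 0\le|i-j|\le \frac N2-1,\\ b_{N-1-|i-j|} & \text{if } \frac N2\le|i-j|\le N-1.\end{cases}$$ The quantity $M_{2m}$ is called the limiting expected $2m$-th moment of $\{\mathrm{GOE},\mathrm{PTE}\}$. *)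

theory Defs
  imports "HOL-Probability.Probability" "Jordan_Normal_Form.Matrix"
begin

definition mat_trace :: "'a::comm_monoid_add mat \<Rightarrow> 'a" where
  "mat_trace A = (\<Sum>i<dim_row A. A $$ (i, i))"

definition anticommutator :: "'a::semiring_0 mat \<Rightarrow> 'a mat \<Rightarrow> 'a mat" where
  "anticommutator A B = A * B + B * A"

text \<open>
  \<open>GOE M N A\<close>: on the probability space \<open>M\<close>, \<open>A\<close> is a random matrix from the
  \<open>N \<times> N\<close> Gaussian Orthogonal Ensemble. The second parameter of
  \<^const>\<open>normal_density\<close> is the standard deviation, so variance 2 reads \<open>sqrt 2\<close>.
\<close>

definition GOE :: "'w measure \<Rightarrow> nat \<Rightarrow> ('w \<Rightarrow> real mat) \<Rightarrow> bool" where
  "GOE M N A \<longleftrightarrow>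
     prob_space M \<and>
     (\<forall>\<omega>\<in>space M. A \<omega> \<in> carrier_mat N N \<and> transpose_mat (A \<omega>) = A \<omega>) \<and>
     prob_space.indep_vars M (\<lambda>_. borel) (\<lambda>(i, j) \<omega>. A \<omega> $$ (i, j)) {(i, j). i \<le> j \<and> j < N} \<and>
     (\<forall>i j. i < j \<and> j < N \<longrightarrow> distributed M lborel (\<lambda>\<omega>. A \<omega> $$ (i, j)) (normal_density 0 1)) \<and>
     (\<forall>i<N. distributed M lborel (\<lambda>\<omega>. A \<omega> $$ (i, i)) (normal_density 0 (sqrt 2)))"

text \<open>Only used for even \<open>N\<close>; indices start at 0, which does not change \<open>\<bar>i - j\<bar>\<close>.\<close>

definition palindromic_toeplitz :: "nat \<Rightarrow> (nat \<Rightarrow> real) \<Rightarrow> real mat" where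
  "palindromic_toeplitz N b = mat N N (\<lambda>(i, j).
     let d = nat \<bar>int i - int j\<bar> in if d < N div 2 then b d else b (N - 1 - d))"

text \<open>
  \<open>PTE M \<mu> N B\<close>: on the probability space \<open>M\<close>, \<open>B\<close> is a random matrix from the
  \<open>N \<times> N\<close> real symmetric palindromic Toeplitz ensemble whose i.i.d. parameters
  \<open>b 0, \<dots>, b (N/2 - 1)\<close> have law \<open>\<mu>\<close>.
\<close>

definition PTE :: "'w measure \<Rightarrow> real measure \<Rightarrow> nat \<Rightarrow> ('w \<Rightarrow> real mat) \<Rightarrow> bool" where
  "PTE M \<mu> N B \<longleftrightarrow>
     prob_space M \<and>
     (\<exists>b :: nat \<Rightarrow> 'w \<Rightarrow> real.
        prob_space.indep_vars M (\<lambda>_. borel) b {..<N div 2} \<and>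
        (\<forall>k<N div 2. distr M borel (b k) = \<mu>) \<and>
        (\<forall>\<omega>\<in>space M. B \<omega> = palindromic_toeplitz N (\<lambda>k. b k \<omega>)))"

text \<open>
  The matrix type carries no \<open>\<sigma>\<close>-algebra, so an \<open>N \<times> N\<close> random matrix is identified
  with the random vector of its entries in the product space below.
\<close>

definition entry_space :: "nat \<Rightarrow> (nat \<times> nat \<Rightarrow> real) measure" where
  "entry_space N = (\<Pi>\<^sub>M ij\<in>{..<N} \<times> {..<N}. borel)"

definition entries :: "nat \<Rightarrow> real mat \<Rightarrow> nat \<times> nat \<Rightarrow> real" where
  "entries N A = (\<lambda>ij\<in>{..<N} \<times> {..<N}. A $$ ij)"

definition indep_matrices ::
    "'w measure \<Rightarrow> nat \<Rightarrow> ('w \<Rightarrow> real mat) \<Rightarrow> ('w \<Rightarrow> real mat) \<Rightarrow> bool" where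
  "indep_matrices M N A B \<longleftrightarrow>
     prob_space.indep_var M (entry_space N) (\<lambda>\<omega>. entries N (A \<omega>))
       (entry_space N) (\<lambda>\<omega>. entries N (B \<omega>))"

text \<open>\<open>odd_double_fact s\<close> is \<open>(2s - 1)!!\<close>, with the empty product 1 at \<open>s = 0\<close>.\<close>

definition odd_double_fact :: "nat \<Rightarrow> nat" where
  "odd_double_fact s = (\<Prod>i=1..s. 2 * i - 1)"

fun sigma_array :: "nat \<Rightarrow> nat \<Rightarrow> nat" where
  "sigma_array 0 s = odd_double_fact s"
| "sigma_array (Suc n) s =
     (\<Sum>k=1..Suc n. sigma_array (k - 1) 1 * sigma_array (Suc n - k) s + sigma_array (k - 1) 0 * sigma_array (Suc n - k) (s + 1))"

lemma sigma_array_initial: "sigma_array 0 0 = 1" "s \<ge> 1 \<Longrightarrow> sigma_array 0 s = odd_double_fact s"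
  by (simp_all add: odd_double_fact_def)

lemma sigma_array_recurrence:
  assumes "n \<ge> 1"
  shows "sigma_array n s =
    (\<Sum>k=1..n. sigma_array (k - 1) 1 * sigma_array (n - k) s + sigma_array (k - 1) 0 * sigma_array (n - k) (s + 1))"
  using assms sigma_array.simps(2)[of "n - 1" s] by simp

end

theory Submission
  imports Defs "HOL-Real_Asymp.Real_Asymp"
begin

text \<open>
  Write \<open>N = n + 1\<close> for the even matrix size. Expanding \<open>(AB + BA)\<^sup>2\<^sup>m\<close> into words in \<open>A\<close> and \<open>B\<close>, it
  suffices to know the limit of the normalised expectation of \<open>Tr w\<close> for every word \<open>w\<close>. More
  generally, for words \<open>w\<^sub>1, \<dots>, w\<^sub>r\<close> the expectation of \<open>Tr w\<^sub>1 \<cdots> Tr w\<^sub>r\<close>, divided by \<open>N\<close> to the power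
  \<open>\<Sum>(length w\<^sub>i / 2 + 1)\<close>, tends to \<open>\<phi> w\<^sub>1 \<cdots> \<phi> w\<^sub>r\<close>. Here \<open>\<phi>\<close> (\<open>free_moment\<close> below) is the joint
  moment of a semicircular variable (for \<open>A\<close>) and a standard Gaussian variable (for \<open>B\<close>) that
  are free from each other: the letters \<open>A\<close> must be paired without crossing any other pair, while
  the letters \<open>B\<close> may cross one another freely.

  This is shown by induction on the total length of the words (\<open>trace_limit\<close>). If some word
  contains \<open>A\<close>, Gaussian integration by parts in the entries of \<open>A\<close> gives the exact identity
  \<open>trace_recursion\<close>: \<open>E Tr (A v) T\<close>, with \<open>T\<close> a product of traces, is the sum of \<open>E Tr p Tr q T\<close> over
  all factorisations \<open>v = p A q\<close>, plus expectations of products of traces that have strictly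
  smaller order in \<open>N\<close>. Dividing by the normalisation and passing to the limit yields the recursion
  that defines \<open>\<phi>\<close>. Carrying products of traces along is what makes the induction close: no
  concentration estimate is needed.

  If only \<open>B\<close> occurs, the palindromic structure enters. With \<open>n = N - 1\<close> one has
  \<open>B\<^sub>k\<^sub>l = c(k - l mod n)\<close> where \<open>c(x) = c(-x)\<close>, so that \<open>B\<close> is a symmetric circulant matrix of odd size \<open>n\<close>
  whose row and column of index \<open>0\<close> are repeated at the end. A trace of \<open>B\<^sup>k\<close> is then, up to an error
  of relative order \<open>1/n\<close>, equal to \<open>n\<close> times the sum of \<open>c(x\<^sub>1) \<cdots> c(x\<^sub>k)\<close> over all residues with
  \<open>x\<^sub>1 + \<dots> + x\<^sub>k = 0\<close>. In the expectation a residue has to be matched up to sign with another one;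
  only matchings \<open>x\<^sub>i = -x\<^sub>j\<close> inside the same trace contribute to the leading order, because any
  other matching, or a coincidence of three residues, loses a degree of freedom. Hence every block
  of length \<open>k\<close> contributes the number of its pairings (\<open>sum_block_zero_lists_approx\<close>).

  Finally, summing \<open>\<phi>\<close> over the words of \<open>(AB + BA)\<^sup>2\<^sup>n B\<^sup>2\<^sup>s\<close> gives \<open>\<sigma>\<^sub>n\<^sub>,\<^sub>s\<close>: pairing the first letter \<open>A\<close>
  with a letter \<open>A\<close> of the \<open>j\<close>-th following factor cuts the word into an inner and an outer word,
  and by parity only two of the four ways of cutting survive (\<open>word_sum_eq_sigma_array\<close>).
\<close>

section \<open>Words and moments of free variables\<close>

text \<open>
  A word in the two matrices is a list of booleans: \<^const>\<open>True\<close> stands for \<open>A\<close> and \<^const>\<open>False\<close> for \<open>B\<close>.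
  \<open>splits w\<close> lists the pairs \<open>(u, v)\<close> with \<open>w = u A v\<close>, one for each occurrence of \<open>A\<close> in \<open>w\<close>.
\<close>

fun splits :: "bool list \<Rightarrow> (bool list \<times> bool list) list" where
  "splits [] = []"
| "splits (x # w) = (if x then [([], w)] else []) @ map (\<lambda>(u, v). (x # u, v)) (splits w)"

lemma in_splits_iff: "(u, v) \<in> set (splits w) \<longleftrightarrow> w = u @ True # v"
proof (induction w arbitrary: u)
  case (Cons x w)
  show ?case by (cases u) (force simp: Cons.IH[symmetric] image_iff)+
qed simp

lemma splits_append_B: "splits (w @ replicate t False) = map (\<lambda>(u, v). (u, v @ replicate t False)) (splits w)"
proof (induction w)
  case Nil
  show ?case by (induction t) simp_all
qed (auto simp: comp_def case_prod_unfold)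

text \<open>
  The \<open>k\<close>-th moment of the standard normal distribution, that is, the number of pairings of a set of
  \<open>k\<close> elements.
\<close>

definition gauss_moment :: "nat \<Rightarrow> nat" where
  "gauss_moment k = (if even k then odd_double_fact (k div 2) else 0)"

lemma gauss_moment_0 [simp]: "gauss_moment 0 = 1"
  by (simp add: gauss_moment_def odd_double_fact_def)

lemma gauss_moment_1 [simp]: "gauss_moment (Suc 0) = 0"
  by (simp add: gauss_moment_def)

lemma gauss_moment_step: "gauss_moment (Suc (Suc k)) = Suc k * gauss_moment k"
  by (auto simp: gauss_moment_def odd_double_fact_def)

text \<open>
  The mixed moment of a semicircular variable \<open>A\<close> and a standard Gaussian variable \<open>B\<close> that are free:
  the number of pairings of equal letters of the word in which no pair of letters \<open>A\<close> crosses another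
  pair. The prefix of letters \<open>B\<close> is first moved to the end, and then the leading letter \<open>A\<close> is paired
  with every other letter \<open>A\<close>, which separates the word into an inner and an outer part.
\<close>

function free_moment :: "bool list \<Rightarrow> nat" where
  "free_moment w = (case dropWhile Not w of [] \<Rightarrow> gauss_moment (length w)
     | x # w' \<Rightarrow> (\<Sum>(u, v)\<leftarrow>splits (w' @ takeWhile Not w). free_moment u * free_moment v))"
  by auto
termination
proof (relation "Wellfounded.measure length", goal_cases)
  case (2 w x w' z u v)
  have "length w = length (takeWhile Not w) + length (dropWhile Not w)"
    by (metis length_append takeWhile_dropWhile_id)
  moreover have "w' @ takeWhile Not w = u @ True # v"
    using 2 by (auto simp: in_splits_iff)
  then have "length w' + length (takeWhile Not w) = length u + Suc (length v)"
    by (metis length_append length_Cons)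
  ultimately show ?case using 2 by simp
next
  case (3 w x w' z u v)
  have "length w = length (takeWhile Not w) + length (dropWhile Not w)"
    by (metis length_append takeWhile_dropWhile_id)
  moreover have "w' @ takeWhile Not w = u @ True # v"
    using 3 by (auto simp: in_splits_iff)
  then have "length w' + length (takeWhile Not w) = length u + Suc (length v)"
    by (metis length_append length_Cons)
  ultimately show ?case using 3 by simp
qed simp

declare free_moment.simps [simp del]

lemma free_moment_B [simp]: "free_moment (replicate k False) = gauss_moment k"
  by (simp add: free_moment.simps[of "replicate k False"])

lemma free_moment_A:
  "free_moment (replicate p False @ True # w) = (\<Sum>(u, v)\<leftarrow>splits (w @ replicate p False). free_moment u * free_moment v)"
  by (subst free_moment.simps) (simp add: dropWhile_append takeWhile_append)

lemma word_cases_A: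
  fixes w :: "bool list"
  obtains k where "w = replicate k False" | p w' where "w = replicate p False @ True # w'"
proof (cases "True \<in> set w")
  case True
  then obtain u v where uv: "w = u @ True # v" "True \<notin> set u"
    by (meson split_list_first)
  then have "u = replicate (length u) False"
    by (intro replicate_eqI) auto
  then show ?thesis using uv that(2) by metis
next
  case False
  then have "w = replicate (length w) False"
    by (intro replicate_eqI) auto
  then show ?thesis using that(1) by metis
qed

text \<open>
  Since the recursion already moves leading letters \<open>B\<close> to the end, this instance of traciality
  needs no induction.
\<close>

lemma free_moment_rotate_B: "free_moment (False # w) = free_moment (w @ [False])"
proof (cases w rule: word_cases_A)
  case (1 k)
  have "False # w = replicate (Suc k) False" "w @ [False] = replicate (Suc k) False"
    using 1 by (simp_all add: replicate_append_same)
  then show ?thesis by simp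
next
  case (2 p w')
  \<comment> \<open>both sides expand along the same letter \<open>A\<close>\<close>
  have "False # w = replicate (Suc p) False @ True # w'"
    using 2 by simp
  then have "free_moment (False # w) = (\<Sum>(u, v)\<leftarrow>splits (w' @ replicate (Suc p) False). free_moment u * free_moment v)"
    by (simp only: free_moment_A)
  also have "w' @ replicate (Suc p) False = (w' @ [False]) @ replicate p False"
    by simp
  also have "(\<Sum>(u, v)\<leftarrow>splits ((w' @ [False]) @ replicate p False). free_moment u * free_moment v)
      = free_moment (replicate p False @ True # (w' @ [False]))"
    by (simp only: free_moment_A)
  finally show ?thesis using 2 by simp
qed

lemma free_moment_odd_eq_0:
  assumes "odd (count_list w True) \<or> odd (count_list w False)"
  shows "free_moment w = 0"
  using assms
proof (induction "length w" arbitrary: w rule: less_induct)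
  case less
  show ?case
  proof (cases w rule: word_cases_A)
    case (1 k)
    have "count_list (replicate k False) True = 0" "count_list (replicate k False) False = k"
      by (induction k) simp_all
    then show ?thesis using 1 less.prems by (auto simp: gauss_moment_def)
  next
    case (2 p w')
    have "free_moment u * free_moment v = 0" if "(u, v) \<in> set (splits (w' @ replicate p False))" for u v
    proof -
      have eq: "w' @ replicate p False = u @ True # v"
        using that by (simp add: in_splits_iff)
      have "count_list w x = count_list [True] x + count_list (w' @ replicate p False) x" for x
        using 2 by simp
      then have c: "count_list w x = count_list [True] x + count_list (u @ True # v) x" for x
        using eq by simp
      have "length w = Suc (length (w' @ replicate p False))"
        using 2 by simp
      then have "length u < length w" "length v < length w"
        using eq by simp_all
      moreover have "(odd (count_list u True) \<or> odd (count_list u False)) \<or>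
          (odd (count_list v True) \<or> odd (count_list v False))"
        using less.prems c[of True] c[of False] by auto
      ultimately show ?thesis
        using less.hyps[of u] less.hyps[of v] by auto
    qed
    then have "(\<Sum>(u, v)\<leftarrow>splits (w' @ replicate p False). free_moment u * free_moment v) = 0"
      by (auto simp: sum_list_eq_0_iff case_prod_unfold)
    then show ?thesis using 2 by (simp add: free_moment_A)
  qed
qed

text \<open>
  The words that occur in the expansion of \<open>(AB + BA)\<^sup>n\<close>.
\<close>

fun anticomm_words :: "nat \<Rightarrow> bool list list" where
  "anticomm_words 0 = [[]]"
| "anticomm_words (Suc n) = map ((@) [True, False]) (anticomm_words n) @ map ((@) [False, True]) (anticomm_words n)"

text \<open>
  Choosing an occurrence of \<open>A\<close> in a word of \<open>(AB + BA)\<^sup>n\<close> means choosing the factor \<open>j\<close> in which it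
  lies and whether this factor is \<open>AB\<close> or \<open>BA\<close>; the letter \<open>B\<close> of that factor falls to the right or to
  the left part accordingly.
\<close>

lemma sum_splits_anticomm_words:
  fixes f :: "bool list \<Rightarrow> bool list \<Rightarrow> nat"
  shows "(\<Sum>w\<leftarrow>anticomm_words n. \<Sum>(u, v)\<leftarrow>splits w. f u v) =
    (\<Sum>j<n. \<Sum>u\<leftarrow>anticomm_words j. \<Sum>v\<leftarrow>anticomm_words (n - 1 - j). f u (False # v) + f (u @ [False]) v)"
proof (induction n arbitrary: f)
  case (Suc n)
  define X where "X = anticomm_words"
  have "(\<Sum>w\<leftarrow>anticomm_words (Suc n). \<Sum>(u, v)\<leftarrow>splits w. f u v) =
     (\<Sum>w\<leftarrow>X n. f [] (False # w) + f [False] w)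
     + ((\<Sum>w\<leftarrow>X n. \<Sum>(u, v)\<leftarrow>splits w. f (True # False # u) v)
      + (\<Sum>w\<leftarrow>X n. \<Sum>(u, v)\<leftarrow>splits w. f (False # True # u) v))"
    by (simp add: X_def comp_def case_prod_unfold sum_list_addf)
  also have "\<dots> = (\<Sum>w\<leftarrow>X n. f [] (False # w) + f [False] w)
     + (\<Sum>j<n. \<Sum>u\<leftarrow>X (Suc j). \<Sum>v\<leftarrow>X (n - 1 - j). f u (False # v) + f (u @ [False]) v)"
    unfolding X_def Suc.IH[of "\<lambda>u. f (True # False # u)"] Suc.IH[of "\<lambda>u. f (False # True # u)"]
    by (simp add: comp_def sum.distrib)
  also have "\<dots> = (\<Sum>j<Suc n. \<Sum>u\<leftarrow>X j. \<Sum>v\<leftarrow>X (n - j). f u (False # v) + f (u @ [False]) v)"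
    unfolding sum.lessThan_Suc_shift by (simp add: X_def)
  finally show ?case by (simp add: X_def)
qed simp

text \<open>
  The moment \<open>\<phi>((AB + BA)\<^sup>n B\<^sup>t)\<close>.
\<close>

definition word_sum :: "nat \<Rightarrow> nat \<Rightarrow> nat" where
  "word_sum n t = (\<Sum>w\<leftarrow>anticomm_words n. free_moment (w @ replicate t False))"

lemma count_anticomm_words:
  "w \<in> set (anticomm_words n) \<Longrightarrow> count_list w x = n"
  by (induction n arbitrary: w) auto

lemma length_anticomm_words:
  "w \<in> set (anticomm_words n) \<Longrightarrow> length w = 2 * n"
  by (induction n arbitrary: w) auto

lemma word_sum_odd_eq_0:
  assumes "odd n \<or> odd (n + t)"
  shows "word_sum n t = 0"
proof -
  have c: "count_list (replicate t False) True = 0" "count_list (replicate t False) False = t"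
    by (induction t) simp_all
  have "free_moment (w @ replicate t False) = 0" if "w \<in> set (anticomm_words n)" for w
    using assms by (intro free_moment_odd_eq_0) (auto simp: c count_anticomm_words[OF that])
  then show ?thesis
    by (auto simp: word_sum_def sum_list_eq_0_iff)
qed

lemma sum_list_prod_nat:
  fixes f g :: "_ \<Rightarrow> nat"
  shows "(\<Sum>u\<leftarrow>xs. \<Sum>v\<leftarrow>ys. f u * g v) = (\<Sum>u\<leftarrow>xs. f u) * (\<Sum>v\<leftarrow>ys. g v)"
  by (simp add: sum_list_const_mult sum_list_mult_const)

text \<open>
  The four products come from the first factor (\<open>AB\<close> or \<open>BA\<close>) and the factor that contains the partner
  of its letter \<open>A\<close> (again \<open>AB\<close> or \<open>BA\<close>).
\<close>

lemma word_sum_Suc: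
  "word_sum (Suc n) t = (\<Sum>j<n.
     word_sum j 1 * word_sum (n - 1 - j) (t + 1) + word_sum j 2 * word_sum (n - 1 - j) t
   + (word_sum j 0 * word_sum (n - 1 - j) (t + 2) + word_sum j 1 * word_sum (n - 1 - j) (t + 1)))"
proof -
  let ?B = "\<lambda>t. replicate t False"
  have AB: "free_moment ([True, False] @ w @ ?B t) = (\<Sum>(u, v)\<leftarrow>splits w. free_moment (False # u) * free_moment (v @ ?B t))" for w
    using free_moment_A[of 0 "False # w @ ?B t"]
    by (simp add: splits_append_B comp_def case_prod_unfold)
  have BA: "free_moment ([False, True] @ w @ ?B t) = (\<Sum>(u, v)\<leftarrow>splits w. free_moment u * free_moment (v @ ?B (Suc t)))" for w
    using free_moment_A[of 1 "w @ ?B t"] splits_append_B[of w "Suc t"]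
    by (simp add: replicate_append_same comp_def case_prod_unfold)
  have r1: "free_moment (False # v @ ?B t) = free_moment (v @ ?B (Suc t))" for v t
    by (simp add: free_moment_rotate_B replicate_append_same)
  have r2: "free_moment (False # u @ [False]) = free_moment (u @ ?B 2)" for u
    using r1[of u 1] by (simp add: numeral_2_eq_2)
  have r3: "free_moment (False # u) = free_moment (u @ ?B 1)" for u
    using r1[of u 0] by simp
  have "word_sum (Suc n) t =
      (\<Sum>w\<leftarrow>anticomm_words n. \<Sum>(u, v)\<leftarrow>splits w. free_moment (False # u) * free_moment (v @ ?B t))
    + (\<Sum>w\<leftarrow>anticomm_words n. \<Sum>(u, v)\<leftarrow>splits w. free_moment u * free_moment (v @ ?B (Suc t)))"
    using AB BA by (simp add: word_sum_def comp_def)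
  also have "\<dots> =
      (\<Sum>j<n. \<Sum>u\<leftarrow>anticomm_words j. \<Sum>v\<leftarrow>anticomm_words (n - 1 - j).
         free_moment (u @ ?B 1) * free_moment (v @ ?B (t + 1)) + free_moment (u @ ?B 2) * free_moment (v @ ?B t))
    + (\<Sum>j<n. \<Sum>u\<leftarrow>anticomm_words j. \<Sum>v\<leftarrow>anticomm_words (n - 1 - j).
         free_moment (u @ ?B 0) * free_moment (v @ ?B (t + 2)) + free_moment (u @ ?B 1) * free_moment (v @ ?B (t + 1)))"
    unfolding sum_splits_anticomm_words append_Cons r1 r2 unfolding r3
    by (simp add: r1[unfolded replicate_Suc])
  finally show ?thesis
    by (simp add: sum_list_addf sum_list_prod_nat word_sum_def sum.distrib)
qed

lemma sum_even_indices:
  fixes f :: "nat \<Rightarrow> nat"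
  assumes "\<And>j. odd j \<Longrightarrow> f j = 0"
  shows "(\<Sum>j<2 * n + 1. f j) = (\<Sum>k=1..Suc n. f (2 * (k - 1)))"
proof (induction n)
  case (Suc n)
  have "f (2 * n + 1) = 0" by (rule assms) simp
  then show ?case using Suc by simp
qed simp

theorem word_sum_eq_sigma_array: "word_sum (2 * n) (2 * s) = sigma_array n s"
proof (induction n arbitrary: s rule: less_induct)
  case (less n)
  show ?case
  proof (cases n)
    case 0
    show ?thesis
      using free_moment_B[of "2 * s"] by (simp add: 0 word_sum_def gauss_moment_def)
  next
    case (Suc m)
    define f where "f j = word_sum j 2 * word_sum (2 * m - j) (2 * s)
        + word_sum j 0 * word_sum (2 * m - j) (2 * s + 2)" for j
    \<comment> \<open>\<open>j\<close> letters \<open>A\<close> and \<open>j + 1\<close> letters \<open>B\<close> cannot both be even in number\<close>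
    have z: "word_sum j 1 = 0" for j
      by (rule word_sum_odd_eq_0) auto
    have "word_sum (2 * n) (2 * s) = word_sum (Suc (2 * m + 1)) (2 * s)"
      by (simp add: Suc)
    also have "\<dots> = (\<Sum>j<2 * m + 1. f j)"
      unfolding word_sum_Suc f_def by (rule sum.cong) (use z in auto)
    also have "\<dots> = (\<Sum>k=1..Suc m. f (2 * (k - 1)))"
      by (rule sum_even_indices) (auto simp: f_def word_sum_odd_eq_0)
    also have "\<dots> = (\<Sum>k=1..Suc m. sigma_array (k - 1) 1 * sigma_array (Suc m - k) s
        + sigma_array (k - 1) 0 * sigma_array (Suc m - k) (s + 1))"
    proof (rule sum.cong)
      fix k assume k: "k \<in> {1..Suc m}"
      have e: "2 * m - 2 * (k - 1) = 2 * (Suc m - k)"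
        using k by auto
      have "word_sum (2 * (k - 1)) (2 * 1) = sigma_array (k - 1) 1"
        "word_sum (2 * (k - 1)) (2 * 0) = sigma_array (k - 1) 0"
        "word_sum (2 * (Suc m - k)) (2 * s) = sigma_array (Suc m - k) s"
        "word_sum (2 * (Suc m - k)) (2 * (s + 1)) = sigma_array (Suc m - k) (s + 1)"
        using k Suc by (intro less.IH; auto)+
      then show "f (2 * (k - 1)) = sigma_array (k - 1) 1 * sigma_array (Suc m - k) s
        + sigma_array (k - 1) 0 * sigma_array (Suc m - k) (s + 1)"
        unfolding f_def e by simp
    qed simp
    finally show ?thesis by (simp add: Suc)
  qed
qed

section \<open>Gaussian integration by parts and the loop equation\<close>

context prob_space
begin

text \<open>
  Random variables with finite moments of all orders. They form an algebra, which provides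
  integrability for all polynomials in the matrix entries.
\<close>

definition all_moments :: "('a \<Rightarrow> real) \<Rightarrow> bool" where
  "all_moments X \<longleftrightarrow> X \<in> borel_measurable M \<and> (\<forall>p::nat. integrable M (\<lambda>\<omega>. X \<omega> ^ p))"

lemma all_moments_measurable [measurable_dest]: "all_moments X \<Longrightarrow> X \<in> borel_measurable M"
  by (simp add: all_moments_def)

lemma all_moments_integrable: "all_moments X \<Longrightarrow> integrable M X"
  unfolding all_moments_def by (metis (no_types, lifting) ext power_one_right)

lemma all_moments_const [simp, intro]: "all_moments (\<lambda>_. c)"
  by (simp add: all_moments_def)

lemma all_moments_add [intro]:
  assumes "all_moments X" "all_moments Y"
  shows "all_moments (\<lambda>\<omega>. X \<omega> + Y \<omega>)"
  unfolding all_moments_def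
proof (intro conjI allI)
  note [measurable] = assms[THEN all_moments_measurable]
  show "(\<lambda>\<omega>. X \<omega> + Y \<omega>) \<in> borel_measurable M" by measurable
  fix p :: nat
  have "integrable M (\<lambda>\<omega>. \<bar>X \<omega> ^ p\<bar>)" "integrable M (\<lambda>\<omega>. \<bar>Y \<omega> ^ p\<bar>)"
    using assms by (auto simp: all_moments_def)
  then have I: "integrable M (\<lambda>\<omega>. 2 ^ p * (\<bar>X \<omega> ^ p\<bar> + \<bar>Y \<omega> ^ p\<bar>))"
    by simp
  show "integrable M (\<lambda>\<omega>. (X \<omega> + Y \<omega>) ^ p)"
  proof (rule Bochner_Integration.integrable_bound[OF I])
    show "AE \<omega> in M. norm ((X \<omega> + Y \<omega>) ^ p) \<le> norm (2 ^ p * (\<bar>X \<omega> ^ p\<bar> + \<bar>Y \<omega> ^ p\<bar>))"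
    proof (rule AE_I2)
      fix \<omega>
      have "\<bar>X \<omega> + Y \<omega>\<bar> ^ p \<le> (2 * max \<bar>X \<omega>\<bar> \<bar>Y \<omega>\<bar>) ^ p"
        by (rule power_mono) auto
      also have "\<dots> = 2 ^ p * max \<bar>X \<omega>\<bar> \<bar>Y \<omega>\<bar> ^ p"
        by (simp add: power_mult_distrib)
      also have "\<dots> \<le> 2 ^ p * (\<bar>X \<omega>\<bar> ^ p + \<bar>Y \<omega>\<bar> ^ p)"
        by (intro mult_left_mono) (auto simp: max_def)
      finally show "norm ((X \<omega> + Y \<omega>) ^ p) \<le> norm (2 ^ p * (\<bar>X \<omega> ^ p\<bar> + \<bar>Y \<omega> ^ p\<bar>))"
        by (simp add: power_abs abs_mult)
    qed
  qed measurable
qed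

lemma all_moments_mult [intro]:
  assumes "all_moments X" "all_moments Y"
  shows "all_moments (\<lambda>\<omega>. X \<omega> * Y \<omega>)"
  unfolding all_moments_def
proof (intro conjI allI)
  note [measurable] = assms[THEN all_moments_measurable]
  show "(\<lambda>\<omega>. X \<omega> * Y \<omega>) \<in> borel_measurable M" by measurable
  fix p :: nat
  have I: "integrable M (\<lambda>\<omega>. X \<omega> ^ (2 * p) + Y \<omega> ^ (2 * p))"
    using assms by (auto simp: all_moments_def)
  show "integrable M (\<lambda>\<omega>. (X \<omega> * Y \<omega>) ^ p)"
  proof (rule Bochner_Integration.integrable_bound[OF I])
    show "AE \<omega> in M. norm ((X \<omega> * Y \<omega>) ^ p) \<le> norm (X \<omega> ^ (2 * p) + Y \<omega> ^ (2 * p))"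
    proof (rule AE_I2)
      fix \<omega>
      have "0 \<le> \<bar>X \<omega> ^ p\<bar> * \<bar>Y \<omega> ^ p\<bar>" by simp
      then have "\<bar>X \<omega> ^ p\<bar> * \<bar>Y \<omega> ^ p\<bar> \<le> \<bar>X \<omega> ^ p\<bar>\<^sup>2 + \<bar>Y \<omega> ^ p\<bar>\<^sup>2"
        using sum_squares_bound[of "\<bar>X \<omega> ^ p\<bar>" "\<bar>Y \<omega> ^ p\<bar>"] by linarith
      moreover have "\<bar>(X \<omega> * Y \<omega>) ^ p\<bar> = \<bar>X \<omega> ^ p\<bar> * \<bar>Y \<omega> ^ p\<bar>"
        by (simp add: power_mult_distrib abs_mult)
      ultimately show "norm ((X \<omega> * Y \<omega>) ^ p) \<le> norm (X \<omega> ^ (2 * p) + Y \<omega> ^ (2 * p))"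
        by (simp add: power_even_eq)
    qed
  qed measurable
qed

lemma all_moments_sum_list [intro]:
  "(\<And>x. x \<in> set xs \<Longrightarrow> all_moments (X x)) \<Longrightarrow> all_moments (\<lambda>\<omega>. \<Sum>x\<leftarrow>xs. X x \<omega>)"
  by (induction xs) auto

lemma all_moments_prod_list [intro]:
  "(\<And>x. x \<in> set xs \<Longrightarrow> all_moments (X x)) \<Longrightarrow> all_moments (\<lambda>\<omega>. \<Prod>x\<leftarrow>xs. X x \<omega>)"
  by (induction xs) auto

end

text \<open>The covariance of the entries \<open>(i, j)\<close> and \<open>(k, l)\<close> of a GOE matrix.\<close>

definition goe_cov :: "nat \<Rightarrow> nat \<Rightarrow> nat \<Rightarrow> nat \<Rightarrow> real" where
  "goe_cov i j k l = of_bool (k = i \<and> l = j) + of_bool (k = j \<and> l = i)"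

text \<open>
  A monomial in the entries of a matrix, given by the list of its index pairs, and its derivative
  in the direction of the entry \<open>(i, j)\<close>: the Leibniz rule applied with the derivative of the entry
  \<open>(k, l)\<close> replaced by its covariance with the entry \<open>(i, j)\<close>.
\<close>

definition monomial :: "(nat \<Rightarrow> nat \<Rightarrow> 'w \<Rightarrow> real) \<Rightarrow> (nat \<times> nat) list \<Rightarrow> 'w \<Rightarrow> real" where
  "monomial a es \<omega> = (\<Prod>(k, l)\<leftarrow>es. a k l \<omega>)"

fun deriv_monomial ::
    "(nat \<Rightarrow> nat \<Rightarrow> 'w \<Rightarrow> real) \<Rightarrow> nat \<Rightarrow> nat \<Rightarrow> (nat \<times> nat) list \<Rightarrow> 'w \<Rightarrow> real" where
  "deriv_monomial a i j [] \<omega> = 0"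
| "deriv_monomial a i j ((k, l) # es) \<omega> =
     goe_cov i j k l * monomial a es \<omega> + a k l \<omega> * deriv_monomial a i j es \<omega>"

lemma monomial_simps [simp]:
  "monomial a [] \<omega> = 1" "monomial a ((k, l) # es) \<omega> = a k l \<omega> * monomial a es \<omega>"
  by (simp_all add: monomial_def)

text \<open>
  The lists of words that arise from a trace \<open>Tr (A v)\<close> and traces of the words in \<open>ws\<close> by pairing the
  displayed letter \<open>A\<close> with a letter \<open>A\<close> of a word in \<open>ws\<close>. The two words merge into one, in either of
  two orientations. In \<open>error_words\<close> the pairings inside \<open>v\<close> with the reversed orientation are added.
\<close>

fun merged_words :: "bool list \<Rightarrow> bool list list \<Rightarrow> bool list list list" where
  "merged_words v [] = []"
| "merged_words v (w # ws) = map (\<lambda>(p, q). (rev v @ q @ p) # ws) (splits w)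
     @ map (\<lambda>(p, q). (v @ q @ p) # ws) (splits w)
     @ map ((#) w) (merged_words v ws)"

definition error_words :: "bool list \<Rightarrow> bool list list \<Rightarrow> bool list list list" where
  "error_words v ws = map (\<lambda>(p, q). (rev p @ q) # ws) (splits v) @ merged_words v ws"

text \<open>
  Two families \<open>a\<close> and \<open>b\<close> of random variables, thought of as the entries of two symmetric \<open>N \<times> N\<close>
  matrices, such that the first family satisfies Wick's formula with the GOE covariance, and continues to do so after
  multiplication with monomials in the second family.
\<close>

locale wick_pair = prob_space M for M :: "'w measure" +
  fixes N :: nat and a b :: "nat \<Rightarrow> nat \<Rightarrow> 'w \<Rightarrow> real"
  assumes a_sym: "a k l = a l k"
    and b_sym: "b k l = b l k"
    and a_moments: "k < N \<Longrightarrow> l < N \<Longrightarrow> all_moments (a k l)"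
    and b_moments: "k < N \<Longrightarrow> l < N \<Longrightarrow> all_moments (b k l)"
    and wick: "i < N \<Longrightarrow> j < N \<Longrightarrow> set es \<subseteq> {..<N} \<times> {..<N} \<Longrightarrow> set fs \<subseteq> {..<N} \<times> {..<N} \<Longrightarrow>
      expectation (\<lambda>\<omega>. a i j \<omega> * monomial a es \<omega> * monomial b fs \<omega>) =
      expectation (\<lambda>\<omega>. deriv_monomial a i j es \<omega> * monomial b fs \<omega>)"
begin

lemma monomial_a_moments: "set es \<subseteq> {..<N} \<times> {..<N} \<Longrightarrow> all_moments (monomial a es)"
  unfolding monomial_def case_prod_unfold
  by (rule all_moments_prod_list, rule a_moments) auto

lemma monomial_b_moments: "set es \<subseteq> {..<N} \<times> {..<N} \<Longrightarrow> all_moments (monomial b es)"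
  unfolding monomial_def case_prod_unfold
  by (rule all_moments_prod_list, rule b_moments) auto

lemma deriv_monomial_moments:
  "set es \<subseteq> {..<N} \<times> {..<N} \<Longrightarrow> all_moments (deriv_monomial a i j es)"
proof (induction es)
  case (Cons e es)
  obtain k l where e: "e = (k, l)" by (cases e)
  have "all_moments (\<lambda>\<omega>. goe_cov i j k l * monomial a es \<omega> + a k l \<omega> * deriv_monomial a i j es \<omega>)"
    using Cons e
    by (intro all_moments_add all_moments_mult all_moments_const a_moments monomial_a_moments) auto
  then show ?case by (simp add: e)
next
  case Nil
  have "deriv_monomial a i j [] = (\<lambda>_. 0)" by (simp add: fun_eq_iff)
  then show ?case by simp
qed

text \<open>
  \<open>wick_poly F D\<close>: \<open>F\<close> is a polynomial in the entries \<open>a k l\<close> and \<open>b k l\<close> with indices below \<open>N\<close>, and \<open>D i j\<close>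
  is its derivative in the direction of \<open>a i j\<close> in the sense above. The relation records one
  derivative for each representation of \<open>F\<close> as a polynomial, which avoids having to show that the
  derivative is well defined.
\<close>

inductive wick_poly :: "('w \<Rightarrow> real) \<Rightarrow> (nat \<Rightarrow> nat \<Rightarrow> 'w \<Rightarrow> real) \<Rightarrow> bool" where
  wick_const: "wick_poly (\<lambda>_. c) (\<lambda>_ _ _. 0)"
| wick_a: "k < N \<Longrightarrow> l < N \<Longrightarrow> wick_poly (a k l) (\<lambda>i j _. goe_cov i j k l)"
| wick_b: "k < N \<Longrightarrow> l < N \<Longrightarrow> wick_poly (b k l) (\<lambda>_ _ _. 0)"
| wick_add: "wick_poly F D \<Longrightarrow> wick_poly G E \<Longrightarrow>
    wick_poly (\<lambda>\<omega>. F \<omega> + G \<omega>) (\<lambda>i j \<omega>. D i j \<omega> + E i j \<omega>)"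
| wick_mult: "wick_poly F D \<Longrightarrow> wick_poly G E \<Longrightarrow>
    wick_poly (\<lambda>\<omega>. F \<omega> * G \<omega>) (\<lambda>i j \<omega>. D i j \<omega> * G \<omega> + F \<omega> * E i j \<omega>)"

lemma wick_poly_moments: "wick_poly F D \<Longrightarrow> all_moments F \<and> all_moments (D i j)"
  by (induction rule: wick_poly.induct) (auto intro!: a_moments b_moments)

lemma wick_sum:
  assumes "\<And>x. x \<in> S \<Longrightarrow> wick_poly (F x) (D x)"
  shows "wick_poly (\<lambda>\<omega>. \<Sum>x\<in>S. F x \<omega>) (\<lambda>i j \<omega>. \<Sum>x\<in>S. D x i j \<omega>)"
  using assms
  by (induction S rule: infinite_finite_induct) (auto intro: wick_const wick_add)

text \<open>
  Integration by parts for \<open>H\<close>, with derivative \<open>E\<close>, after multiplication with an arbitrary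
  monomial. Quantifying over the monomials makes the property stable under multiplication with
  polynomials.
\<close>

definition wick_multiplier :: "('w \<Rightarrow> real) \<Rightarrow> (nat \<Rightarrow> nat \<Rightarrow> 'w \<Rightarrow> real) \<Rightarrow> bool" where
  "wick_multiplier H E \<longleftrightarrow> all_moments H \<and> (\<forall>i j. all_moments (E i j)) \<and>
    (\<forall>i<N. \<forall>j<N. \<forall>es fs. set es \<subseteq> {..<N} \<times> {..<N} \<longrightarrow> set fs \<subseteq> {..<N} \<times> {..<N} \<longrightarrow>
      expectation (\<lambda>\<omega>. a i j \<omega> * monomial a es \<omega> * monomial b fs \<omega> * H \<omega>) =
      expectation (\<lambda>\<omega>. monomial b fs \<omega> * (deriv_monomial a i j es \<omega> * H \<omega> + monomial a es \<omega> * E i j \<omega>)))"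

lemma wick_multiplierD:
  assumes "wick_multiplier H E" "i < N" "j < N" "set es \<subseteq> {..<N} \<times> {..<N}" "set fs \<subseteq> {..<N} \<times> {..<N}"
  shows "expectation (\<lambda>\<omega>. a i j \<omega> * monomial a es \<omega> * monomial b fs \<omega> * H \<omega>) =
      expectation (\<lambda>\<omega>. monomial b fs \<omega> * (deriv_monomial a i j es \<omega> * H \<omega> + monomial a es \<omega> * E i j \<omega>))"
  using assms unfolding wick_multiplier_def by blast

lemma wick_poly_multiplier:
  assumes "wick_poly F D" "wick_multiplier H E"
  shows "wick_multiplier (\<lambda>\<omega>. F \<omega> * H \<omega>) (\<lambda>i j \<omega>. D i j \<omega> * H \<omega> + F \<omega> * E i j \<omega>)"
  using assms
proof (induction arbitrary: H E rule: wick_poly.induct)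
  case (wick_const c)
  show ?case unfolding wick_multiplier_def
  proof (intro conjI allI impI)
    fix i j and es fs :: "(nat \<times> nat) list"
    assume *: "i < N" "j < N" "set es \<subseteq> {..<N} \<times> {..<N}" "set fs \<subseteq> {..<N} \<times> {..<N}"
    have "expectation (\<lambda>\<omega>. c * (a i j \<omega> * monomial a es \<omega> * monomial b fs \<omega> * H \<omega>)) =
      expectation (\<lambda>\<omega>. c * (monomial b fs \<omega> * (deriv_monomial a i j es \<omega> * H \<omega> + monomial a es \<omega> * E i j \<omega>)))"
      using wick_multiplierD[OF wick_const *] by simp
    then show "expectation (\<lambda>\<omega>. a i j \<omega> * monomial a es \<omega> * monomial b fs \<omega> * (c * H \<omega>)) =
      expectation (\<lambda>\<omega>. monomial b fs \<omega> * (deriv_monomial a i j es \<omega> * (c * H \<omega>)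
        + monomial a es \<omega> * (0 * H \<omega> + c * E i j \<omega>)))"
      by (simp add: algebra_simps)
  qed (use wick_const in \<open>auto simp: wick_multiplier_def\<close>)
next
  case (wick_a k l)
  show ?case unfolding wick_multiplier_def
  proof (intro conjI allI impI)
    fix i j and es fs :: "(nat \<times> nat) list"
    assume *: "i < N" "j < N" "set es \<subseteq> {..<N} \<times> {..<N}" "set fs \<subseteq> {..<N} \<times> {..<N}"
    have "set ((k, l) # es) \<subseteq> {..<N} \<times> {..<N}" using * wick_a by simp
    from wick_multiplierD[OF wick_a(3) *(1,2) this *(4)]
    show "expectation (\<lambda>\<omega>. a i j \<omega> * monomial a es \<omega> * monomial b fs \<omega> * (a k l \<omega> * H \<omega>)) =
      expectation (\<lambda>\<omega>. monomial b fs \<omega> * (deriv_monomial a i j es \<omega> * (a k l \<omega> * H \<omega>)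
        + monomial a es \<omega> * (goe_cov i j k l * H \<omega> + a k l \<omega> * E i j \<omega>)))"
      by (simp add: algebra_simps)
  qed (use wick_a a_moments[OF wick_a(1,2)] in
    \<open>auto simp: wick_multiplier_def intro!: all_moments_add all_moments_mult\<close>)
next
  case (wick_b k l)
  show ?case unfolding wick_multiplier_def
  proof (intro conjI allI impI)
    fix i j and es fs :: "(nat \<times> nat) list"
    assume *: "i < N" "j < N" "set es \<subseteq> {..<N} \<times> {..<N}" "set fs \<subseteq> {..<N} \<times> {..<N}"
    have "set ((k, l) # fs) \<subseteq> {..<N} \<times> {..<N}" using * wick_b by simp
    from wick_multiplierD[OF wick_b(3) *(1,2,3) this]
    show "expectation (\<lambda>\<omega>. a i j \<omega> * monomial a es \<omega> * monomial b fs \<omega> * (b k l \<omega> * H \<omega>)) =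
      expectation (\<lambda>\<omega>. monomial b fs \<omega> * (deriv_monomial a i j es \<omega> * (b k l \<omega> * H \<omega>)
        + monomial a es \<omega> * (0 * H \<omega> + b k l \<omega> * E i j \<omega>)))"
      by (simp add: algebra_simps)
  qed (use wick_b b_moments[OF wick_b(1,2)] in
    \<open>auto simp: wick_multiplier_def intro!: all_moments_add all_moments_mult\<close>)
next
  case (wick_add F D G D')
  have mom: "all_moments F" "all_moments (D i j)" "all_moments G" "all_moments (D' i j)"
      "all_moments H" "all_moments (E i j)" for i j
    using wick_add wick_poly_moments by (auto simp: wick_multiplier_def)
  show ?case unfolding wick_multiplier_def
  proof (intro conjI allI impI)
    fix i j and es fs :: "(nat \<times> nat) list"
    assume *: "i < N" "j < N" "set es \<subseteq> {..<N} \<times> {..<N}" "set fs \<subseteq> {..<N} \<times> {..<N}"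
    note m = mom a_moments[OF *(1,2)] monomial_a_moments[OF *(3)] monomial_b_moments[OF *(4)]
      deriv_monomial_moments[OF *(3)]
    define P Q where "P = (\<lambda>\<omega>. a i j \<omega> * monomial a es \<omega> * monomial b fs \<omega> * (F \<omega> * H \<omega>))"
      and "Q = (\<lambda>\<omega>. a i j \<omega> * monomial a es \<omega> * monomial b fs \<omega> * (G \<omega> * H \<omega>))"
    define P' Q' where "P' = (\<lambda>\<omega>. monomial b fs \<omega> * (deriv_monomial a i j es \<omega> * (F \<omega> * H \<omega>)
        + monomial a es \<omega> * (D i j \<omega> * H \<omega> + F \<omega> * E i j \<omega>)))"
      and "Q' = (\<lambda>\<omega>. monomial b fs \<omega> * (deriv_monomial a i j es \<omega> * (G \<omega> * H \<omega>)
        + monomial a es \<omega> * (D' i j \<omega> * H \<omega> + G \<omega> * E i j \<omega>)))"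
    have int: "integrable M P" "integrable M Q" "integrable M P'" "integrable M Q'"
      unfolding P_def Q_def P'_def Q'_def
      by (intro all_moments_integrable all_moments_mult all_moments_add m)+
    have "expectation (\<lambda>\<omega>. P \<omega> + Q \<omega>) = expectation (\<lambda>\<omega>. P' \<omega> + Q' \<omega>)"
      using wick_multiplierD[OF wick_add.IH(1)[OF wick_add.prems] *]
        wick_multiplierD[OF wick_add.IH(2)[OF wick_add.prems] *] int
      unfolding P_def[symmetric] Q_def[symmetric] P'_def[symmetric] Q'_def[symmetric]
      by simp
    then show "expectation (\<lambda>\<omega>. a i j \<omega> * monomial a es \<omega> * monomial b fs \<omega> * ((F \<omega> + G \<omega>) * H \<omega>)) =
      expectation (\<lambda>\<omega>. monomial b fs \<omega> * (deriv_monomial a i j es \<omega> * ((F \<omega> + G \<omega>) * H \<omega>)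
        + monomial a es \<omega> * ((D i j \<omega> + D' i j \<omega>) * H \<omega> + (F \<omega> + G \<omega>) * E i j \<omega>)))"
      unfolding P_def Q_def P'_def Q'_def by (simp add: algebra_simps)
  qed (intro all_moments_mult all_moments_add mom)+
next
  case (wick_mult F D G D')
  have "wick_multiplier (\<lambda>\<omega>. F \<omega> * (G \<omega> * H \<omega>))
     (\<lambda>i j \<omega>. D i j \<omega> * (G \<omega> * H \<omega>) + F \<omega> * (D' i j \<omega> * H \<omega> + G \<omega> * E i j \<omega>))"
    by (intro wick_mult.IH wick_mult.prems)
  then show ?case by (simp add: algebra_simps)
qed

lemma wick_multiplier_one: "wick_multiplier (\<lambda>_. 1) (\<lambda>_ _ _. 0)"
  unfolding wick_multiplier_def using wick by (auto simp: mult_ac)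

text \<open>
  Gaussian integration by parts for polynomials in the entries.
\<close>

lemma integration_by_parts:
  assumes "wick_poly F D" "i < N" "j < N"
  shows "expectation (\<lambda>\<omega>. a i j \<omega> * F \<omega>) = expectation (D i j)"
  using wick_multiplierD[OF wick_poly_multiplier[OF assms(1) wick_multiplier_one] assms(2,3), of "[]" "[]"]
  by simp

text \<open>
  \<open>word_entry w k l\<close> is the entry \<open>(k, l)\<close> of the product of matrices that the word \<open>w\<close> denotes, \<open>tr w\<close> is its
  trace, and \<open>trs ws\<close> is the product of the traces of the words in \<open>ws\<close>.
\<close>

definition letter :: "bool \<Rightarrow> nat \<Rightarrow> nat \<Rightarrow> 'w \<Rightarrow> real" where
  "letter x = (if x then a else b)"

fun word_entry :: "bool list \<Rightarrow> nat \<Rightarrow> nat \<Rightarrow> 'w \<Rightarrow> real" where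
  "word_entry [] k l \<omega> = of_bool (k = l)"
| "word_entry (x # w) k l \<omega> = (\<Sum>q<N. letter x k q \<omega> * word_entry w q l \<omega>)"

definition tr :: "bool list \<Rightarrow> 'w \<Rightarrow> real" where
  "tr w \<omega> = (\<Sum>k<N. word_entry w k k \<omega>)"

lemma letter_sym: "letter x k l = letter x l k"
  by (simp add: letter_def a_sym[of k] b_sym[of k])

lemma sum_delta_lessThan:
  fixes f :: "nat \<Rightarrow> real"
  assumes "k < N"
  shows "(\<Sum>q<N. of_bool (k = q) * f q) = f k" "(\<Sum>q<N. f q * of_bool (q = k)) = f k"
proof -
  have "(\<Sum>q<N. of_bool (k = q) * f q) = (\<Sum>q<N. if q = k then f q else 0)"
    "(\<Sum>q<N. f q * of_bool (q = k)) = (\<Sum>q<N. if q = k then f q else 0)"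
    by (rule sum.cong; simp)+
  then show "(\<Sum>q<N. of_bool (k = q) * f q) = f k" "(\<Sum>q<N. f q * of_bool (q = k)) = f k"
    using assms by simp_all
qed

lemma word_entry_append:
  assumes "k < N"
  shows "word_entry (u @ v) k l \<omega> = (\<Sum>q<N. word_entry u k q \<omega> * word_entry v q l \<omega>)"
  using assms
proof (induction u arbitrary: k)
  case Nil
  then show ?case by (simp add: sum_delta_lessThan)
next
  case (Cons x u)
  have "word_entry ((x # u) @ v) k l \<omega> =
      (\<Sum>r<N. \<Sum>q<N. letter x k r \<omega> * (word_entry u r q \<omega> * word_entry v q l \<omega>))"
    by (simp add: Cons.IH sum_distrib_left)
  also have "\<dots> = (\<Sum>q<N. \<Sum>r<N. letter x k r \<omega> * (word_entry u r q \<omega> * word_entry v q l \<omega>))"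
    by (rule sum.swap)
  also have "\<dots> = (\<Sum>q<N. word_entry (x # u) k q \<omega> * word_entry v q l \<omega>)"
    by (simp add: sum_distrib_right mult.assoc)
  finally show ?case .
qed

lemma word_entry_rev:
  assumes "k < N" "l < N"
  shows "word_entry (rev w) k l \<omega> = word_entry w l k \<omega>"
  using assms
proof (induction w arbitrary: k l)
  case (Cons x w)
  have "word_entry (rev (x # w)) k l \<omega> = (\<Sum>q<N. word_entry (rev w) k q \<omega> * word_entry [x] q l \<omega>)"
    using Cons.prems by (simp add: word_entry_append)
  also have "\<dots> = (\<Sum>q<N. letter x l q \<omega> * word_entry w q k \<omega>)"
    using Cons.prems by (intro sum.cong) (simp_all add: Cons.IH sum_delta_lessThan letter_sym[of x l])
  finally show ?case by simp
qed auto

lemma sum_entries_eq_tr: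
  "(\<Sum>i<N. \<Sum>j<N. word_entry u i j \<omega> * word_entry v j i \<omega>) = tr (u @ v) \<omega>"
  by (simp add: tr_def word_entry_append)

lemma tr_rotate: "tr (u @ v) \<omega> = tr (v @ u) \<omega>"
proof -
  have "tr (u @ v) \<omega> = (\<Sum>j<N. \<Sum>i<N. word_entry u i j \<omega> * word_entry v j i \<omega>)"
    unfolding sum_entries_eq_tr[symmetric] by (rule sum.swap)
  also have "\<dots> = tr (v @ u) \<omega>"
    unfolding sum_entries_eq_tr[symmetric] by (simp add: mult.commute)
  finally show ?thesis .
qed

text \<open>
  Derivatives in the direction of \<open>a i j\<close>, matching the pairs in \<open>wick_poly\<close>. Lemma \<open>deriv_word_entry_eq\<close>
  identifies the derivative of an entry as a sum over the occurrences of \<open>A\<close> in the word; the two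
  summands come from the two entries \<open>(i, j)\<close> and \<open>(j, i)\<close>.
\<close>

fun deriv_word_entry :: "nat \<Rightarrow> nat \<Rightarrow> bool list \<Rightarrow> nat \<Rightarrow> nat \<Rightarrow> 'w \<Rightarrow> real" where
  "deriv_word_entry i j [] k l \<omega> = 0"
| "deriv_word_entry i j (x # w) k l \<omega> =
    (\<Sum>q<N. (if x then goe_cov i j k q else 0) * word_entry w q l \<omega> + letter x k q \<omega> * deriv_word_entry i j w q l \<omega>)"

lemma wick_letter:
  assumes "k < N" "l < N"
  shows "wick_poly (letter x k l) (\<lambda>i j _. if x then goe_cov i j k l else 0)"
  using wick_a[OF assms] wick_b[OF assms] by (cases x) (simp_all add: letter_def)

lemma wick_word_entry:
  assumes "k < N" "l < N"
  shows "wick_poly (word_entry w k l) (\<lambda>i j. deriv_word_entry i j w k l)"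
  using assms
proof (induction w arbitrary: k)
  case Nil
  show ?case using wick_const[of "of_bool (k = l)"] by (simp cong: if_cong)
next
  case (Cons x w)
  have "wick_poly (\<lambda>\<omega>. \<Sum>q<N. letter x k q \<omega> * word_entry w q l \<omega>)
    (\<lambda>i j \<omega>. \<Sum>q<N. (if x then goe_cov i j k q else 0) * word_entry w q l \<omega>
       + letter x k q \<omega> * deriv_word_entry i j w q l \<omega>)"
    using Cons by (intro wick_sum wick_mult wick_letter) auto
  then show ?case by simp
qed

lemma deriv_word_entry_eq:
  assumes "i < N" "j < N" "k < N"
  shows "deriv_word_entry i j w k l \<omega> = (\<Sum>(u, v)\<leftarrow>splits w.
    word_entry u k i \<omega> * word_entry v j l \<omega> + word_entry u k j \<omega> * word_entry v i l \<omega>)"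
  using assms(3)
proof (induction w arbitrary: k)
  case (Cons x w)
  have 1: "(\<Sum>q<N. goe_cov i j k q * word_entry w q l \<omega>) =
     of_bool (k = i) * word_entry w j l \<omega> + of_bool (k = j) * word_entry w i l \<omega>"
  proof -
    have "(\<Sum>q<N. goe_cov i j k q * word_entry w q l \<omega>) =
      (\<Sum>q<N. of_bool (j = q) * (of_bool (k = i) * word_entry w q l \<omega>)
         + of_bool (i = q) * (of_bool (k = j) * word_entry w q l \<omega>))"
      by (intro sum.cong) (auto simp: goe_cov_def)
    then show ?thesis
      unfolding sum.distrib using assms by (simp only: sum_delta_lessThan)
  qed
  have 2: "(\<Sum>q<N. letter x k q \<omega> * deriv_word_entry i j w q l \<omega>) = (\<Sum>(u, v)\<leftarrow>splits w.
    word_entry (x # u) k i \<omega> * word_entry v j l \<omega> + word_entry (x # u) k j \<omega> * word_entry v i l \<omega>)"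
  proof -
    have "(\<Sum>q<N. letter x k q \<omega> * deriv_word_entry i j w q l \<omega>) =
      (\<Sum>q<N. \<Sum>(u, v)\<leftarrow>splits w. letter x k q \<omega> * (word_entry u q i \<omega> * word_entry v j l \<omega>
         + word_entry u q j \<omega> * word_entry v i l \<omega>))"
      by (intro sum.cong refl) (simp add: Cons.IH flip: sum_list_const_mult cong: map_cong add: case_prod_unfold)
    also have "\<dots> = (\<Sum>(u, v)\<leftarrow>splits w. \<Sum>q<N. letter x k q \<omega> * (word_entry u q i \<omega> * word_entry v j l \<omega>
         + word_entry u q j \<omega> * word_entry v i l \<omega>))"
      by (induction "splits w") (auto simp: sum.distrib case_prod_unfold sum_list_sum_nth sum.swap[of _ "{0..<length (splits w)}"])
    finally show ?thesis
      by (simp add: distrib_left sum.distrib sum_distrib_right mult.assoc)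
  qed
  show ?case
    using 1 2 by (simp add: sum.distrib comp_def case_prod_unfold)
qed simp

definition deriv_tr :: "nat \<Rightarrow> nat \<Rightarrow> bool list \<Rightarrow> 'w \<Rightarrow> real" where
  "deriv_tr i j w \<omega> = (\<Sum>k<N. deriv_word_entry i j w k k \<omega>)"

lemma sum_sum_list_swap:
  fixes f :: "'i \<Rightarrow> 'x \<Rightarrow> real"
  shows "(\<Sum>i\<in>I. \<Sum>x\<leftarrow>xs. f i x) = (\<Sum>x\<leftarrow>xs. \<Sum>i\<in>I. f i x)"
  by (induction xs) (simp_all add: sum.distrib)

lemma wick_tr: "wick_poly (tr w) (\<lambda>i j. deriv_tr i j w)"
proof -
  have "wick_poly (\<lambda>\<omega>. \<Sum>k<N. word_entry w k k \<omega>) (\<lambda>i j \<omega>. \<Sum>k<N. deriv_word_entry i j w k k \<omega>)"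
    by (intro wick_sum wick_word_entry) auto
  then show ?thesis by (simp add: tr_def[abs_def] deriv_tr_def[abs_def])
qed

lemma deriv_tr_eq:
  assumes "i < N" "j < N"
  shows "deriv_tr i j w \<omega> = (\<Sum>(u, v)\<leftarrow>splits w. word_entry (v @ u) j i \<omega> + word_entry (v @ u) i j \<omega>)"
proof -
  have "deriv_tr i j w \<omega> = (\<Sum>k<N. \<Sum>(u, v)\<leftarrow>splits w.
    word_entry u k i \<omega> * word_entry v j k \<omega> + word_entry u k j \<omega> * word_entry v i k \<omega>)"
    unfolding deriv_tr_def using assms by (intro sum.cong) (auto simp: deriv_word_entry_eq)
  also have "\<dots> = (\<Sum>(u, v)\<leftarrow>splits w. word_entry (v @ u) j i \<omega> + word_entry (v @ u) i j \<omega>)"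
    using assms
    by (simp add: sum_sum_list_swap case_prod_unfold sum.distrib word_entry_append mult.commute)
  finally show ?thesis .
qed

definition trs :: "bool list list \<Rightarrow> 'w \<Rightarrow> real" where
  "trs ws \<omega> = (\<Prod>w\<leftarrow>ws. tr w \<omega>)"

lemma trs_simps [simp]: "trs [] \<omega> = 1" "trs (w # ws) \<omega> = tr w \<omega> * trs ws \<omega>"
  by (simp_all add: trs_def)

fun deriv_trs :: "nat \<Rightarrow> nat \<Rightarrow> bool list list \<Rightarrow> 'w \<Rightarrow> real" where
  "deriv_trs i j [] \<omega> = 0"
| "deriv_trs i j (w # ws) \<omega> = deriv_tr i j w \<omega> * trs ws \<omega> + tr w \<omega> * deriv_trs i j ws \<omega>"

lemma wick_trs: "wick_poly (trs ws) (\<lambda>i j. deriv_trs i j ws)"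
proof (induction ws)
  case Nil
  show ?case using wick_const[of 1] by (simp add: trs_def[abs_def] fun_eq_iff[symmetric] cong: if_cong)
next
  case (Cons w ws)
  from wick_mult[OF wick_tr Cons] show ?case by simp
qed

lemma trs_moments: "all_moments (trs ws)"
  using wick_poly_moments wick_trs by blast

lemma sum_entry_deriv_trs:
  "(\<Sum>i<N. \<Sum>j<N. word_entry v j i \<omega> * deriv_trs i j ws \<omega>) = (\<Sum>us\<leftarrow>merged_words v ws. trs us \<omega>)"
proof (induction ws)
  case (Cons w ws)
  have "(\<Sum>i<N. \<Sum>j<N. word_entry v j i \<omega> * deriv_tr i j w \<omega>) =
     (\<Sum>i<N. \<Sum>j<N. \<Sum>(p, q)\<leftarrow>splits w.
        word_entry (rev v) i j \<omega> * word_entry (q @ p) j i \<omega> + word_entry (q @ p) i j \<omega> * word_entry v j i \<omega>)"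
    by (intro sum.cong)
      (auto simp: deriv_tr_eq word_entry_rev sum_list_const_mult[symmetric] distrib_left mult_ac case_prod_unfold)
  also have "\<dots> = (\<Sum>(p, q)\<leftarrow>splits w. tr (rev v @ q @ p) \<omega> + tr (v @ q @ p) \<omega>)"
    by (simp add: sum_sum_list_swap case_prod_unfold sum.distrib sum_entries_eq_tr tr_rotate[of v])
  finally have 1: "(\<Sum>i<N. \<Sum>j<N. word_entry v j i \<omega> * deriv_tr i j w \<omega>) =
    (\<Sum>(p, q)\<leftarrow>splits w. tr (rev v @ q @ p) \<omega> + tr (v @ q @ p) \<omega>)" .
  have "(\<Sum>i<N. \<Sum>j<N. word_entry v j i \<omega> * deriv_trs i j (w # ws) \<omega>) =
     (\<Sum>i<N. \<Sum>j<N. word_entry v j i \<omega> * deriv_tr i j w \<omega>) * trs ws \<omega>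
     + tr w \<omega> * (\<Sum>i<N. \<Sum>j<N. word_entry v j i \<omega> * deriv_trs i j ws \<omega>)"
    by (simp add: sum_distrib_left sum_distrib_right sum.distrib distrib_left mult_ac)
  then show ?case
    unfolding 1 Cons.IH
    by (simp add: sum_list_const_mult[symmetric] sum_list_mult_const[symmetric] comp_def
      case_prod_unfold sum_list_addf distrib_right)
qed simp

lemma expectation_sum_list_trs:
  "expectation (\<lambda>\<omega>. \<Sum>x\<leftarrow>xs. trs (f x) \<omega>) = (\<Sum>x\<leftarrow>xs. expectation (trs (f x)))"
proof (induction xs)
  case (Cons x xs)
  have "integrable M (\<lambda>\<omega>. \<Sum>x\<leftarrow>xs. trs (f x) \<omega>)"
    by (intro all_moments_integrable all_moments_sum_list trs_moments)
  then show ?case using Cons all_moments_integrable[OF trs_moments] by simp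
qed simp

text \<open>
  The loop equation. With \<open>v\<close> split as \<open>p A q\<close>, the first sum collects the pairings that cut the trace
  into two traces. Every pairing removes two letters, but only these also create an additional
  trace; the others are of lower order in \<open>N\<close>.
\<close>

theorem trace_recursion:
  "expectation (trs ((True # v) # ws)) =
    (\<Sum>(p, q)\<leftarrow>splits v. expectation (trs (p # q # ws))) + (\<Sum>us\<leftarrow>error_words v ws. expectation (trs us))"
proof -
  define D where "D i j \<omega> = deriv_word_entry i j v j i \<omega> * trs ws \<omega> + word_entry v j i \<omega> * deriv_trs i j ws \<omega>" for i j \<omega>
  define F where "F i j \<omega> = word_entry v j i \<omega> * trs ws \<omega>" for i j \<omega>
  have ae: "trs ((True # v) # ws) \<omega> = (\<Sum>i<N. \<Sum>j<N. a i j \<omega> * F i j \<omega>)" for \<omega>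
    by (simp add: tr_def F_def letter_def sum_distrib_right mult.assoc)
  have W: "wick_poly (F i j) (\<lambda>k l \<omega>. deriv_word_entry k l v j i \<omega> * trs ws \<omega> + word_entry v j i \<omega> * deriv_trs k l ws \<omega>)"
    if "i < N" "j < N" for i j
    unfolding F_def[abs_def] using that by (intro wick_mult wick_word_entry wick_trs)
  have FD: "expectation (\<lambda>\<omega>. a i j \<omega> * F i j \<omega>) = expectation (D i j)" if "i < N" "j < N" for i j
    unfolding D_def[abs_def] using integration_by_parts[OF W[OF that] that] .
  have intF: "integrable M (\<lambda>\<omega>. a i j \<omega> * F i j \<omega>)" if "i < N" "j < N" for i j
    using that wick_poly_moments[OF W[OF that]] by (intro all_moments_integrable all_moments_mult a_moments) auto
  have intD: "integrable M (D i j)" if "i < N" "j < N" for i j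
    using wick_poly_moments[OF W[OF that], of i j] all_moments_integrable
    unfolding D_def[abs_def] by blast
  have dsum: "expectation (\<lambda>\<omega>. \<Sum>i<N. \<Sum>j<N. G i j \<omega>) = (\<Sum>i<N. \<Sum>j<N. expectation (G i j))"
    if int: "\<And>i j. i < N \<Longrightarrow> j < N \<Longrightarrow> integrable M (G i j)" for G :: "nat \<Rightarrow> nat \<Rightarrow> 'w \<Rightarrow> real"
  proof -
    have "expectation (\<lambda>\<omega>. \<Sum>i<N. \<Sum>j<N. G i j \<omega>) = (\<Sum>i<N. expectation (\<lambda>\<omega>. \<Sum>j<N. G i j \<omega>))"
      by (rule Bochner_Integration.integral_sum) (auto intro!: int)
    also have "\<dots> = (\<Sum>i<N. \<Sum>j<N. expectation (G i j))"
      by (intro sum.cong refl Bochner_Integration.integral_sum) (auto intro!: int)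
    finally show ?thesis .
  qed
  have "expectation (trs ((True # v) # ws)) = (\<Sum>i<N. \<Sum>j<N. expectation (D i j))"
    unfolding ae[abs_def] by (subst dsum) (auto intro!: intF sum.cong FD)
  also have "\<dots> = expectation (\<lambda>\<omega>. \<Sum>i<N. \<Sum>j<N. D i j \<omega>)"
    using dsum[of D, OF intD] by simp
  also have "(\<lambda>\<omega>. \<Sum>i<N. \<Sum>j<N. D i j \<omega>) =
      (\<lambda>\<omega>. (\<Sum>(p, q)\<leftarrow>splits v. trs (p # q # ws) \<omega>) + (\<Sum>us\<leftarrow>error_words v ws. trs us \<omega>))"
  proof
    fix \<omega>
    have "(\<Sum>i<N. \<Sum>j<N. deriv_word_entry i j v j i \<omega>) = (\<Sum>i<N. \<Sum>j<N. \<Sum>(p, q)\<leftarrow>splits v.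
        word_entry p j j \<omega> * word_entry q i i \<omega> + word_entry (rev p) i j \<omega> * word_entry q j i \<omega>)"
      by (intro sum.cong) (auto simp: deriv_word_entry_eq word_entry_rev case_prod_unfold add.commute)
    also have "\<dots> = (\<Sum>(p, q)\<leftarrow>splits v. tr p \<omega> * tr q \<omega> + tr (rev p @ q) \<omega>)"
      by (simp add: sum_sum_list_swap case_prod_unfold sum.distrib sum_entries_eq_tr)
        (simp add: tr_def sum_distrib_left sum_distrib_right)
    finally have "(\<Sum>i<N. \<Sum>j<N. D i j \<omega>) = (\<Sum>(p, q)\<leftarrow>splits v. tr p \<omega> * tr q \<omega> + tr (rev p @ q) \<omega>) * trs ws \<omega>
        + (\<Sum>us\<leftarrow>merged_words v ws. trs us \<omega>)"
      by (simp add: D_def sum.distrib sum_entry_deriv_trs flip: sum_distrib_right)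
    then show "(\<Sum>i<N. \<Sum>j<N. D i j \<omega>) =
      (\<Sum>(p, q)\<leftarrow>splits v. trs (p # q # ws) \<omega>) + (\<Sum>us\<leftarrow>error_words v ws. trs us \<omega>)"
      by (simp add: error_words_def comp_def case_prod_unfold sum_list_addf distrib_right
        sum_list_mult_const[symmetric] mult.assoc)
  qed
  also have "expectation \<dots> = (\<Sum>(p, q)\<leftarrow>splits v. expectation (trs (p # q # ws)))
      + (\<Sum>us\<leftarrow>error_words v ws. expectation (trs us))"
  proof -
    have i: "integrable M (\<lambda>\<omega>. \<Sum>x\<leftarrow>xs. trs (f x) \<omega>)" for xs :: "'x list" and f
      by (intro all_moments_integrable all_moments_sum_list trs_moments)
    show ?thesis
      using Bochner_Integration.integral_add[OF i[of "\<lambda>(p, q). p # q # ws" "splits v"] i[of "\<lambda>x. x" "error_words v ws"]]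
        expectation_sum_list_trs[of "\<lambda>(p, q). p # q # ws" "splits v"]
        expectation_sum_list_trs[of "\<lambda>x. x" "error_words v ws"]
      by (simp add: case_prod_unfold)
  qed
  finally show ?thesis .
qed

end

section \<open>Lists of residues and moments of independent variables\<close>

text \<open>
  Residues modulo \<open>n\<close> are represented by the integers in \<open>{0..<n}\<close>. The residues \<open>x\<close> and \<open>-x\<close> form one
  class, labelled by the smaller of \<open>x\<close> and \<open>n - x\<close>; this label is the index of the parameter that stands
  at distance \<open>x\<close> from the diagonal of the circulant matrix.
\<close>

definition residue_class :: "nat \<Rightarrow> int \<Rightarrow> nat" where
  "residue_class n x = nat (min x (int n - x))"

text \<open>
  Lists of \<open>k\<close> residues, and those among them whose sum vanishes modulo \<open>n\<close>.
\<close>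

definition residue_lists :: "nat \<Rightarrow> nat \<Rightarrow> int list set" where
  "residue_lists n k = {xs. set xs \<subseteq> {0..<int n} \<and> length xs = k}"

definition zero_sum_lists :: "nat \<Rightarrow> nat \<Rightarrow> int list set" where
  "zero_sum_lists n k = {xs \<in> residue_lists n k. int n dvd sum_list xs}"

definition delete_nth :: "nat \<Rightarrow> 'a list \<Rightarrow> 'a list" where
  "delete_nth l xs = take l xs @ drop (Suc l) xs"

lemma finite_residue_lists [simp]: "finite (residue_lists n k)"
  unfolding residue_lists_def by (rule finite_lists_length_eq) simp

lemma finite_zero_sum_lists [simp]: "finite (zero_sum_lists n k)"
  by (simp add: zero_sum_lists_def)

lemma residue_lists_0 [simp]: "residue_lists n 0 = {[]}"
  by (auto simp: residue_lists_def)

lemma zero_sum_lists_0 [simp]: "zero_sum_lists n 0 = {[]}"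
  by (auto simp: zero_sum_lists_def)

lemma sum_residue_lists_append:
  fixes f :: "int list \<Rightarrow> real"
  shows "(\<Sum>xs\<in>residue_lists n k. \<Sum>zs\<in>residue_lists n q. f (xs @ zs)) = (\<Sum>us\<in>residue_lists n (k + q). f us)"
proof -
  have "(\<Sum>us\<in>residue_lists n (k + q). f us) =
      (\<Sum>(xs, zs)\<in>residue_lists n k \<times> residue_lists n q. f (xs @ zs))"
    by (rule sum.reindex_bij_witness[of _ "\<lambda>(xs, zs). xs @ zs" "\<lambda>us. (take k us, drop k us)"])
      (auto simp: residue_lists_def dest: in_set_takeD in_set_dropD)
  then show ?thesis by (simp add: sum.cartesian_product)
qed

lemma sum_residue_lists_insert:
  fixes f :: "int list \<Rightarrow> real"
  assumes "l \<le> k"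
  shows "(\<Sum>ys\<in>residue_lists n (Suc k). f ys) =
    (\<Sum>ys\<in>residue_lists n k. \<Sum>y\<in>{0..<int n}. f (take l ys @ y # drop l ys))"
proof -
  have *: "take l ys @ ys ! l # drop (Suc l) ys = ys" if "length ys = Suc k" for ys :: "int list"
    using that assms by (simp add: id_take_nth_drop[symmetric])
  have nth: "ys ! l \<in> {0..<int n}" if "set ys \<subseteq> {0..<int n}" "length ys = Suc k" for ys
    using that assms nth_mem[of l ys] by (auto simp del: nth_mem)
  have "(\<Sum>ys\<in>residue_lists n (Suc k). f ys) =
      (\<Sum>(ys, y)\<in>residue_lists n k \<times> {0..<int n}. f (take l ys @ y # drop l ys))"
    by (rule sum.reindex_bij_witness[of _ "\<lambda>(ys, y). take l ys @ y # drop l ys" "\<lambda>ys. (delete_nth l ys, ys ! l)"])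
      (use assms nth in \<open>auto simp: residue_lists_def delete_nth_def * nth_append min_def
         dest: in_set_takeD in_set_dropD\<close>)
  then show ?thesis by (simp add: sum.cartesian_product)
qed

lemma delete_nth_insert: "l \<le> length ys \<Longrightarrow> delete_nth l (take l ys @ y # drop l ys) = ys"
  by (simp add: delete_nth_def)

lemma nth_insert: "l \<le> length ys \<Longrightarrow> (take l ys @ y # drop l ys) ! l = y"
  by (simp add: nth_append)

lemma sum_list_insert: "sum_list (take l ys @ y # drop l ys) = y + sum_list (ys :: int list)"
proof -
  have "sum_list (take l ys) + sum_list (drop l ys) = sum_list ys"
    by (simp flip: sum_list_append)
  then show ?thesis by simp
qed

lemma residue_class_eq_iff:
  assumes "x \<in> {0..<int n}" "y \<in> {0..<int n}"
  shows "residue_class n x = residue_class n y \<longleftrightarrow> x = y \<or> x = (- y) mod int n"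
proof (cases "y = 0")
  case True
  then show ?thesis using assms by (auto simp: residue_class_def min_def split: if_splits)
next
  case False
  have "(- y) mod int n = (- y + int n) mod int n" by simp
  also have "\<dots> = int n - y" using assms False by (subst mod_pos_pos_trivial) auto
  finally show ?thesis
    using assms False by (auto simp: residue_class_def min_def split: if_splits)
qed

lemma residue_class_bound:
  assumes "x \<in> {0..<int n}"
  shows "int (residue_class n x) \<in> {0..<int n}"
  using assms by (auto simp: residue_class_def min_def)

text \<open>
  A list of length \<open>k\<close> with at most \<open>r\<close> classes is determined by \<open>r\<close> residues and, for each
  position, a choice of one of these residues together with a sign.
\<close>

lemma card_few_classes_le:
  assumes "n > 0"
  shows "card {xs \<in> residue_lists n k. card (residue_class n ` set xs) \<le> r} \<le> (2 * r) ^ k * n ^ r"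
proof -
  define G where "G = residue_lists n r"
  define H where "H = {hs :: (nat \<times> bool) list. set hs \<subseteq> {..<r} \<times> UNIV \<and> length hs = k}"
  define F where "F = (\<lambda>(gs, hs). map (\<lambda>(j :: nat, s). if s then gs ! j else int n - gs ! j) hs)"
  have fin: "finite G" "finite H"
    unfolding G_def H_def by (auto intro: finite_lists_length_eq)
  have "xs \<in> F ` (G \<times> H)" if xs: "xs \<in> residue_lists n k" "card (residue_class n ` set xs) \<le> r" for xs
  proof -
    obtain ds where ds: "set ds = residue_class n ` set xs" "distinct ds"
      using finite_distinct_list by (metis List.finite_set finite_imageI)
    define gs where "gs = map int ds @ replicate (r - length ds) 0"
    have len: "length ds \<le> r" using ds xs(2) by (simp add: distinct_card[symmetric])
    have V: "set xs \<subseteq> {0..<int n}" "length xs = k" using xs by (auto simp: residue_lists_def)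
    have "set gs \<subseteq> {0..<int n}"
      using assms V(1) ds(1) residue_class_bound by (auto simp: gs_def)
    moreover have "length gs = r" using len by (simp add: gs_def)
    ultimately have gs: "gs \<in> G" by (simp add: G_def residue_lists_def)
    have "\<exists>p. fst p < r \<and> x = (if snd p then gs ! fst p else int n - gs ! fst p)" if x: "x \<in> set xs" for x
    proof -
      have "residue_class n x \<in> set ds" using x ds by simp
      then obtain j where j: "j < length ds" "ds ! j = residue_class n x"
        by (auto simp: in_set_conv_nth)
      then have g: "gs ! j = min x (int n - x)"
        using V(1) x by (auto simp: gs_def nth_append residue_class_def)
      show ?thesis
        using g j(1) len by (intro exI[of _ "(j, x \<le> int n - x)"]) (auto simp: min_def)
    qed
    then obtain ch where ch: "\<And>x. x \<in> set xs \<Longrightarrow> fst (ch x) < r \<and>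
        x = (if snd (ch x) then gs ! fst (ch x) else int n - gs ! fst (ch x))"
      by metis
    have "(if snd (ch x) then gs ! fst (ch x) else int n - gs ! fst (ch x)) = x" if "x \<in> set xs" for x
      using ch[OF that] by presburger
    then have "xs = F (gs, map ch xs)"
      unfolding F_def case_prod_unfold fst_conv snd_conv map_map comp_def
      by (intro map_idI[symmetric])
    moreover have "fst (ch x) < r" if "x \<in> set xs" for x
      using ch[OF that] by blast
    then have "map ch xs \<in> H" using V(2) by (simp add: H_def image_subset_iff mem_Times_iff)
    ultimately show ?thesis using gs by (metis SigmaI image_eqI)
  qed
  then have "card {xs \<in> residue_lists n k. card (residue_class n ` set xs) \<le> r} \<le> card (F ` (G \<times> H))"
    using fin by (intro card_mono) auto
  also have "\<dots> \<le> card (G \<times> H)" using fin by (intro card_image_le) auto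
  also have "\<dots> = (2 * r) ^ k * n ^ r"
    by (simp add: G_def H_def residue_lists_def card_lists_length_eq card_cartesian_product mult_ac)
  finally show ?thesis .
qed

lemma card_few_classes_sqrt:
  assumes "n > 0"
  shows "real (card {xs \<in> residue_lists n k. 2 * card (residue_class n ` set xs) \<le> j})
    \<le> real ((2 * j) ^ k) * sqrt n ^ j"
proof -
  have "{xs \<in> residue_lists n k. 2 * card (residue_class n ` set xs) \<le> j} =
    {xs \<in> residue_lists n k. card (residue_class n ` set xs) \<le> j div 2}"
    by auto
  then have "real (card {xs \<in> residue_lists n k. 2 * card (residue_class n ` set xs) \<le> j})
      \<le> real ((2 * (j div 2)) ^ k * n ^ (j div 2))"
    using card_few_classes_le[OF assms, of k "j div 2"] by (simp only: of_nat_le_iff)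
  also have "\<dots> = real ((2 * (j div 2)) ^ k) * sqrt n ^ (2 * (j div 2))"
    by (simp add: power_mult)
  also have "\<dots> \<le> real ((2 * j) ^ k) * sqrt n ^ j"
    using assms by (intro mult_mono power_increasing of_nat_mono power_mono) auto
  finally show ?thesis .
qed

text \<open>
  The expectation of \<open>X\<^sub>d\<^sub>1 \<cdots> X\<^sub>d\<^sub>k\<close> for the list \<open>cs = [d\<^sub>1, \<dots>, d\<^sub>k]\<close>, where the \<open>X\<^sub>d\<close> are independent and
  have common moments \<open>m 0, m 1, \<dots>\<close>.
\<close>

definition list_moment :: "(nat \<Rightarrow> real) \<Rightarrow> nat list \<Rightarrow> real" where
  "list_moment m cs = (\<Prod>d\<in>set cs. m (count_list cs d))"

lemma list_moment_mset_cong: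
  assumes "mset cs = mset ds"
  shows "list_moment m cs = list_moment m ds"
proof -
  have "count_list cs d = count_list ds d" for d
    using assms by (simp flip: count_mset)
  then show ?thesis
    using mset_eq_setD[OF assms] by (simp add: list_moment_def)
qed

lemma list_moment_abs_le:
  assumes "length cs \<le> K"
  shows "\<bar>list_moment m cs\<bar> \<le> (1 + (\<Sum>p\<le>K. \<bar>m p\<bar>)) ^ K"
proof -
  let ?B = "1 + (\<Sum>p\<le>K. \<bar>m p\<bar>)"
  have B: "1 \<le> ?B" by (simp add: sum_nonneg)
  have "\<bar>m (count_list cs d)\<bar> \<le> ?B" for d
  proof -
    have "count_list cs d \<le> K" using assms count_le_length[of cs d] by simp
    then have "\<bar>m (count_list cs d)\<bar> \<le> (\<Sum>p\<le>K. \<bar>m p\<bar>)"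
      by (intro member_le_sum) auto
    then show ?thesis by simp
  qed
  then have "\<bar>list_moment m cs\<bar> \<le> (\<Prod>d\<in>set cs. ?B)"
    unfolding list_moment_def abs_prod by (intro prod_mono) auto
  also have "\<dots> = ?B ^ card (set cs)" by simp
  also have "\<dots> \<le> ?B ^ K"
    using B assms card_length[of cs] by (intro power_increasing) auto
  finally show ?thesis .
qed

lemma list_moment_once: "d \<notin> set cs \<Longrightarrow> list_moment m (d # cs) = m 1 * list_moment m cs"
  unfolding list_moment_def by (simp add: prod.insert) (intro disjI2 prod.cong refl, auto)

lemma list_moment_twice: "d \<notin> set cs \<Longrightarrow> list_moment m (d # d # cs) = m 2 * list_moment m cs"
  unfolding list_moment_def
  by (simp add: prod.insert numeral_2_eq_2) (intro disjI2 prod.cong refl, auto)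

text \<open>
  For centred variables every index has to be repeated.
\<close>

lemma list_moment_nonzero_card:
  assumes "m 1 = 0" "list_moment m cs \<noteq> 0"
  shows "2 * card (set cs) \<le> length cs"
proof -
  have "2 \<le> count_list cs d" if "d \<in> set cs" for d
  proof -
    have "m (count_list cs d) \<noteq> 0"
      using assms(2) that by (auto simp: list_moment_def)
    then have "count_list cs d \<noteq> 1" using assms(1) by metis
    moreover have "count_list cs d \<noteq> 0" using that by (simp add: count_list_0_iff)
    ultimately show ?thesis by linarith
  qed
  then have "(\<Sum>d\<in>set cs. 2) \<le> (\<Sum>d\<in>set cs. count_list cs d)" by (rule sum_mono)
  then show ?thesis by (simp add: sum_count_set mult.commute)
qed

lemma mset_delete_nth: "l < length cs \<Longrightarrow> mset (delete_nth l cs) = mset cs - {#cs ! l#}"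
proof -
  assume l: "l < length cs"
  have "mset cs = mset (take l cs @ cs ! l # drop (Suc l) cs)"
    using l by (simp add: id_take_nth_drop[symmetric])
  then show ?thesis by (simp add: delete_nth_def)
qed

lemma sum_delete_nth_list_moment:
  "(\<Sum>l<length cs. of_bool (cs ! l = d) * list_moment m (delete_nth l cs)) =
    real (count_list cs d) * list_moment m (remove1 d cs)"
proof -
  have "(\<Sum>l<length cs. of_bool (cs ! l = d) * list_moment m (delete_nth l cs)) =
      (\<Sum>l<length cs. of_bool (cs ! l = d) * list_moment m (remove1 d cs))"
    by (intro sum.cong refl) (auto intro!: list_moment_mset_cong simp: mset_delete_nth)
  also have "\<dots> = real (card {l. l < length cs \<and> cs ! l = d}) * list_moment m (remove1 d cs)"
    by (simp add: sum_distrib_right[symmetric] Int_def lessThan_def)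
  also have "card {l. l < length cs \<and> cs ! l = d} = count_list cs d"
    by (simp add: count_list_eq_length_filter length_filter_conv_card eq_commute)
  finally show ?thesis .
qed

text \<open>
  Approximate integration by parts: the first variable is paired with each equal variable. This is
  exact unless the index \<open>d\<close> occurs at least three times in \<open>d # cs\<close>. In that case either another index is
  isolated and both sides vanish, or the list has fewer distinct indices than a perfect pairing
  would have.
\<close>

lemma list_moment_Cons_approx:
  assumes m: "m 0 = 1" "m 1 = 0" "m 2 = 1" and K: "length cs \<le> K"
  shows "\<bar>list_moment m (d # cs) - (\<Sum>l<length cs. of_bool (cs ! l = d) * list_moment m (delete_nth l cs))\<bar>
    \<le> (1 + real K) * (1 + (\<Sum>p\<le>Suc K. \<bar>m p\<bar>)) ^ Suc K * of_bool (2 * card (set (d # cs)) \<le> length cs)"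
proof -
  let ?B = "(1 + (\<Sum>p\<le>Suc K. \<bar>m p\<bar>)) ^ Suc K"
  have B: "\<bar>list_moment m cs'\<bar> \<le> ?B" if "length cs' \<le> Suc K" for cs'
    using list_moment_abs_le[OF that] .
  have B0: "0 \<le> ?B" by (simp add: sum_nonneg)
  consider "count_list cs d = 0" | "count_list cs d = 1" | "count_list cs d \<ge> 2" by linarith
  then show ?thesis
  proof cases
    case 1
    then have "d \<notin> set cs" by (simp add: count_list_0_iff)
    then show ?thesis using 1 m B0 by (simp add: sum_delete_nth_list_moment list_moment_once)
  next
    case 2
    then have d: "d \<in> set cs" by (metis count_list_0_iff zero_neq_one)
    define rs where "rs = remove1 d cs"
    have ms: "mset cs = mset (d # rs)" using d by (simp add: rs_def)
    have "count_list rs d = 0" using ms 2 by (metis count_list.simps(2) count_mset add_cancel_left_left)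
    then have "d \<notin> set rs" by (simp add: count_list_0_iff)
    moreover have "list_moment m (d # cs) = list_moment m (d # d # rs)"
      by (rule list_moment_mset_cong) (simp add: ms)
    ultimately have "list_moment m (d # cs) = list_moment m rs"
      using m by (simp add: list_moment_twice)
    then show ?thesis using 2 B0 by (simp add: sum_delete_nth_list_moment rs_def)
  next
    case 3
    then have d: "d \<in> set cs" by (metis count_list_0_iff not_numeral_le_zero)
    show ?thesis
    proof (cases "2 * card (set (d # cs)) \<le> length cs")
      case True
      have "real (count_list cs d) * \<bar>list_moment m (remove1 d cs)\<bar> \<le> real K * ?B"
        using K count_le_length[of cs d]
        by (intro mult_mono B) (auto simp: length_remove1)
      moreover have "\<bar>list_moment m (d # cs)\<bar> \<le> ?B"
        using K by (intro B) simp
      moreover have "\<bar>x - y * z\<bar> \<le> \<bar>x\<bar> + y * \<bar>z\<bar>" if "0 \<le> y" for x y z :: real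
        using abs_triangle_ineq4[of x "y * z"] that by (simp add: abs_mult)
      then have "\<bar>list_moment m (d # cs) - real (count_list cs d) * list_moment m (remove1 d cs)\<bar>
          \<le> \<bar>list_moment m (d # cs)\<bar> + real (count_list cs d) * \<bar>list_moment m (remove1 d cs)\<bar>"
        by simp
      ultimately have "\<bar>list_moment m (d # cs) - real (count_list cs d) * list_moment m (remove1 d cs)\<bar>
          \<le> (1 + real K) * ?B"
        unfolding distrib_right mult_1 by linarith
      then show ?thesis
        using True by (simp add: sum_delete_nth_list_moment)
    next
      case False
      \<comment> \<open>with too many distinct indices, one of them is isolated, and both sides vanish\<close>
      have "\<exists>d'. d' \<noteq> d \<and> count_list cs d' = 1"
      proof (rule ccontr)
        assume "\<not> ?thesis"
        moreover have "count_list cs d' \<noteq> 0" if "d' \<in> set cs" for d'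
          using that by (simp add: count_list_0_iff)
        ultimately have "2 \<le> count_list cs d'" if "d' \<in> set cs" for d'
          using that 3 by (metis One_nat_def less_2_cases not_less)
        then have "(\<Sum>d\<in>set cs. 2) \<le> (\<Sum>d\<in>set cs. count_list cs d)" by (rule sum_mono)
        then show False using False d by (simp add: sum_count_set insert_absorb mult.commute)
      qed
      then obtain d' where d': "d' \<noteq> d" "count_list cs d' = 1" by blast
      have z: "list_moment m cs' = 0" if "count_list cs' d' = 1" for cs'
      proof -
        have "d' \<in> set cs'" using that by (metis count_list_0_iff zero_neq_one)
        then show ?thesis using that m by (auto simp: list_moment_def intro!: prod_zero bexI[of _ d'])
      qed
      have "count_list (remove1 d cs) d' = 1"
        using d' by (metis count_mset mset_remove1 count_diff count_single diff_zero)
      then show ?thesis using z d' False B0 by (simp add: sum_delete_nth_list_moment)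
    qed
  qed
qed

section \<open>Zero-sum blocks of residues\<close>

text \<open>
  The expectation of \<open>c(x\<^sub>1) \<cdots> c(x\<^sub>k)\<close>, where \<open>c(x) = c(-x)\<close> and the variables \<open>c(x)\<close> are independent apart
  from this symmetry.
\<close>

definition circ_moment :: "(nat \<Rightarrow> real) \<Rightarrow> nat \<Rightarrow> int list \<Rightarrow> real" where
  "circ_moment m n xs = list_moment m (map (residue_class n) xs)"

lemma circ_moment_mset_cong: "mset xs = mset ys \<Longrightarrow> circ_moment m n xs = circ_moment m n ys"
  unfolding circ_moment_def by (rule list_moment_mset_cong) simp

lemma sum_of_bool_real: "finite S \<Longrightarrow> (\<Sum>x\<in>S. of_bool (P x)) = real (card {x \<in> S. P x})"
  by (simp add: sum_of_bool_eq Int_def)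

text \<open>
  Only lists in which every class is repeated contribute, and they have at most \<open>K/2\<close> classes.
\<close>

lemma sum_abs_circ_moment_le:
  assumes "m 1 = 0"
  shows "\<exists>C\<ge>0. \<forall>n>0. (\<Sum>us\<in>residue_lists n K. \<bar>circ_moment m n us\<bar>) \<le> C * sqrt n ^ K"
proof -
  define B where "B = (1 + (\<Sum>p\<le>K. \<bar>m p\<bar>)) ^ K"
  have B: "B \<ge> 0" by (simp add: B_def sum_nonneg)
  have "(\<Sum>us\<in>residue_lists n K. \<bar>circ_moment m n us\<bar>) \<le> B * real ((2 * K) ^ K) * sqrt n ^ K"
    if "n > 0" for n
  proof -
    have "\<bar>circ_moment m n us\<bar> \<le> B * of_bool (2 * card (residue_class n ` set us) \<le> K)"
      if "us \<in> residue_lists n K" for us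
    proof (cases "circ_moment m n us = 0")
      case False
      have len: "length us = K" using that by (simp add: residue_lists_def)
      have "2 * card (residue_class n ` set us) \<le> K"
        using list_moment_nonzero_card[where m = m, OF assms, of "map (residue_class n) us"] False len
        by (simp add: circ_moment_def)
      then show ?thesis
        using list_moment_abs_le[of "map (residue_class n) us" K m] len by (simp add: circ_moment_def B_def)
    qed (simp add: B)
    then have "(\<Sum>us\<in>residue_lists n K. \<bar>circ_moment m n us\<bar>) \<le>
       (\<Sum>us\<in>residue_lists n K. B * of_bool (2 * card (residue_class n ` set us) \<le> K))"
      by (rule sum_mono)
    also have "\<dots> = B * real (card {us \<in> residue_lists n K. 2 * card (residue_class n ` set us) \<le> K})"
      by (simp only: sum_distrib_left[symmetric] sum_of_bool_real finite_residue_lists)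
    also have "\<dots> \<le> B * (real ((2 * K) ^ K) * sqrt n ^ K)"
      using card_few_classes_sqrt[OF \<open>n > 0\<close>, of K K] B by (intro mult_left_mono)
    finally show ?thesis by (simp add: mult.assoc)
  qed
  then show ?thesis using B by (intro exI[of _ "B * real ((2 * K) ^ K)"]) auto
qed

lemma sum_repeated_classes_le:
  "\<exists>C\<ge>0. \<forall>n>0. (\<Sum>us\<in>residue_lists n (Suc K). of_bool (2 * card (residue_class n ` set us) \<le> K)) \<le> C * sqrt n ^ K"
proof -
  have "(\<Sum>us\<in>residue_lists n (Suc K). of_bool (2 * card (residue_class n ` set us) \<le> K))
      \<le> real ((2 * K) ^ Suc K) * sqrt n ^ K" if "n > 0" for n
    using card_few_classes_sqrt[OF that, of "Suc K" K] by (simp only: sum_of_bool_real finite_residue_lists)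
  then show ?thesis by (intro exI[of _ "real ((2 * K) ^ Suc K)"]) auto
qed

lemma sum_zero_sum_lists_Suc:
  fixes f :: "int list \<Rightarrow> real"
  assumes "n > 0"
  shows "(\<Sum>xs\<in>zero_sum_lists n (Suc k). f xs) =
    (\<Sum>ys\<in>residue_lists n k. f ((- sum_list ys) mod int n # ys))"
proof (rule sum.reindex_bij_witness[of _ "\<lambda>ys. (- sum_list ys) mod int n # ys" tl])
  fix xs assume "xs \<in> zero_sum_lists n (Suc k)"
  then obtain x ys where xs: "xs = x # ys" "x \<in> {0..<int n}" "ys \<in> residue_lists n k" "int n dvd x + sum_list ys"
    by (cases xs) (auto simp: zero_sum_lists_def residue_lists_def)
  have "(- sum_list ys) mod int n = x mod int n"
    using xs(4) by (simp add: mod_eq_dvd_iff minus_add_distrib[symmetric] dvd_minus_iff add.commute del: minus_add_distrib)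
       (metis add.commute dvd_minus_iff minus_add_distrib uminus_add_conv_diff add_uminus_conv_diff)
  then show "(- sum_list (tl xs)) mod int n # tl xs = xs"
    using xs by simp
  then show "f ((- sum_list (tl xs)) mod int n # tl xs) = f xs" by simp
  show "tl xs \<in> residue_lists n k" using xs by simp
next
  fix ys assume "ys \<in> residue_lists n k"
  moreover have "int n dvd (- sum_list ys) mod int n + sum_list ys"
    by (simp add: dvd_eq_mod_eq_0 mod_simps)
  ultimately show "(- sum_list ys) mod int n # ys \<in> zero_sum_lists n (Suc k)"
    using assms by (auto simp: zero_sum_lists_def residue_lists_def)
qed simp_all

lemma card_double_root_le_1:
  assumes "odd n"
  shows "card {y \<in> {0..<int n}. y = (- (y + s)) mod int n} \<le> 1"
proof -
  have "y = z" if y: "y \<in> {0..<int n}" "y = (- (y + s)) mod int n"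
    and z: "z \<in> {0..<int n}" "z = (- (z + s)) mod int n" for y z
  proof -
    have "y mod int n = (- (y + s)) mod int n" "z mod int n = (- (z + s)) mod int n"
      using y z by simp_all
    then have "int n dvd y - - (y + s)" "int n dvd z - - (z + s)"
      unfolding mod_eq_dvd_iff by simp_all
    then have "int n dvd (y - - (y + s)) - (z - - (z + s))" by (rule dvd_diff)
    then have "int n dvd 2 * (y - z)" by (simp add: algebra_simps)
    moreover have "coprime (int n) 2" using assms by simp
    ultimately have "int n dvd y - z" using coprime_dvd_mult_right_iff by blast
    then have "y mod int n = z mod int n" by (simp add: mod_eq_dvd_iff)
    then show ?thesis using y(1) z(1) by simp
  qed
  moreover have "finite {y \<in> {0..<int n}. y = (- (y + s)) mod int n}"
    by (rule finite_subset[of _ "{0..<int n}"]) auto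
  ultimately show ?thesis
    unfolding One_nat_def by (subst card_le_Suc0_iff_eq) blast+
qed

text \<open>
  The residue that completes \<open>ys\<close> to a zero-sum list is \<open>- sum_list ys\<close>. If it is matched with the entry
  \<open>y = ys ! l\<close> with opposite sign, then \<open>y\<close> is arbitrary and the remaining entries have sum zero; this
  gives the main term. If it is matched with equal sign, then \<open>2 y\<close> is prescribed, and \<open>y\<close> is unique
  because \<open>n\<close> is odd.
\<close>

lemma sum_match_same_block:
  fixes G :: "int list \<Rightarrow> real"
  assumes "odd n" "l \<le> j"
  shows "\<bar>(\<Sum>ys\<in>residue_lists n (Suc j).
      of_bool (residue_class n (ys ! l) = residue_class n ((- sum_list ys) mod int n)) * G (delete_nth l ys))
    - real n * (\<Sum>ys\<in>zero_sum_lists n j. G ys)\<bar> \<le> (\<Sum>ys\<in>residue_lists n j. \<bar>G ys\<bar>)"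
proof -
  let ?V = "{0..<int n}"
  have n: "n > 0" using assms(1) by (simp add: odd_pos)
  have "(\<Sum>ys\<in>residue_lists n (Suc j).
      of_bool (residue_class n (ys ! l) = residue_class n ((- sum_list ys) mod int n)) * G (delete_nth l ys)) =
    (\<Sum>ys\<in>residue_lists n j. \<Sum>y\<in>?V. of_bool (residue_class n y = residue_class n ((- (y + sum_list ys)) mod int n)) * G ys)"
    unfolding sum_residue_lists_insert[OF assms(2)] using assms(2)
    by (intro sum.cong refl) (simp only: sum_list_insert nth_insert delete_nth_insert residue_lists_def mem_Collect_eq)
  moreover have "real n * (\<Sum>ys\<in>zero_sum_lists n j. G ys) =
    (\<Sum>ys\<in>residue_lists n j. \<Sum>y\<in>?V. of_bool (int n dvd sum_list ys) * G ys)"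
  proof -
    have "(\<Sum>ys\<in>zero_sum_lists n j. G ys) = (\<Sum>ys\<in>residue_lists n j. if int n dvd sum_list ys then G ys else 0)"
      unfolding zero_sum_lists_def by (rule sum.inter_filter) simp
    then show ?thesis by (auto simp: sum_distrib_left intro!: sum.cong)
  qed
  moreover have "\<bar>(\<Sum>ys\<in>residue_lists n j. \<Sum>y\<in>?V. of_bool (residue_class n y = residue_class n ((- (y + sum_list ys)) mod int n)) * G ys)
     - (\<Sum>ys\<in>residue_lists n j. \<Sum>y\<in>?V. of_bool (int n dvd sum_list ys) * G ys)\<bar>
     \<le> (\<Sum>ys\<in>residue_lists n j. \<bar>G ys\<bar>)"
    unfolding sum_subtractf[symmetric]
  proof (rule order_trans[OF sum_abs], rule sum_mono)
    fix ys :: "int list"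
    let ?s = "sum_list ys"
    let ?x = "\<lambda>y. (- (y + ?s)) mod int n"
    have *: "\<bar>of_bool (residue_class n y = residue_class n (?x y)) - of_bool (int n dvd ?s)\<bar>
        \<le> (of_bool (y = ?x y) :: real)" if "y \<in> ?V" for y
    proof -
      have "residue_class n y = residue_class n (?x y) \<longleftrightarrow> y = ?x y \<or> y = (- ?x y) mod int n"
        by (rule residue_class_eq_iff) (use that n in auto)
      moreover have "(- ?x y) mod int n = (y + ?s) mod int n"
        by (metis add.inverse_inverse mod_minus_eq)
      moreover have "y = (y + ?s) mod int n \<longleftrightarrow> int n dvd ?s"
        using that by (metis add_diff_cancel_left' atLeastLessThan_iff mod_eq_dvd_iff mod_pos_pos_trivial)
      ultimately show ?thesis by auto
    qed
    have "\<bar>\<Sum>y\<in>?V. of_bool (residue_class n y = residue_class n (?x y)) * G ys - of_bool (int n dvd ?s) * G ys\<bar>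
      \<le> (\<Sum>y\<in>?V. \<bar>of_bool (residue_class n y = residue_class n (?x y)) * G ys - of_bool (int n dvd ?s) * G ys\<bar>)"
      by (rule sum_abs)
    also have "\<dots> \<le> (\<Sum>y\<in>?V. of_bool (y = ?x y) * \<bar>G ys\<bar>)"
      unfolding left_diff_distrib[symmetric] abs_mult
      by (intro sum_mono mult_right_mono *) auto
    also have "\<dots> = real (card {y \<in> ?V. y = ?x y}) * \<bar>G ys\<bar>"
      by (simp only: sum_distrib_right[symmetric] sum_of_bool_real finite_atLeastLessThan_int)
    also have "\<dots> \<le> 1 * \<bar>G ys\<bar>"
      using card_double_root_le_1[OF assms(1), of ?s] by (intro mult_right_mono) auto
    finally show "\<bar>\<Sum>y\<in>?V. of_bool (residue_class n y = residue_class n (?x y)) * G ys - of_bool (int n dvd ?s) * G ys\<bar> \<le> \<bar>G ys\<bar>"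
      by simp
  qed
  ultimately show ?thesis by simp
qed

text \<open>
  If the first residue is matched with a residue in another block, then the latter has at most
  two possible values.
\<close>

lemma sum_match_other_block:
  fixes G :: "int list \<Rightarrow> real"
  assumes "Z \<subseteq> residue_lists n (Suc j)" "l \<le> j" "z \<in> {0..<int n}"
  shows "(\<Sum>zs\<in>Z. of_bool (residue_class n (zs ! l) = residue_class n z) * \<bar>G (delete_nth l zs)\<bar>)
    \<le> 2 * (\<Sum>zs\<in>residue_lists n j. \<bar>G zs\<bar>)"
proof -
  let ?V = "{0..<int n}"
  have "(\<Sum>zs\<in>Z. of_bool (residue_class n (zs ! l) = residue_class n z) * \<bar>G (delete_nth l zs)\<bar>)
    \<le> (\<Sum>zs\<in>residue_lists n (Suc j). of_bool (residue_class n (zs ! l) = residue_class n z) * \<bar>G (delete_nth l zs)\<bar>)"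
    using assms(1) by (intro sum_mono2) auto
  also have "\<dots> = (\<Sum>zs\<in>residue_lists n j. \<Sum>y\<in>?V. of_bool (residue_class n y = residue_class n z) * \<bar>G zs\<bar>)"
    unfolding sum_residue_lists_insert[OF assms(2)] using assms(2)
    by (intro sum.cong refl) (simp only: nth_insert delete_nth_insert residue_lists_def mem_Collect_eq)
  also have "\<dots> = real (card {y \<in> ?V. residue_class n y = residue_class n z}) * (\<Sum>zs\<in>residue_lists n j. \<bar>G zs\<bar>)"
    by (simp only: sum_distrib_right[symmetric] sum_of_bool_real finite_atLeastLessThan_int sum_distrib_left)
  also have "\<dots> \<le> real (card {z, (- z) mod int n}) * (\<Sum>zs\<in>residue_lists n j. \<bar>G zs\<bar>)"
    using residue_class_eq_iff[OF _ assms(3)]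
    by (intro mult_right_mono of_nat_mono card_mono sum_nonneg) auto
  also have "\<dots> \<le> 2 * (\<Sum>zs\<in>residue_lists n j. \<bar>G zs\<bar>)"
    by (intro mult_right_mono sum_nonneg) (auto simp: card_insert_if)
  finally show ?thesis .
qed

text \<open>
  One block of \<open>k + 1\<close> residues with sum zero, next to arbitrary further residues \<open>zs\<close> from a set \<open>Z\<close>: the
  first residue has \<open>k\<close> possible partners in its block, and each choice leaves a zero-sum block of
  length \<open>k - 1\<close> and a free residue. Since \<open>C\<close> does not depend on \<open>Z\<close>, the other blocks may later
  be subject to constraints of their own. For \<open>k = 0\<close> the truncated difference is harmless because of the factor \<open>k\<close>.
\<close>

lemma zero_sum_step:
  assumes m: "m 0 = 1" "m 1 = 0" "m 2 = 1"
  shows "\<exists>C\<ge>0. \<forall>n Z. odd n \<longrightarrow> Z \<subseteq> residue_lists n q \<longrightarrow>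
    \<bar>(\<Sum>xs\<in>zero_sum_lists n (Suc k). \<Sum>zs\<in>Z. circ_moment m n (xs @ zs))
      - real k * real n * (\<Sum>xs\<in>zero_sum_lists n (k - 1). \<Sum>zs\<in>Z. circ_moment m n (xs @ zs))\<bar>
    \<le> C * sqrt n ^ (k + q)"
proof -
  obtain C1 where C1: "C1 \<ge> 0" "\<And>n. n > 0 \<Longrightarrow>
     (\<Sum>us\<in>residue_lists n (k - 1 + q). \<bar>circ_moment m n us\<bar>) \<le> C1 * sqrt n ^ (k - 1 + q)"
    using sum_abs_circ_moment_le[where m = m, OF m(2)] by blast
  obtain C2 where C2: "C2 \<ge> 0" "\<And>n. n > 0 \<Longrightarrow>
     (\<Sum>us\<in>residue_lists n (k + (q - 1)). \<bar>circ_moment m n us\<bar>) \<le> C2 * sqrt n ^ (k + (q - 1))"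
    using sum_abs_circ_moment_le[where m = m, OF m(2)] by blast
  obtain C3 where C3: "C3 \<ge> 0" "\<And>n. n > 0 \<Longrightarrow>
     (\<Sum>us\<in>residue_lists n (Suc (k + q)). of_bool (2 * card (residue_class n ` set us) \<le> k + q)) \<le> C3 * sqrt n ^ (k + q)"
    using sum_repeated_classes_le by blast
  define B where "B = (1 + real (k + q)) * (1 + (\<Sum>p\<le>Suc (k + q). \<bar>m p\<bar>)) ^ Suc (k + q)"
  have B: "B \<ge> 0" by (simp add: B_def sum_nonneg)
  have "\<bar>(\<Sum>xs\<in>zero_sum_lists n (Suc k). \<Sum>zs\<in>Z. circ_moment m n (xs @ zs))
      - real k * real n * (\<Sum>xs\<in>zero_sum_lists n (k - 1). \<Sum>zs\<in>Z. circ_moment m n (xs @ zs))\<bar>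
      \<le> (B * C3 + real k * C1 + real q * (2 * C2)) * sqrt n ^ (k + q)"
    if odd: "odd n" and Z: "Z \<subseteq> residue_lists n q" for n Z
  proof -
    let ?c = "residue_class n"
    let ?e = "circ_moment m n"
    let ?L = "residue_lists n"
    have n: "n > 0" using odd by (simp add: odd_pos)
    have finZ: "finite Z" using Z finite_subset by fastforce
    define x where "x = (\<lambda>ys. (- sum_list ys) mod int n)"
    define S where "S = (\<Sum>ys\<in>?L k. \<Sum>zs\<in>Z. ?e (x ys # ys @ zs))"
    \<comment> \<open>partners inside the block, and partners among the residues \<open>zs\<close>\<close>
    define D1 where "D1 = (\<Sum>ys\<in>?L k. \<Sum>zs\<in>Z. \<Sum>l<k. of_bool (?c (ys ! l) = ?c (x ys)) * ?e (delete_nth l ys @ zs))"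
    define D2 where "D2 = (\<Sum>ys\<in>?L k. \<Sum>zs\<in>Z. \<Sum>l<q. of_bool (?c (zs ! l) = ?c (x ys)) * ?e (ys @ delete_nth l zs))"
    define G where "G w = (\<Sum>zs\<in>Z. ?e (w @ zs))" for w
    have S: "(\<Sum>xs\<in>zero_sum_lists n (Suc k). \<Sum>zs\<in>Z. ?e (xs @ zs)) = S"
      unfolding S_def sum_zero_sum_lists_Suc[OF n] x_def by simp
    have bound1: "\<bar>S - (D1 + D2)\<bar> \<le> B * (C3 * sqrt n ^ (k + q))"
    proof -
      have pw: "\<bar>?e (x ys # ys @ zs) - ((\<Sum>l<k. of_bool (?c (ys ! l) = ?c (x ys)) * ?e (delete_nth l ys @ zs))
          + (\<Sum>l<q. of_bool (?c (zs ! l) = ?c (x ys)) * ?e (ys @ delete_nth l zs)))\<bar>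
         \<le> B * of_bool (2 * card (?c ` set (x ys # ys @ zs)) \<le> k + q)"
        if "ys \<in> ?L k" "zs \<in> ?L q" for ys zs
      proof -
        have len: "length ys = k" "length zs = q" using that by (auto simp: residue_lists_def)
        let ?cs = "map ?c (ys @ zs)"
        have del: "delete_nth l ?cs = map ?c (delete_nth l (ys @ zs))" for l
          by (simp add: delete_nth_def take_map drop_map)
        have "(\<Sum>l<length ?cs. of_bool (?cs ! l = ?c (x ys)) * list_moment m (delete_nth l ?cs)) =
           (\<Sum>l<k + q. of_bool (?c ((ys @ zs) ! l) = ?c (x ys)) * ?e (delete_nth l (ys @ zs)))"
          unfolding del circ_moment_def by (intro sum.cong) (auto simp: len nth_append)
        also have "\<dots> = (\<Sum>l<k. of_bool (?c ((ys @ zs) ! l) = ?c (x ys)) * ?e (delete_nth l (ys @ zs)))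
          + (\<Sum>l<q. of_bool (?c ((ys @ zs) ! (k + l)) = ?c (x ys)) * ?e (delete_nth (k + l) (ys @ zs)))"
          by (induction q) (simp_all add: add.assoc)
        also have "\<dots> = (\<Sum>l<k. of_bool (?c (ys ! l) = ?c (x ys)) * ?e (delete_nth l ys @ zs))
          + (\<Sum>l<q. of_bool (?c (zs ! l) = ?c (x ys)) * ?e (ys @ delete_nth l zs))"
          by (intro arg_cong2[of _ _ _ _ "(+)"] sum.cong refl) (auto simp: nth_append delete_nth_def len)
        finally have eq: "(\<Sum>l<length ?cs. of_bool (?cs ! l = ?c (x ys)) * list_moment m (delete_nth l ?cs)) = \<dots>" .
        show ?thesis
          using list_moment_Cons_approx[OF m, of ?cs "k + q" "?c (x ys)"] len
          unfolding eq B_def[symmetric] by (simp add: circ_moment_def image_Un B_def)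
      qed
      \<comment> \<open>sum the pointwise estimate, then view \<open>x ys # ys @ zs\<close> as a list of \<open>k + q + 1\<close> residues\<close>
      have "\<bar>S - (D1 + D2)\<bar> \<le> (\<Sum>ys\<in>?L k. \<Sum>zs\<in>Z. B * of_bool (2 * card (?c ` set (x ys # ys @ zs)) \<le> k + q))"
        unfolding S_def D1_def D2_def sum.distrib[symmetric] sum_subtractf[symmetric]
        using Z by (intro order_trans[OF sum_abs] sum_mono pw) auto
      also have "\<dots> = B * (\<Sum>xs\<in>zero_sum_lists n (Suc k). \<Sum>zs\<in>Z. of_bool (2 * card (?c ` set (xs @ zs)) \<le> k + q))"
        unfolding sum_zero_sum_lists_Suc[OF n] x_def by (simp add: sum_distrib_left)
      also have "\<dots> \<le> B * (\<Sum>xs\<in>?L (Suc k). \<Sum>zs\<in>?L q. of_bool (2 * card (?c ` set (xs @ zs)) \<le> k + q))"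
      proof (rule mult_left_mono[OF _ B])
        have "(\<Sum>xs\<in>zero_sum_lists n (Suc k). \<Sum>zs\<in>Z. of_bool (2 * card (?c ` set (xs @ zs)) \<le> k + q))
          \<le> (\<Sum>xs\<in>?L (Suc k). \<Sum>zs\<in>Z. of_bool (2 * card (?c ` set (xs @ zs)) \<le> k + q) :: real)"
          by (rule sum_mono2) (auto simp: zero_sum_lists_def intro: sum_nonneg)
        also have "\<dots> \<le> (\<Sum>xs\<in>?L (Suc k). \<Sum>zs\<in>?L q. of_bool (2 * card (?c ` set (xs @ zs)) \<le> k + q))"
          by (rule sum_mono, rule sum_mono2) (use Z in auto)
        finally show "(\<Sum>xs\<in>zero_sum_lists n (Suc k). \<Sum>zs\<in>Z. of_bool (2 * card (?c ` set (xs @ zs)) \<le> k + q))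
          \<le> (\<Sum>xs\<in>?L (Suc k). \<Sum>zs\<in>?L q. of_bool (2 * card (?c ` set (xs @ zs)) \<le> k + q) :: real)" .
      qed
      also have "\<dots> = B * (\<Sum>us\<in>?L (Suc k + q). of_bool (2 * card (?c ` set us) \<le> k + q))"
        using sum_residue_lists_append[where f = "\<lambda>us. of_bool (2 * card (?c ` set us) \<le> k + q)"
            and n = n and k = "Suc k" and q = q] by (simp only:)
      also have "\<dots> \<le> B * (C3 * sqrt n ^ (k + q))"
        using C3(2)[OF n] by (intro mult_left_mono B) simp
      finally show ?thesis .
    qed
    have mono: "sqrt n ^ i \<le> sqrt n ^ j" if "i \<le> j" for i j
      using n that by (intro power_increasing) auto
    have bound2: "\<bar>D1 - real k * real n * (\<Sum>xs\<in>zero_sum_lists n (k - 1). G xs)\<bar> \<le> real k * (C1 * sqrt n ^ (k + q))"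
    proof (cases k)
      case (Suc j)
      have "D1 = (\<Sum>ys\<in>?L k. \<Sum>l<k. of_bool (?c (ys ! l) = ?c (x ys)) * G (delete_nth l ys))"
        unfolding D1_def G_def sum_distrib_left by (intro sum.cong refl sum.swap)
      also have "\<dots> = (\<Sum>l<k. \<Sum>ys\<in>?L k. of_bool (?c (ys ! l) = ?c (x ys)) * G (delete_nth l ys))"
        by (rule sum.swap)
      finally have "\<bar>D1 - real k * real n * (\<Sum>xs\<in>zero_sum_lists n (k - 1). G xs)\<bar> =
        \<bar>\<Sum>l<k. (\<Sum>ys\<in>?L k. of_bool (?c (ys ! l) = ?c (x ys)) * G (delete_nth l ys))
           - real n * (\<Sum>xs\<in>zero_sum_lists n (k - 1). G xs)\<bar>"
        by (simp add: sum_subtractf mult.assoc)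
      also have "\<dots> \<le> (\<Sum>l<k. \<Sum>ys\<in>?L j. \<bar>G ys\<bar>)"
        using sum_match_same_block[OF odd, of _ j G]
        by (intro order_trans[OF sum_abs] sum_mono) (auto simp: Suc x_def)
      also have "\<dots> = real k * (\<Sum>ys\<in>?L j. \<bar>G ys\<bar>)" by simp
      also have "(\<Sum>ys\<in>?L j. \<bar>G ys\<bar>) \<le> (\<Sum>ys\<in>?L j. \<Sum>zs\<in>?L q. \<bar>?e (ys @ zs)\<bar>)"
        unfolding G_def using Z by (intro sum_mono order_trans[OF sum_abs] sum_mono2) auto
      also have "\<dots> = (\<Sum>us\<in>?L (k - 1 + q). \<bar>?e us\<bar>)"
        using sum_residue_lists_append[where f = "\<lambda>us. \<bar>?e us\<bar>" and n = n and k = j and q = q]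
        by (simp only: Suc diff_Suc_1)
      also have "\<dots> \<le> C1 * sqrt n ^ (k - 1 + q)" by (rule C1(2)[OF n])
      also have "\<dots> \<le> C1 * sqrt n ^ (k + q)" using C1(1) by (intro mult_left_mono mono) auto
      finally show ?thesis by (simp add: mult_left_mono)
    qed (simp add: D1_def)
    have bound3: "\<bar>D2\<bar> \<le> real q * (2 * (C2 * sqrt n ^ (k + q)))"
    proof (cases q)
      case (Suc j)
      have "\<bar>D2\<bar> \<le> (\<Sum>ys\<in>?L k. \<Sum>zs\<in>Z. \<Sum>l<q. of_bool (?c (zs ! l) = ?c (x ys)) * \<bar>?e (ys @ delete_nth l zs)\<bar>)"
        unfolding D2_def
        by (intro order_trans[OF sum_abs] sum_mono) (simp add: abs_mult order_trans[OF sum_abs])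
      also have "\<dots> = (\<Sum>ys\<in>?L k. \<Sum>l<q. \<Sum>zs\<in>Z. of_bool (?c (zs ! l) = ?c (x ys)) * \<bar>?e (ys @ delete_nth l zs)\<bar>)"
        by (intro sum.cong refl sum.swap)
      also have "\<dots> \<le> (\<Sum>ys\<in>?L k. \<Sum>l<q. 2 * (\<Sum>zs\<in>?L j. \<bar>?e (ys @ zs)\<bar>))"
        using Z n by (intro sum_mono sum_match_other_block) (auto simp: Suc x_def)
      also have "\<dots> = real q * (2 * (\<Sum>us\<in>?L (k + (q - 1)). \<bar>?e us\<bar>))"
        using sum_residue_lists_append[where f = "\<lambda>us. \<bar>?e us\<bar>" and n = n and k = k and q = j, symmetric]
        by (simp only: Suc diff_Suc_1 sum_constant card_lessThan sum_distrib_left[symmetric] mult.left_commute)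
      also have "\<dots> \<le> real q * (2 * (C2 * sqrt n ^ (k + (q - 1))))"
        using C2(2)[OF n] by (intro mult_left_mono) auto
      also have "\<dots> \<le> real q * (2 * (C2 * sqrt n ^ (k + q)))"
        using C2(1) by (intro mult_left_mono mono) auto
      finally show ?thesis .
    qed (simp add: D2_def)
    have "\<bar>S - real k * real n * (\<Sum>xs\<in>zero_sum_lists n (k - 1). G xs)\<bar>
        \<le> B * (C3 * sqrt n ^ (k + q)) + real k * (C1 * sqrt n ^ (k + q)) + real q * (2 * (C2 * sqrt n ^ (k + q)))"
      using bound1 bound2 bound3 by linarith
    then show ?thesis unfolding S G_def by (simp add: distrib_right mult.assoc)
  qed
  moreover have "B * C3 + real k * C1 + real q * (2 * C2) \<ge> 0"
    using B C1(1) C2(1) C3(1) by simp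
  ultimately show ?thesis by blast
qed

text \<open>
  A block of length \<open>k\<close> contributes the Gaussian moment. The bound is written as a quotient by
  \<open>sqrt n\<close> since the exponent \<open>k + q - 1\<close> would be truncated for \<open>k = q = 0\<close>.
\<close>

lemma zero_sum_block:
  assumes m: "m 0 = 1" "m 1 = 0" "m 2 = 1"
  shows "\<exists>C\<ge>0. \<forall>n Z. odd n \<longrightarrow> Z \<subseteq> residue_lists n q \<longrightarrow>
    \<bar>(\<Sum>xs\<in>zero_sum_lists n k. \<Sum>zs\<in>Z. circ_moment m n (xs @ zs))
      - real (gauss_moment k) * sqrt n ^ k * (\<Sum>zs\<in>Z. circ_moment m n zs)\<bar>
    \<le> C * sqrt n ^ (k + q) / sqrt n"
proof (induction k rule: induct_nat_012)
  case 0
  show ?case by (intro exI[of _ 0]) simp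
next
  case 1
  obtain C where C: "C \<ge> 0" "\<And>n Z. odd n \<Longrightarrow> Z \<subseteq> residue_lists n q \<Longrightarrow>
    \<bar>(\<Sum>xs\<in>zero_sum_lists n (Suc 0). \<Sum>zs\<in>Z. circ_moment m n (xs @ zs))\<bar> \<le> C * sqrt n ^ q"
    using zero_sum_step[OF m, of q 0] by auto
  show ?case
    using C odd_pos by (intro exI[of _ C]) auto
next
  case (ge2 k)
  obtain C where C: "C \<ge> 0" "\<And>n Z. odd n \<Longrightarrow> Z \<subseteq> residue_lists n q \<Longrightarrow>
    \<bar>(\<Sum>xs\<in>zero_sum_lists n k. \<Sum>zs\<in>Z. circ_moment m n (xs @ zs))
      - real (gauss_moment k) * sqrt n ^ k * (\<Sum>zs\<in>Z. circ_moment m n zs)\<bar> \<le> C * sqrt n ^ (k + q) / sqrt n"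
    using ge2(1) by blast
  obtain D where D: "D \<ge> 0" "\<And>n Z. odd n \<Longrightarrow> Z \<subseteq> residue_lists n q \<Longrightarrow>
    \<bar>(\<Sum>xs\<in>zero_sum_lists n (Suc (Suc k)). \<Sum>zs\<in>Z. circ_moment m n (xs @ zs))
      - real (Suc k) * real n * (\<Sum>xs\<in>zero_sum_lists n k. \<Sum>zs\<in>Z. circ_moment m n (xs @ zs))\<bar>
    \<le> D * sqrt n ^ (Suc k + q)"
    using zero_sum_step[OF m, of q "Suc k"] by auto
  show ?case
  proof (intro exI[of _ "D + real (Suc k) * C"] conjI allI impI)
    show "0 \<le> D + real (Suc k) * C" using C D by simp
    fix n :: nat and Z assume nZ: "odd n" "Z \<subseteq> residue_lists n q"
    then have n: "n > 0" by (simp add: odd_pos)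
    let ?S = "\<lambda>k. \<Sum>xs\<in>zero_sum_lists n k. \<Sum>zs\<in>Z. circ_moment m n (xs @ zs)"
    let ?T = "\<Sum>zs\<in>Z. circ_moment m n zs"
    have "real (gauss_moment (Suc (Suc k))) * sqrt n ^ Suc (Suc k) =
        real (Suc k) * (sqrt n * sqrt n) * (real (gauss_moment k) * sqrt n ^ k)"
      unfolding gauss_moment_step by (simp only: of_nat_mult power_Suc mult_ac)
    then have g: "real (gauss_moment (Suc (Suc k))) * sqrt n ^ Suc (Suc k) =
        real (Suc k) * real n * (real (gauss_moment k) * sqrt n ^ k)"
      by simp
    have "?S (Suc (Suc k)) - real (gauss_moment (Suc (Suc k))) * sqrt n ^ Suc (Suc k) * ?T =
       (?S (Suc (Suc k)) - real (Suc k) * real n * ?S k)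
        + real (Suc k) * real n * (?S k - real (gauss_moment k) * sqrt n ^ k * ?T)"
      unfolding g by (simp add: right_diff_distrib mult.assoc del: of_nat_Suc)
    also have "\<bar>\<dots>\<bar> \<le> \<bar>?S (Suc (Suc k)) - real (Suc k) * real n * ?S k\<bar>
        + real (Suc k) * real n * \<bar>?S k - real (gauss_moment k) * sqrt n ^ k * ?T\<bar>"
      using abs_triangle_ineq by (simp add: abs_mult order_trans[OF abs_triangle_ineq])
    also have "\<dots> \<le> D * sqrt n ^ (Suc k + q) + real (Suc k) * real n * (C * sqrt n ^ (k + q) / sqrt n)"
      using C(2)[OF nZ] D(2)[OF nZ] by (intro add_mono mult_left_mono) auto
    also have "\<dots> = (D + real (Suc k) * C) * sqrt n ^ (Suc (Suc k) + q) / sqrt n"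
      using n by (simp add: field_simps del: of_nat_Suc)
    finally show "\<bar>?S (Suc (Suc k)) - real (gauss_moment (Suc (Suc k))) * sqrt n ^ Suc (Suc k) * ?T\<bar>
      \<le> (D + real (Suc k) * C) * sqrt n ^ (Suc (Suc k) + q) / sqrt n" .
  qed
qed

text \<open>
  Concatenations of zero-sum blocks of the given lengths.
\<close>

fun block_zero_lists :: "nat \<Rightarrow> nat list \<Rightarrow> int list set" where
  "block_zero_lists n [] = {[]}"
| "block_zero_lists n (k # ks) = (\<lambda>(xs, zs). xs @ zs) ` (zero_sum_lists n k \<times> block_zero_lists n ks)"

lemma block_zero_lists_subset: "block_zero_lists n ks \<subseteq> residue_lists n (sum_list ks)"
  by (induction ks) (fastforce simp: zero_sum_lists_def residue_lists_def)+

lemma finite_block_zero_lists [simp]: "finite (block_zero_lists n ks)"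
  using block_zero_lists_subset finite_residue_lists by (rule finite_subset)

lemma sum_block_zero_lists_Cons:
  fixes f :: "int list \<Rightarrow> real"
  shows "(\<Sum>us\<in>block_zero_lists n (k # ks). f us) = (\<Sum>xs\<in>zero_sum_lists n k. \<Sum>zs\<in>block_zero_lists n ks. f (xs @ zs))"
proof -
  have "inj_on (\<lambda>(xs, zs). xs @ zs) (zero_sum_lists n k \<times> block_zero_lists n ks)"
    by (auto simp: inj_on_def zero_sum_lists_def residue_lists_def)
  then show ?thesis
    by (simp add: sum.reindex sum.cartesian_product comp_def case_prod_unfold)
qed

theorem sum_block_zero_lists_approx:
  assumes m: "m 0 = 1" "m 1 = 0" "m 2 = 1"
  shows "\<exists>C\<ge>0. \<forall>n. odd n \<longrightarrow>
    \<bar>(\<Sum>us\<in>block_zero_lists n ks. circ_moment m n us)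
      - real (\<Prod>k\<leftarrow>ks. gauss_moment k) * sqrt n ^ sum_list ks\<bar> \<le> C * sqrt n ^ sum_list ks / sqrt n"
proof (induction ks)
  case Nil
  show ?case by (intro exI[of _ 0]) (simp add: circ_moment_def list_moment_def)
next
  case (Cons k ks)
  let ?K = "sum_list ks"
  obtain C where C: "C \<ge> 0" "\<And>n. odd n \<Longrightarrow>
    \<bar>(\<Sum>us\<in>block_zero_lists n ks. circ_moment m n us)
      - real (\<Prod>k\<leftarrow>ks. gauss_moment k) * sqrt n ^ ?K\<bar> \<le> C * sqrt n ^ ?K / sqrt n"
    using Cons.IH by blast
  obtain D where D: "D \<ge> 0" "\<And>n Z. odd n \<Longrightarrow> Z \<subseteq> residue_lists n ?K \<Longrightarrow>
    \<bar>(\<Sum>xs\<in>zero_sum_lists n k. \<Sum>zs\<in>Z. circ_moment m n (xs @ zs))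
      - real (gauss_moment k) * sqrt n ^ k * (\<Sum>zs\<in>Z. circ_moment m n zs)\<bar>
    \<le> D * sqrt n ^ (k + ?K) / sqrt n"
    using zero_sum_block[OF m, of ?K k] by blast
  show ?case
  proof (intro exI[of _ "D + real (gauss_moment k) * C"] conjI allI impI)
    show "0 \<le> D + real (gauss_moment k) * C" using C D by simp
    fix n :: nat assume n: "odd n"
    let ?S = "\<Sum>us\<in>block_zero_lists n ks. circ_moment m n us"
    let ?P = "real (\<Prod>k\<leftarrow>ks. gauss_moment k) * sqrt n ^ ?K"
    let ?g = "real (gauss_moment k) * sqrt n ^ k"
    have "(\<Sum>us\<in>block_zero_lists n (k # ks). circ_moment m n us)
      - real (\<Prod>k\<leftarrow>k # ks. gauss_moment k) * sqrt n ^ sum_list (k # ks) =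
      ((\<Sum>us\<in>block_zero_lists n (k # ks). circ_moment m n us) - ?g * ?S) + ?g * (?S - ?P)"
      by (simp add: algebra_simps power_add)
    also have "\<bar>\<dots>\<bar> \<le> \<bar>(\<Sum>us\<in>block_zero_lists n (k # ks). circ_moment m n us) - ?g * ?S\<bar> + ?g * \<bar>?S - ?P\<bar>"
      by (rule order_trans[OF abs_triangle_ineq]) (simp add: abs_mult)
    also have "\<dots> \<le> D * sqrt n ^ (k + ?K) / sqrt n + ?g * (C * sqrt n ^ ?K / sqrt n)"
      using C(2)[OF n] D(2)[OF n block_zero_lists_subset]
      unfolding sum_block_zero_lists_Cons by (intro add_mono mult_left_mono) auto
    also have "\<dots> = (D + real (gauss_moment k) * C) * sqrt n ^ sum_list (k # ks) / sqrt n"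
      by (simp add: algebra_simps power_add add_divide_distrib)
    finally show "\<bar>(\<Sum>us\<in>block_zero_lists n (k # ks). circ_moment m n us)
      - real (\<Prod>k\<leftarrow>k # ks. gauss_moment k) * sqrt n ^ sum_list (k # ks)\<bar>
      \<le> (D + real (gauss_moment k) * C) * sqrt n ^ sum_list (k # ks) / sqrt n" .
  qed
qed

section \<open>Traces of powers of the palindromic Toeplitz matrix\<close>

text \<open>
  Two of the indices \<open>0, \<dots>, n\<close>, namely \<open>0\<close> and \<open>n\<close>, represent the residue \<open>0\<close>, and every other residue has exactly
  one representative. A closed walk on residues starting at \<open>v\<close> with steps \<open>-x\<^sub>1, -x\<^sub>2, \<dots>\<close> therefore lifts to
  as many closed walks on the indices as the product of the weights of its vertices tells. The walk of
  length zero still has its starting vertex, whence the case distinction in \<open>loop_weight\<close>.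
\<close>

definition vertex_weight :: "int \<Rightarrow> real" where
  "vertex_weight v = (if v = 0 then 2 else 1)"

fun path_weight :: "nat \<Rightarrow> int \<Rightarrow> int list \<Rightarrow> real" where
  "path_weight n v [] = 1"
| "path_weight n v (x # xs) = vertex_weight v * path_weight n ((v - x) mod int n) xs"

definition loop_weight :: "nat \<Rightarrow> int \<Rightarrow> int list \<Rightarrow> real" where
  "loop_weight n v xs = (if xs = [] then vertex_weight v else path_weight n v xs)"

lemma sum_mod_eq_weighted:
  fixes g :: "int \<Rightarrow> real"
  assumes "n > 0"
  shows "(\<Sum>p<Suc n. g (int p mod int n)) = (\<Sum>v\<in>{0..<int n}. vertex_weight v * g v)"
proof -
  have "(\<Sum>v\<in>{0..<int n}. vertex_weight v * g v) = (\<Sum>v\<in>{0..<int n}. g v + (if v = 0 then g v else 0))"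
    by (intro sum.cong) (auto simp: vertex_weight_def)
  also have "\<dots> = (\<Sum>v\<in>{0..<int n}. g v) + g 0"
    using assms by (simp add: sum.distrib)
  also have "(\<Sum>v\<in>{0..<int n}. g v) = (\<Sum>p<n. g (int p mod int n))"
    by (rule sum.reindex_bij_witness[of _ int nat]) auto
  finally show ?thesis by simp
qed

lemma sum_shift_mod:
  fixes g :: "int \<Rightarrow> real"
  assumes "n > 0"
  shows "(\<Sum>v\<in>{0..<int n}. g ((v - x) mod int n)) = (\<Sum>v\<in>{0..<int n}. g v)"
  by (rule sum.reindex_bij_witness[of _ "\<lambda>v. (v + x) mod int n" "\<lambda>v. (v - x) mod int n"])
    (use assms in \<open>auto simp: mod_simps\<close>)

lemma sum_reflect_mod:
  fixes g :: "int \<Rightarrow> int \<Rightarrow> real"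
  assumes "n > 0"
  shows "(\<Sum>r\<in>{0..<int n}. g ((v - r) mod int n) r) = (\<Sum>x\<in>{0..<int n}. g x ((v - x) mod int n))"
  by (rule sum.reindex_bij_witness[of _ "\<lambda>x. (v - x) mod int n" "\<lambda>r. (v - r) mod int n"])
    (use assms in \<open>auto simp: mod_simps\<close>)

text \<open>
  The weight differs from 1 only if the walk meets the residue \<open>0\<close>, which for given steps happens for
  a number of starting points that is bounded independently of \<open>n\<close>.
\<close>

lemma sum_path_weight_le:
  assumes "n > 0"
  shows "(\<Sum>v\<in>{0..<int n}. \<bar>path_weight n v xs - 1\<bar>) \<le> 2 ^ length xs - 1"
proof (induction xs)
  case (Cons x xs)
  have "(\<Sum>v\<in>{0..<int n}. \<bar>path_weight n v (x # xs) - 1\<bar>)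
     \<le> (\<Sum>v\<in>{0..<int n}. 2 * \<bar>path_weight n ((v - x) mod int n) xs - 1\<bar> + (if v = 0 then 1 else 0))"
  proof (intro sum_mono)
    fix v
    have "\<bar>2 * y - 1\<bar> \<le> 2 * \<bar>y - 1\<bar> + 1" "\<bar>y - 1\<bar> \<le> 2 * \<bar>y - 1\<bar>" for y :: real
      by (simp_all add: abs_if)
    then show "\<bar>path_weight n v (x # xs) - 1\<bar>
        \<le> 2 * \<bar>path_weight n ((v - x) mod int n) xs - 1\<bar> + (if v = 0 then 1 else 0)"
      by (simp add: vertex_weight_def)
  qed
  also have "\<dots> \<le> 2 * (\<Sum>v\<in>{0..<int n}. \<bar>path_weight n v xs - 1\<bar>) + 1"
    using assms sum_shift_mod[OF assms, of "\<lambda>v. \<bar>path_weight n v xs - 1\<bar>" x]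
    by (simp add: sum.distrib sum_distrib_left[symmetric])
  also have "\<dots> \<le> 2 ^ length (x # xs) - 1" using Cons by simp
  finally show ?case .
qed simp

lemma sum_loop_weight_le:
  assumes "n > 0"
  shows "\<bar>(\<Sum>v\<in>{0..<int n}. loop_weight n v xs) - real n\<bar> \<le> 2 ^ length xs"
proof (cases "xs = []")
  case True
  have "(\<Sum>v\<in>{0..<int n}. loop_weight n v xs) = (\<Sum>p<Suc n. 1)"
    using sum_mod_eq_weighted[OF assms, of "\<lambda>_. 1"] True by (simp add: loop_weight_def)
  then show ?thesis by simp
next
  case False
  have "(\<Sum>v\<in>{0..<int n}. loop_weight n v xs) - real n = (\<Sum>v\<in>{0..<int n}. path_weight n v xs - 1)"
    using False by (simp add: loop_weight_def sum_subtractf)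
  also have "\<bar>\<dots>\<bar> \<le> 2 ^ length xs - 1"
    using sum_abs sum_path_weight_le[OF assms] by (rule order_trans)
  finally show ?thesis by simp
qed

text \<open>
  The constant in the error estimate of \<open>expectation_B_traces_approx\<close>.
\<close>

fun weight_error :: "nat list \<Rightarrow> real" where
  "weight_error [] = 0"
| "weight_error (k # ks) = weight_error ks + 2 ^ k * (1 + weight_error ks)"

lemma weight_error_nonneg: "weight_error ks \<ge> 0"
  by (induction ks) simp_all

text \<open>
  The matrix \<open>b\<close> of size \<open>n + 1\<close> is an odd circulant matrix of size \<open>n\<close> with one repeated row and column,
  and the mixed moments of its parameters are those of independent variables with moments \<open>m\<close>.
\<close>

locale goe_pte = wick_pair M "Suc n" a b
  for M :: "'w measure" and n :: nat and a b :: "nat \<Rightarrow> nat \<Rightarrow> 'w \<Rightarrow> real" +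
  fixes c :: "int \<Rightarrow> 'w \<Rightarrow> real" and m :: "nat \<Rightarrow> real"
  assumes odd_n: "odd n"
    and b_circulant: "k < Suc n \<Longrightarrow> l < Suc n \<Longrightarrow> b k l = c ((int k - int l) mod int n)"
    and c_moments: "x \<in> {0..<int n} \<Longrightarrow> all_moments (c x)"
    and c_expectation: "set xs \<subseteq> {0..<int n} \<Longrightarrow> expectation (\<lambda>\<omega>. \<Prod>x\<leftarrow>xs. c x \<omega>) = circ_moment m n xs"
begin

lemma n_pos: "n > 0"
  using odd_n by (simp add: odd_pos)

text \<open>
  The sum over walks of length \<open>k\<close> from \<open>v\<close> to \<open>w\<close> on the residues, weighted by all vertices but the
  last.
\<close>

definition circ_walk :: "nat \<Rightarrow> int \<Rightarrow> int \<Rightarrow> 'w \<Rightarrow> real" where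
  "circ_walk k v w \<omega> = (\<Sum>xs\<in>residue_lists n k.
     of_bool (int n dvd v - w - sum_list xs) * path_weight n v xs * (\<Prod>x\<leftarrow>xs. c x \<omega>))"

lemma circ_walk_0:
  assumes "v \<in> {0..<int n}" "w \<in> {0..<int n}"
  shows "circ_walk 0 v w \<omega> = of_bool (v = w)"
proof -
  have "int n dvd v - w \<longleftrightarrow> v = w"
    using assms by (metis atLeastLessThan_iff mod_eq_dvd_iff mod_pos_pos_trivial)
  then show ?thesis by (simp add: circ_walk_def)
qed

lemma circ_walk_Suc:
  "circ_walk (Suc k) v w \<omega> = vertex_weight v * (\<Sum>r\<in>{0..<int n}. c ((v - r) mod int n) \<omega> * circ_walk k r w \<omega>)"
proof -
  have "circ_walk (Suc k) v w \<omega> = (\<Sum>ys\<in>residue_lists n k. \<Sum>x\<in>{0..<int n}.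
     of_bool (int n dvd v - w - (x + sum_list ys)) * path_weight n v (x # ys) * (\<Prod>x\<leftarrow>x # ys. c x \<omega>))"
    unfolding circ_walk_def sum_residue_lists_insert[OF le0] by simp
  also have "\<dots> = (\<Sum>x\<in>{0..<int n}. \<Sum>ys\<in>residue_lists n k.
     of_bool (int n dvd v - w - (x + sum_list ys)) * path_weight n v (x # ys) * (\<Prod>x\<leftarrow>x # ys. c x \<omega>))"
    by (rule sum.swap)
  also have "\<dots> = (\<Sum>x\<in>{0..<int n}. vertex_weight v * (c x \<omega> * circ_walk k ((v - x) mod int n) w \<omega>))"
  proof -
    have "int n dvd v - w - (x + s) \<longleftrightarrow> int n dvd (v - x) mod int n - w - s" for x s
      by (simp add: dvd_eq_mod_eq_0 mod_simps algebra_simps)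
    then show ?thesis
      by (simp add: circ_walk_def sum_distrib_left mult_ac)
  qed
  also have "\<dots> = vertex_weight v * (\<Sum>x\<in>{0..<int n}. c x \<omega> * circ_walk k ((v - x) mod int n) w \<omega>)"
    by (simp add: sum_distrib_left)
  finally show ?thesis
    using sum_reflect_mod[OF n_pos, of "\<lambda>x r. c x \<omega> * circ_walk k r w \<omega>" v] by simp
qed

lemma word_entry_B:
  assumes "p < Suc n" "q < Suc n"
  shows "vertex_weight (int p mod int n) * word_entry (replicate (Suc k) False) p q \<omega> =
    circ_walk (Suc k) (int p mod int n) (int q mod int n) \<omega>"
  using assms(1)
proof (induction k arbitrary: p)
  case 0
  have "word_entry (replicate (Suc 0) False) p q \<omega> = b p q \<omega>"
    using assms(2) sum_delta_lessThan(2)[of q "\<lambda>r. b p r \<omega>"]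
    by (simp add: letter_def)
  moreover have "circ_walk (Suc 0) (int p mod int n) (int q mod int n) \<omega> =
     vertex_weight (int p mod int n) * c ((int p - int q) mod int n) \<omega>"
  proof -
    have "(\<Sum>r\<in>{0..<int n}. c ((int p mod int n - r) mod int n) \<omega> * circ_walk 0 r (int q mod int n) \<omega>) =
      (\<Sum>r\<in>{0..<int n}. if r = int q mod int n then c ((int p mod int n - r) mod int n) \<omega> else 0)"
      using n_pos by (intro sum.cong) (auto simp: circ_walk_0)
    then show ?thesis using n_pos by (simp add: circ_walk_Suc mod_simps)
  qed
  ultimately show ?case using 0 assms(2) by (simp add: b_circulant)
next
  case (Suc k)
  define g where "g r = c ((int p - r) mod int n) \<omega> * (circ_walk (Suc k) r (int q mod int n) \<omega> / vertex_weight r)" for r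
  have "word_entry (replicate (Suc (Suc k)) False) p q \<omega> =
      (\<Sum>r<Suc n. b p r \<omega> * word_entry (replicate (Suc k) False) r q \<omega>)"
    by (simp add: letter_def del: sum.lessThan_Suc)
  also have "\<dots> = (\<Sum>r<Suc n. g (int r mod int n))"
  proof (rule sum.cong)
    fix r assume r: "r \<in> {..<Suc n}"
    have "vertex_weight (int r mod int n) \<noteq> 0" by (simp add: vertex_weight_def)
    then have "word_entry (replicate (Suc k) False) r q \<omega> =
        circ_walk (Suc k) (int r mod int n) (int q mod int n) \<omega> / vertex_weight (int r mod int n)"
      using Suc.IH[of r] r by (simp add: field_simps del: replicate_Suc)
    then show "b p r \<omega> * word_entry (replicate (Suc k) False) r q \<omega> = g (int r mod int n)"
      using r Suc.prems by (simp add: g_def b_circulant mod_simps del: replicate_Suc)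
  qed simp
  also have "\<dots> = (\<Sum>v\<in>{0..<int n}. vertex_weight v * g v)"
    by (rule sum_mod_eq_weighted[OF n_pos])
  also have "\<dots> = (\<Sum>v\<in>{0..<int n}. c ((int p - v) mod int n) \<omega> * circ_walk (Suc k) v (int q mod int n) \<omega>)"
    by (intro sum.cong) (auto simp: g_def vertex_weight_def)
  finally show ?case by (simp add: circ_walk_Suc[of "Suc k"] mod_simps)
qed

lemma tr_B:
  "tr (replicate k False) \<omega> =
    (\<Sum>v\<in>{0..<int n}. \<Sum>xs\<in>zero_sum_lists n k. loop_weight n v xs * (\<Prod>x\<leftarrow>xs. c x \<omega>))"
proof (cases k)
  case 0
  then show ?thesis
    using sum_mod_eq_weighted[OF n_pos, of "\<lambda>_. 1"] by (simp add: tr_def loop_weight_def)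
next
  case (Suc j)
  define g where "g v = circ_walk k v v \<omega> / vertex_weight v" for v
  have "tr (replicate k False) \<omega> = (\<Sum>p<Suc n. g (int p mod int n))"
    unfolding tr_def
  proof (rule sum.cong)
    fix p assume "p \<in> {..<Suc n}"
    moreover have "vertex_weight (int p mod int n) \<noteq> 0" by (simp add: vertex_weight_def)
    ultimately show "word_entry (replicate k False) p p \<omega> = g (int p mod int n)"
      using word_entry_B[of p p j \<omega>] by (simp add: g_def Suc field_simps del: replicate_Suc)
  qed simp
  also have "\<dots> = (\<Sum>v\<in>{0..<int n}. circ_walk k v v \<omega>)"
    unfolding sum_mod_eq_weighted[OF n_pos, of g]
    by (intro sum.cong) (auto simp: g_def vertex_weight_def)
  also have "\<dots> = (\<Sum>v\<in>{0..<int n}. \<Sum>xs\<in>zero_sum_lists n k. loop_weight n v xs * (\<Prod>x\<leftarrow>xs. c x \<omega>))"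
  proof (rule sum.cong)
    fix v
    have "(\<Sum>xs\<in>zero_sum_lists n k. loop_weight n v xs * (\<Prod>x\<leftarrow>xs. c x \<omega>)) =
      (\<Sum>xs\<in>residue_lists n k. if int n dvd sum_list xs then loop_weight n v xs * (\<Prod>x\<leftarrow>xs. c x \<omega>) else 0)"
      unfolding zero_sum_lists_def by (rule sum.inter_filter) simp
    also have "\<dots> = circ_walk k v v \<omega>"
      unfolding circ_walk_def
      by (intro sum.cong) (auto simp: Suc loop_weight_def residue_lists_def)
    finally show "circ_walk k v v \<omega> = (\<Sum>xs\<in>zero_sum_lists n k. loop_weight n v xs * (\<Prod>x\<leftarrow>xs. c x \<omega>))" ..
  qed simp
  finally show ?thesis .
qed

abbreviation B_traces :: "nat list \<Rightarrow> 'w \<Rightarrow> real" where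
  "B_traces ks \<equiv> trs (map (\<lambda>k. replicate k False) ks)"

lemma prod_c_moments: "set xs \<subseteq> {0..<int n} \<Longrightarrow> all_moments (\<lambda>\<omega>. \<Prod>x\<leftarrow>xs. c x \<omega>)"
  using c_moments by (intro all_moments_prod_list) auto

lemma expectation_B_traces_Cons:
  assumes "set zs \<subseteq> {0..<int n}"
  shows "expectation (\<lambda>\<omega>. B_traces (k # ks) \<omega> * (\<Prod>z\<leftarrow>zs. c z \<omega>)) =
    (\<Sum>xs\<in>zero_sum_lists n k. (\<Sum>v\<in>{0..<int n}. loop_weight n v xs) *
      expectation (\<lambda>\<omega>. B_traces ks \<omega> * (\<Prod>z\<leftarrow>xs @ zs. c z \<omega>)))"
proof -
  have int: "integrable M (\<lambda>\<omega>. B_traces ks \<omega> * (\<Prod>z\<leftarrow>xs @ zs. c z \<omega>))" if "xs \<in> zero_sum_lists n k" for xs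
    using that assms
    by (intro all_moments_integrable all_moments_mult trs_moments prod_c_moments)
      (auto simp: zero_sum_lists_def residue_lists_def)
  have "(\<lambda>\<omega>. B_traces (k # ks) \<omega> * (\<Prod>z\<leftarrow>zs. c z \<omega>)) =
    (\<lambda>\<omega>. \<Sum>xs\<in>zero_sum_lists n k. (\<Sum>v\<in>{0..<int n}. loop_weight n v xs) *
       (B_traces ks \<omega> * (\<Prod>z\<leftarrow>xs @ zs. c z \<omega>)))"
  proof
    fix \<omega>
    have "tr (replicate k False) \<omega> =
      (\<Sum>xs\<in>zero_sum_lists n k. (\<Sum>v\<in>{0..<int n}. loop_weight n v xs) * (\<Prod>x\<leftarrow>xs. c x \<omega>))"
      unfolding tr_B by (subst sum.swap) (simp add: sum_distrib_right)
    then show "B_traces (k # ks) \<omega> * (\<Prod>z\<leftarrow>zs. c z \<omega>) =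
      (\<Sum>xs\<in>zero_sum_lists n k. (\<Sum>v\<in>{0..<int n}. loop_weight n v xs) *
       (B_traces ks \<omega> * (\<Prod>z\<leftarrow>xs @ zs. c z \<omega>)))"
      by (simp add: sum_distrib_left sum_distrib_right mult_ac)
  qed
  then show ?thesis
    using int by (simp add: Bochner_Integration.integral_sum del: map_append)
qed

text \<open>
  The additional factors \<open>c z\<close> are needed for the induction: expanding the first trace turns its
  steps into such factors.
\<close>

lemma expectation_B_traces_approx:
  assumes "set zs \<subseteq> {0..<int n}"
  shows "\<bar>expectation (\<lambda>\<omega>. B_traces ks \<omega> * (\<Prod>z\<leftarrow>zs. c z \<omega>))
      - real n ^ length ks * (\<Sum>us\<in>block_zero_lists n ks. circ_moment m n (us @ zs))\<bar>
    \<le> weight_error ks * (real n ^ length ks / real n) * (\<Sum>us\<in>residue_lists n (sum_list ks). \<bar>circ_moment m n (us @ zs)\<bar>)"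
  using assms
proof (induction ks arbitrary: zs)
  case Nil
  then show ?case by (simp add: c_expectation)
next
  case (Cons k ks)
  let ?r = "length ks"
  let ?K = "sum_list ks"
  let ?e = "circ_moment m n"
  let ?w = "weight_error ks"
  define X where "X xs = expectation (\<lambda>\<omega>. B_traces ks \<omega> * (\<Prod>z\<leftarrow>xs @ zs. c z \<omega>))" for xs
  define Y where "Y xs = real n ^ ?r * (\<Sum>us\<in>block_zero_lists n ks. ?e (us @ xs @ zs))" for xs
  define U where "U xs = (\<Sum>us\<in>residue_lists n ?K. \<bar>?e (us @ xs @ zs)\<bar>)" for xs
  define W where "W xs = (\<Sum>v\<in>{0..<int n}. loop_weight n v xs)" for xs
  have U0: "U xs \<ge> 0" for xs by (simp add: U_def sum_nonneg)
  have w0: "?w \<ge> 0" by (rule weight_error_nonneg)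
  have n1: "real n \<ge> 1" using n_pos by simp
  have pw: "\<bar>W xs * X xs - real n * Y xs\<bar> \<le> weight_error (k # ks) * real n ^ ?r * U xs"
    if xs: "xs \<in> zero_sum_lists n k" for xs
  proof -
    have "set (xs @ zs) \<subseteq> {0..<int n}"
      using xs Cons.prems by (auto simp: zero_sum_lists_def residue_lists_def)
    from Cons.IH[OF this] have XY: "\<bar>X xs - Y xs\<bar> \<le> ?w * (real n ^ ?r / real n) * U xs"
      unfolding X_def Y_def U_def .
    have "\<bar>Y xs\<bar> \<le> real n ^ ?r * U xs"
      unfolding Y_def U_def abs_mult
      by (intro mult_mono order_trans[OF sum_abs] sum_mono2 block_zero_lists_subset) auto
    moreover have "?w * (real n ^ ?r / real n) * U xs \<le> ?w * real n ^ ?r * U xs"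
      using w0 U0 n1 by (intro mult_right_mono mult_left_mono) (auto simp: divide_le_eq mult_le_cancel_left1)
    ultimately have X: "\<bar>X xs\<bar> \<le> (1 + ?w) * real n ^ ?r * U xs"
      using XY by (simp add: distrib_right)
    have len: "length xs = k" using xs by (simp add: zero_sum_lists_def residue_lists_def)
    have "W xs * X xs - real n * Y xs = (W xs - real n) * X xs + real n * (X xs - Y xs)"
      by (simp add: algebra_simps)
    also have "\<bar>\<dots>\<bar> \<le> \<bar>W xs - real n\<bar> * \<bar>X xs\<bar> + real n * \<bar>X xs - Y xs\<bar>"
      by (rule order_trans[OF abs_triangle_ineq]) (simp add: abs_mult)
    also have "\<dots> \<le> 2 ^ k * ((1 + ?w) * real n ^ ?r * U xs) + real n * (?w * (real n ^ ?r / real n) * U xs)"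
      using sum_loop_weight_le[OF n_pos, of xs] X XY unfolding W_def len
      by (intro add_mono mult_mono mult_left_mono) auto
    also have "\<dots> = weight_error (k # ks) * real n ^ ?r * U xs"
      using n1 by (simp add: field_simps)
    finally show ?thesis .
  qed
  have "expectation (\<lambda>\<omega>. B_traces (k # ks) \<omega> * (\<Prod>z\<leftarrow>zs. c z \<omega>)) = (\<Sum>xs\<in>zero_sum_lists n k. W xs * X xs)"
    unfolding W_def X_def by (rule expectation_B_traces_Cons[OF Cons.prems])
  moreover have "real n ^ length (k # ks) * (\<Sum>us\<in>block_zero_lists n (k # ks). ?e (us @ zs)) =
      (\<Sum>xs\<in>zero_sum_lists n k. real n * Y xs)"
  proof -
    have "?e ((xs @ us) @ zs) = ?e (us @ xs @ zs)" for xs us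
      by (rule circ_moment_mset_cong) simp
    then show ?thesis
      unfolding sum_block_zero_lists_Cons Y_def by (simp add: sum_distrib_left mult.assoc)
  qed
  ultimately have "\<bar>expectation (\<lambda>\<omega>. B_traces (k # ks) \<omega> * (\<Prod>z\<leftarrow>zs. c z \<omega>))
      - real n ^ length (k # ks) * (\<Sum>us\<in>block_zero_lists n (k # ks). ?e (us @ zs))\<bar>
    = \<bar>\<Sum>xs\<in>zero_sum_lists n k. W xs * X xs - real n * Y xs\<bar>"
    by (simp add: sum_subtractf)
  also have "\<dots> \<le> (\<Sum>xs\<in>zero_sum_lists n k. weight_error (k # ks) * real n ^ ?r * U xs)"
    by (intro order_trans[OF sum_abs] sum_mono pw)
  also have "\<dots> = weight_error (k # ks) * real n ^ ?r * (\<Sum>xs\<in>zero_sum_lists n k. U xs)"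
    by (simp only: sum_distrib_left)
  also have "\<dots> \<le> weight_error (k # ks) * real n ^ ?r * (\<Sum>xs\<in>residue_lists n k. U xs)"
    using U0 weight_error_nonneg[of "k # ks"]
    by (intro mult_left_mono sum_mono2) (auto simp: zero_sum_lists_def)
  also have "(\<Sum>xs\<in>residue_lists n k. U xs) = (\<Sum>us\<in>residue_lists n (k + ?K). \<bar>?e (us @ zs)\<bar>)"
  proof -
    have "?e (us @ xs @ zs) = ?e ((xs @ us) @ zs)" for xs us
      by (rule circ_moment_mset_cong) simp
    then show ?thesis
      using sum_residue_lists_append[where f = "\<lambda>us. \<bar>?e (us @ zs)\<bar>" and n = n and k = k and q = ?K]
      by (simp only: U_def)
  qed
  also have "weight_error (k # ks) * real n ^ ?r = weight_error (k # ks) * (real n ^ length (k # ks) / real n)"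
    using n1 by simp
  finally show ?case by (simp only: sum_list.Cons)
qed

lemma expectation_B_traces_bound:
  assumes C: "(\<Sum>us\<in>residue_lists n (sum_list ks). \<bar>circ_moment m n us\<bar>) \<le> C * sqrt n ^ sum_list ks"
    and D: "\<bar>(\<Sum>us\<in>block_zero_lists n ks. circ_moment m n us) - G * sqrt n ^ sum_list ks\<bar>
      \<le> D * sqrt n ^ sum_list ks / sqrt n"
    and "C \<ge> 0"
  shows "\<bar>expectation (B_traces ks) / sqrt n ^ (sum_list ks + 2 * length ks) - G\<bar> \<le> (weight_error ks * C + D) / sqrt n"
proof -
  let ?K = "sum_list ks"
  let ?r = "length ks"
  let ?S = "\<Sum>us\<in>block_zero_lists n ks. circ_moment m n us"
  let ?E = "expectation (B_traces ks)"
  have n1: "1 \<le> sqrt n" using n_pos by simp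
  have "\<bar>?E - real n ^ ?r * ?S\<bar> \<le> weight_error ks * (real n ^ ?r / real n) * (\<Sum>us\<in>residue_lists n ?K. \<bar>circ_moment m n us\<bar>)"
    using expectation_B_traces_approx[of "[]" ks] by simp
  also have "\<dots> \<le> weight_error ks * (real n ^ ?r / sqrt n) * (C * sqrt n ^ ?K)"
    using C n1 weight_error_nonneg[of ks] n_pos
    by (intro mult_mono mult_left_mono divide_left_mono sum_nonneg)
      (auto simp: real_sqrt_le_iff intro!: real_le_lsqrt power2_nonneg_ge_1_iff[THEN iffD2] self_le_power)
  finally have 1: "\<bar>?E - real n ^ ?r * ?S\<bar> \<le> weight_error ks * (real n ^ ?r / sqrt n) * (C * sqrt n ^ ?K)" .
  have "?E - real n ^ ?r * (G * sqrt n ^ ?K) = (?E - real n ^ ?r * ?S) + real n ^ ?r * (?S - G * sqrt n ^ ?K)"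
    by (simp add: algebra_simps)
  also have "\<bar>\<dots>\<bar> \<le> \<bar>?E - real n ^ ?r * ?S\<bar> + real n ^ ?r * \<bar>?S - G * sqrt n ^ ?K\<bar>"
    by (rule order_trans[OF abs_triangle_ineq]) (simp add: abs_mult)
  also have "\<dots> \<le> weight_error ks * (real n ^ ?r / sqrt n) * (C * sqrt n ^ ?K) + real n ^ ?r * (D * sqrt n ^ ?K / sqrt n)"
    using 1 D by (intro add_mono mult_left_mono) auto
  also have "\<dots> = (weight_error ks * C + D) / sqrt n * (real n ^ ?r * sqrt n ^ ?K)"
    by (simp add: add_divide_distrib distrib_right distrib_left mult_ac)
  finally have 2: "\<bar>?E - real n ^ ?r * (G * sqrt n ^ ?K)\<bar> \<le> (weight_error ks * C + D) / sqrt n * (real n ^ ?r * sqrt n ^ ?K)" .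
  have s: "sqrt n ^ (?K + 2 * ?r) = real n ^ ?r * sqrt n ^ ?K"
    by (simp add: power_add power_mult)
  have p: "real n ^ ?r * sqrt n ^ ?K > 0" using n_pos by simp
  have "?E / (real n ^ ?r * sqrt n ^ ?K) - G = (?E - real n ^ ?r * (G * sqrt n ^ ?K)) / (real n ^ ?r * sqrt n ^ ?K)"
    using n_pos by (simp add: diff_divide_distrib)
  then have "\<bar>?E / (real n ^ ?r * sqrt n ^ ?K) - G\<bar> = \<bar>?E - real n ^ ?r * (G * sqrt n ^ ?K)\<bar> / (real n ^ ?r * sqrt n ^ ?K)"
    using p by (simp add: abs_divide)
  also have "\<dots> \<le> (weight_error ks * C + D) / sqrt n"
    using 2 p by (simp add: divide_le_eq)
  finally show ?thesis unfolding s .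
qed

end

section \<open>Limits of products of traces\<close>

lemma (in wick_pair) trs_rotate: "trs (us @ (p @ q) # vs) = trs ((q @ p) # us @ vs)"
  by (simp add: fun_eq_iff trs_def tr_rotate[of p])

text \<open>
  Twice the exponent of \<open>N\<close> in the normalisation of a product of traces.
\<close>

definition trace_degree :: "bool list list \<Rightarrow> nat" where
  "trace_degree ws = (\<Sum>w\<leftarrow>ws. length w + 2)"

lemma tendsto_sum_list:
  fixes f :: "'x \<Rightarrow> nat \<Rightarrow> real"
  assumes "\<And>x. x \<in> set xs \<Longrightarrow> (\<lambda>i. f x i) \<longlonglongrightarrow> L x"
  shows "(\<lambda>i. \<Sum>x\<leftarrow>xs. f x i) \<longlonglongrightarrow> (\<Sum>x\<leftarrow>xs. L x)"
  using assms by (induction xs) (auto intro!: tendsto_add)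

lemma length_splits:
  "(p, q) \<in> set (splits w) \<Longrightarrow> length w = Suc (length p + length q)"
  by (auto simp: in_splits_iff)

lemma merged_words_degree:
  assumes "us \<in> set (merged_words v ws)"
  shows "trace_degree us < length v + trace_degree ws" "sum_list (map length us) < Suc (length v) + sum_list (map length ws)"
  using assms
  by (induction v ws arbitrary: us rule: merged_words.induct)
    (fastforce simp: trace_degree_def dest: length_splits)+

lemma error_words_degree:
  assumes "us \<in> set (error_words v ws)"
  shows "trace_degree us < trace_degree ((True # v) # ws)"
    "sum_list (map length us) < Suc (length v) + sum_list (map length ws)"
  using assms merged_words_degree[of us v ws]
  by (auto simp: error_words_def trace_degree_def dest: length_splits)

lemma trace_limit_B_words:
  fixes M :: "nat \<Rightarrow> 'w measure"
  assumes model: "\<And>i. i > 0 \<Longrightarrow> goe_pte (M i) (2 * i - 1) (a i) (b i) (c i) m"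
    and m: "m 0 = 1" "m 1 = 0" "m 2 = 1"
  shows "(\<lambda>i. integral\<^sup>L (M i) (wick_pair.trs (Suc (2 * i - 1)) (a i) (b i) (map (\<lambda>k. replicate k False) ks))
      / sqrt (2 * real i) ^ (sum_list ks + 2 * length ks)) \<longlonglongrightarrow> real (\<Prod>k\<leftarrow>ks. gauss_moment k)"
proof -
  let ?G = "real (\<Prod>k\<leftarrow>ks. gauss_moment k)"
  let ?D = "sum_list ks + 2 * length ks"
  define E where "E i = integral\<^sup>L (M i) (wick_pair.trs (Suc (2 * i - 1)) (a i) (b i) (map (\<lambda>k. replicate k False) ks))" for i
  obtain C where C: "C \<ge> 0" "\<And>n. n > 0 \<Longrightarrow>
     (\<Sum>us\<in>residue_lists n (sum_list ks). \<bar>circ_moment m n us\<bar>) \<le> C * sqrt n ^ sum_list ks"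
    using sum_abs_circ_moment_le[where m = m, OF m(2)] by blast
  obtain D where D: "D \<ge> 0" "\<And>n. odd n \<Longrightarrow> \<bar>(\<Sum>us\<in>block_zero_lists n ks. circ_moment m n us)
      - ?G * sqrt n ^ sum_list ks\<bar> \<le> D * sqrt n ^ sum_list ks / sqrt n"
    using sum_block_zero_lists_approx[where m = m, OF m] by blast
  let ?c = "weight_error ks * C + D"
  have bound: "\<bar>E i / sqrt (2 * real i - 1) ^ ?D - ?G\<bar> \<le> ?c / sqrt (2 * real i - 1)" if "i > 0" for i
  proof -
    interpret goe_pte "M i" "2 * i - 1" "a i" "b i" "c i" m by (rule model[OF that])
    have r: "real (2 * i - 1) = 2 * real i - 1" using that by (simp add: of_nat_diff)
    show ?thesis
      using expectation_B_traces_bound[OF C(2)[OF n_pos] D(2)[OF odd_n] C(1)]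
      unfolding r E_def .
  qed
  have "(\<lambda>i. E i / sqrt (2 * real i - 1) ^ ?D - ?G) \<longlonglongrightarrow> 0"
  proof (rule Lim_null_comparison)
    show "\<forall>\<^sub>F i in sequentially. norm (E i / sqrt (2 * real i - 1) ^ ?D - ?G) \<le> ?c * (1 / sqrt (2 * real i - 1))"
      using eventually_gt_at_top[of 0] by eventually_elim (use bound in auto)
    have "(\<lambda>i. 1 / sqrt (2 * real i - 1)) \<longlonglongrightarrow> 0" by real_asymp
    then show "(\<lambda>i. ?c * (1 / sqrt (2 * real i - 1))) \<longlonglongrightarrow> 0" by (rule tendsto_mult_right_zero)
  qed
  then have "(\<lambda>i. E i / sqrt (2 * real i - 1) ^ ?D) \<longlonglongrightarrow> ?G" by (simp add: LIM_zero_iff)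
  moreover have "(\<lambda>i. sqrt (2 * real i - 1) / sqrt (2 * real i)) \<longlonglongrightarrow> 1" by real_asymp
  ultimately have "(\<lambda>i. E i / sqrt (2 * real i - 1) ^ ?D * (sqrt (2 * real i - 1) / sqrt (2 * real i)) ^ ?D) \<longlonglongrightarrow> ?G * 1 ^ ?D"
    by (intro tendsto_intros)
  moreover have "\<forall>\<^sub>F i in sequentially. E i / sqrt (2 * real i - 1) ^ ?D * (sqrt (2 * real i - 1) / sqrt (2 * real i)) ^ ?D
      = E i / sqrt (2 * real i) ^ ?D"
    using eventually_gt_at_top[of 0]
  proof eventually_elim
    case (elim i)
    then have "sqrt (2 * real i - 1) \<noteq> 0" by simp
    then show ?case by (simp add: power_divide)
  qed
  ultimately show ?thesis
    unfolding E_def by (simp add: tendsto_cong)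
qed

theorem trace_limit:
  fixes M :: "nat \<Rightarrow> 'w measure"
  assumes model: "\<And>i. i > 0 \<Longrightarrow> goe_pte (M i) (2 * i - 1) (a i) (b i) (c i) m"
    and m: "m 0 = 1" "m 1 = 0" "m 2 = 1"
  shows "(\<lambda>i. integral\<^sup>L (M i) (wick_pair.trs (Suc (2 * i - 1)) (a i) (b i) ws) / sqrt (2 * real i) ^ trace_degree ws)
    \<longlonglongrightarrow> real (\<Prod>w\<leftarrow>ws. free_moment w)"
proof (induction "sum_list (map length ws)" arbitrary: ws rule: less_induct)
  case less
  define T where "T i ws = integral\<^sup>L (M i) (wick_pair.trs (Suc (2 * i - 1)) (a i) (b i) ws)" for i ws
  have IH: "(\<lambda>i. T i us / sqrt (2 * real i) ^ trace_degree us) \<longlonglongrightarrow> real (\<Prod>w\<leftarrow>us. free_moment w)"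
    if "sum_list (map length us) < sum_list (map length ws)" for us
    unfolding T_def using that by (rule less.hyps)
  show ?case
  proof (cases "\<exists>w\<in>set ws. True \<in> set w")
    case False
    define ks where "ks = map length ws"
    have "w = replicate (length w) False" if "w \<in> set ws" for w
      using False that by (intro replicate_eqI) auto
    then have ws: "ws = map (\<lambda>k. replicate k False) ks"
      by (simp add: ks_def comp_def map_idI)
    have "trace_degree ws = sum_list ks + 2 * length ks"
      unfolding trace_degree_def ks_def by (induction ws) simp_all
    moreover have "(\<Prod>w\<leftarrow>ws. free_moment w) = (\<Prod>k\<leftarrow>ks. gauss_moment k)"
      by (simp add: ws comp_def)
    ultimately show ?thesis
      using trace_limit_B_words[OF model m, of ks] by (simp add: ws)
  next
    case True
    then obtain w where w: "w \<in> set ws" "True \<in> set w" by blast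
    then obtain us vs where ws: "ws = us @ w # vs" by (meson split_list)
    obtain p w' where w': "w = replicate p False @ True # w'"
      using w(2) by (cases w rule: word_cases_A) auto
    define v where "v = w' @ replicate p False"
    define rest where "rest = us @ vs"
    have deg: "trace_degree ws = trace_degree ((True # v) # rest)"
      by (simp add: trace_degree_def ws w' v_def rest_def)
    have len: "sum_list (map length ws) = Suc (length v) + sum_list (map length rest)"
      by (simp add: ws w' v_def rest_def)
    \<comment> \<open>rotate the word so that it starts with its first letter \<open>A\<close>, then apply the loop equation\<close>
    have rec: "T i ws = (\<Sum>(p, q)\<leftarrow>splits v. T i (p # q # rest)) + (\<Sum>us\<leftarrow>error_words v rest. T i us)"
      if "i > 0" for i
    proof -
      interpret goe_pte "M i" "2 * i - 1" "a i" "b i" "c i" m by (rule model[OF that])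
      have "trs ws = trs ((True # v) # rest)"
        unfolding ws w' v_def rest_def using trs_rotate[of us "replicate p False" "True # w'" vs]
        by (simp only: append_Cons)
      then show ?thesis unfolding T_def by (simp only: trace_recursion)
    qed
    have main: "(\<lambda>i. \<Sum>(p, q)\<leftarrow>splits v. T i (p # q # rest) / sqrt (2 * real i) ^ trace_degree ws)
      \<longlonglongrightarrow> (\<Sum>(p, q)\<leftarrow>splits v. real (free_moment p * free_moment q * (\<Prod>w\<leftarrow>rest. free_moment w)))"
    proof (unfold case_prod_unfold, rule tendsto_sum_list)
      fix x assume "x \<in> set (splits v)"
      then obtain p q where x: "x = (p, q)" "(p, q) \<in> set (splits v)" by (metis surj_pair)
      have l: "length v = Suc (length p + length q)" using x(2) by (rule length_splits)
      then have "trace_degree ws = trace_degree (p # q # rest)"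
        unfolding deg by (simp add: trace_degree_def)
      then show "(\<lambda>i. T i (fst x # snd x # rest) / sqrt (2 * real i) ^ trace_degree ws)
        \<longlonglongrightarrow> real (free_moment (fst x) * free_moment (snd x) * (\<Prod>w\<leftarrow>rest. free_moment w))"
        using IH[of "p # q # rest"] l by (simp add: x(1) len mult.assoc)
    qed
    have err: "(\<lambda>i. \<Sum>us\<leftarrow>error_words v rest. T i us / sqrt (2 * real i) ^ trace_degree ws)
      \<longlonglongrightarrow> (\<Sum>us\<leftarrow>error_words v rest. 0)"
    proof (rule tendsto_sum_list)
      fix us assume us: "us \<in> set (error_words v rest)"
      \<comment> \<open>at least one factor \<open>sqrt N\<close> of the normalisation is left over\<close>
      then have d: "trace_degree us < trace_degree ws" and l: "sum_list (map length us) < sum_list (map length ws)"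
        using error_words_degree[of us v rest] by (simp_all add: deg len)
      define r where "r = trace_degree ws - trace_degree us - 1"
      have r: "trace_degree ws = trace_degree us + Suc r" using d by (simp add: r_def)
      have "(\<lambda>i. 1 / sqrt (2 * real i)) \<longlonglongrightarrow> 0" by real_asymp
      then have "(\<lambda>i. (1 / sqrt (2 * real i)) ^ Suc r) \<longlonglongrightarrow> 0 ^ Suc r" by (intro tendsto_intros)
      then have "(\<lambda>i. T i us / sqrt (2 * real i) ^ trace_degree us * (1 / sqrt (2 * real i)) ^ Suc r)
        \<longlonglongrightarrow> real (\<Prod>w\<leftarrow>us. free_moment w) * 0 ^ Suc r"
        by (intro tendsto_mult IH l)
      then show "(\<lambda>i. T i us / sqrt (2 * real i) ^ trace_degree ws) \<longlonglongrightarrow> 0"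
        by (simp add: r power_add power_divide mult_ac)
    qed
    have "(\<lambda>i. T i ws / sqrt (2 * real i) ^ trace_degree ws) \<longlonglongrightarrow>
      (\<Sum>(p, q)\<leftarrow>splits v. real (free_moment p * free_moment q * (\<Prod>w\<leftarrow>rest. free_moment w))) + (\<Sum>us\<leftarrow>error_words v rest. 0)"
    proof (rule Lim_transform_eventually[OF tendsto_add[OF main err]])
      show "\<forall>\<^sub>F i in sequentially.
        (\<Sum>(p, q)\<leftarrow>splits v. T i (p # q # rest) / sqrt (2 * real i) ^ trace_degree ws)
        + (\<Sum>us\<leftarrow>error_words v rest. T i us / sqrt (2 * real i) ^ trace_degree ws)
        = T i ws / sqrt (2 * real i) ^ trace_degree ws"
        using eventually_gt_at_top[of 0]
      proof eventually_elim
        case (elim i)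
        show ?case
          unfolding rec[OF elim] divide_inverse distrib_right
          by (simp add: sum_list_mult_const[symmetric] case_prod_unfold)
      qed
    qed
    moreover have "(\<Sum>(p, q)\<leftarrow>splits v. real (free_moment p * free_moment q * (\<Prod>w\<leftarrow>rest. free_moment w))) + (\<Sum>us\<leftarrow>error_words v rest. 0)
      = real (\<Prod>w\<leftarrow>ws. free_moment w)"
    proof -
      have real_sum: "real (\<Sum>(p, q)\<leftarrow>xs. free_moment p * free_moment q) = (\<Sum>(p, q)\<leftarrow>xs. real (free_moment p * free_moment q))" for xs
        by (induction xs) auto
      have "free_moment w = (\<Sum>(p, q)\<leftarrow>splits v. free_moment p * free_moment q)"
        unfolding w' v_def by (rule free_moment_A)
      then have "real (\<Prod>w\<leftarrow>ws. free_moment w) = (\<Sum>(p, q)\<leftarrow>splits v. real (free_moment p * free_moment q)) * real (\<Prod>w\<leftarrow>rest. free_moment w)"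
        by (simp add: ws rest_def real_sum mult_ac)
      then show ?thesis
        by (simp add: sum_list_mult_const[symmetric] case_prod_unfold)
    qed
    ultimately show ?thesis unfolding T_def by simp
  qed
qed

section \<open>The two ensembles\<close>

context prob_space
begin

lemma expectation_prod_list_indep:
  assumes indep: "indep_vars (\<lambda>_. borel) X I" and es: "set es \<subseteq> I"
    and mom: "\<And>i. i \<in> I \<Longrightarrow> all_moments (X i)"
  shows "expectation (\<lambda>\<omega>. \<Prod>e\<leftarrow>es. X e \<omega>) = (\<Prod>d\<in>set es. expectation (\<lambda>\<omega>. X d \<omega> ^ count_list es d))"
proof -
  have prod: "(\<Prod>e\<leftarrow>es. X e \<omega>) = (\<Prod>d\<in>set es. X d \<omega> ^ count_list es d)" for \<omega>
  proof -
    have "(\<Prod>e\<leftarrow>xs. X e \<omega>) = (\<Prod>d\<in>S. X d \<omega> ^ count_list xs d)" if "set xs \<subseteq> S" "finite S" for xs S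
      using that
    proof (induction xs)
      case (Cons x xs)
      have "(\<Prod>d\<in>S. X d \<omega> ^ count_list (x # xs) d) =
          (\<Prod>d\<in>S. (if d = x then X d \<omega> else 1) * X d \<omega> ^ count_list xs d)"
        by (intro prod.cong) auto
      also have "\<dots> = X x \<omega> * (\<Prod>d\<in>S. X d \<omega> ^ count_list xs d)"
        using Cons.prems by (simp add: prod.distrib)
      finally show ?case using Cons by simp
    qed simp
    then show ?thesis by simp
  qed
  have "indep_vars (\<lambda>_. borel) X (set es)"
    using indep es by (rule indep_vars_subset)
  then have "indep_vars (\<lambda>_. borel) (\<lambda>d \<omega>. X d \<omega> ^ count_list es d) (set es)"
    by (rule indep_vars_compose2[where Y = "\<lambda>d x. x ^ count_list es d"]) simp
  then have "expectation (\<lambda>\<omega>. \<Prod>d\<in>set es. X d \<omega> ^ count_list es d) =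
      (\<Prod>d\<in>set es. expectation (\<lambda>\<omega>. X d \<omega> ^ count_list es d))"
    using mom es by (intro indep_vars_lebesgue_integral) (auto simp: all_moments_def)
  then show ?thesis by (simp add: prod)
qed

lemma normal_all_moments:
  assumes X: "distributed M lborel X (normal_density 0 \<sigma>)" and \<sigma>: "\<sigma> > 0"
  shows "all_moments X"
proof -
  have "integrable M (\<lambda>\<omega>. X \<omega> ^ p)" for p
    using integrable_normal_moment[OF \<sigma>, of 0 p] distributed_integrable[OF X, of "\<lambda>x. x ^ p"] by simp
  then show ?thesis
    using distributed_measurable[OF X] by (simp add: all_moments_def)
qed

lemma normal_moment_Suc:
  assumes X: "distributed M lborel X (normal_density 0 \<sigma>)" and \<sigma>: "\<sigma> > 0"
  shows "expectation (\<lambda>\<omega>. X \<omega> ^ Suc k) = \<sigma>\<^sup>2 * real k * expectation (\<lambda>\<omega>. X \<omega> ^ (k - 1))"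
proof -
  have E: "expectation (\<lambda>\<omega>. X \<omega> ^ p) = integral\<^sup>L lborel (\<lambda>x. normal_density 0 \<sigma> x * x ^ p)" for p
    using distributed_integral[OF X, of "\<lambda>x. x ^ p"] by simp
  have even: "expectation (\<lambda>\<omega>. X \<omega> ^ (2 * j)) = fact (2 * j) / ((2 / \<sigma>\<^sup>2) ^ j * fact j)"
    and odd: "expectation (\<lambda>\<omega>. X \<omega> ^ (2 * j + 1)) = 0" for j
    unfolding E using integral_normal_moment_even[OF \<sigma>, of 0 j] integral_normal_moment_odd[OF \<sigma>, of 0 j] by simp_all
  show ?thesis
  proof (cases "even k")
    case True
    then obtain j where j: "k = 2 * j" by (rule evenE)
    show ?thesis
    proof (cases j)
      case 0
      then show ?thesis using odd[of 0] j by simp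
    next
      case (Suc i)
      then have "k - 1 = 2 * i + 1" "Suc k = 2 * j + 1" using j by simp_all
      then show ?thesis using odd[of i] odd[of j] by simp
    qed
  next
    case False
    then obtain j where j: "k = 2 * j + 1" by (rule oddE)
    have cancel: "2 * x * y * F / (2 / s * q * (x * G)) = s * y * (F / (q * G))"
      if "x \<noteq> 0" "s \<noteq> 0" "q \<noteq> 0" "G \<noteq> 0" for x y s q F G :: real
      using that by (simp add: field_simps)
    have "fact (2 * Suc j) = 2 * (real j + 1) * real (2 * j + 1) * fact (2 * j)"
      "fact (Suc j) = (real j + 1) * fact j"
      by (simp_all add: algebra_simps)
    then have "fact (2 * Suc j) / ((2 / \<sigma>\<^sup>2) ^ Suc j * fact (Suc j)) =
        \<sigma>\<^sup>2 * real (2 * j + 1) * (fact (2 * j) / ((2 / \<sigma>\<^sup>2) ^ j * fact j))"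
      unfolding power_Suc using \<sigma> by (simp only:) (rule cancel, auto)
    then show ?thesis using even[of "Suc j"] even[of j] j by simp
  qed
qed

text \<open>
  Wick's formula for independent Gaussian variables: the first factor is contracted with each equal
  factor.
\<close>

lemma expectation_gaussian_Cons:
  assumes indep: "indep_vars (\<lambda>_. borel) X I" and es: "set (e # es) \<subseteq> I"
    and normal: "\<And>i. i \<in> I \<Longrightarrow> distributed M lborel (X i) (normal_density 0 (\<sigma> i))"
    and \<sigma>: "\<And>i. i \<in> I \<Longrightarrow> \<sigma> i > 0"
  shows "expectation (\<lambda>\<omega>. \<Prod>d\<leftarrow>e # es. X d \<omega>) =
    (\<sigma> e)\<^sup>2 * real (count_list es e) * expectation (\<lambda>\<omega>. \<Prod>d\<leftarrow>remove1 e es. X d \<omega>)"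
proof -
  define mu where "mu d p = expectation (\<lambda>\<omega>. X d \<omega> ^ p)" for d p
  have mom: "\<And>i. i \<in> I \<Longrightarrow> all_moments (X i)"
    using normal \<sigma> normal_all_moments by blast
  define S where "S = set es - {e}"
  have ext: "(\<Prod>d\<in>set xs. mu d (count_list xs d)) = mu e (count_list xs e) * (\<Prod>d\<in>S. mu d (count_list xs d))"
    if "set xs \<subseteq> insert e (set es)" for xs
  proof -
    have "(\<Prod>d\<in>set xs. mu d (count_list xs d)) = (\<Prod>d\<in>insert e S. mu d (count_list xs d))"
      using that by (intro prod.mono_neutral_left) (auto simp: S_def mu_def count_list_0_iff prob_space)
    also have "\<dots> = mu e (count_list xs e) * (\<Prod>d\<in>S. mu d (count_list xs d))"
      by (rule prod.insert) (simp_all add: S_def)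
    finally show ?thesis .
  qed
  have cnt: "count_list (remove1 e es) d = (if d = e then count_list es e - 1 else count_list es d)" for d
    by (simp flip: count_mset)
  have "expectation (\<lambda>\<omega>. \<Prod>d\<leftarrow>e # es. X d \<omega>) = (\<Prod>d\<in>set (e # es). mu d (count_list (e # es) d))"
    unfolding mu_def by (rule expectation_prod_list_indep[OF indep es mom])
  also have "\<dots> = mu e (count_list (e # es) e) * (\<Prod>d\<in>S. mu d (count_list (e # es) d))"
    by (rule ext) auto
  also have "count_list (e # es) e = Suc (count_list es e)" by simp
  also have "(\<Prod>d\<in>S. mu d (count_list (e # es) d)) = (\<Prod>d\<in>S. mu d (count_list (remove1 e es) d))"
    by (intro prod.cong) (auto simp: S_def cnt)
  also have "mu e (Suc (count_list es e)) = (\<sigma> e)\<^sup>2 * real (count_list es e) * mu e (count_list (remove1 e es) e)"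
  proof -
    have "e \<in> I" using es by simp
    then show ?thesis
      unfolding mu_def cnt using normal_moment_Suc[OF normal \<sigma>, of e "count_list es e"] by (simp only: if_True simp_thms)
  qed
  also have "\<dots> * (\<Prod>d\<in>S. mu d (count_list (remove1 e es) d)) = (\<sigma> e)\<^sup>2 * real (count_list es e)
      * (mu e (count_list (remove1 e es) e) * (\<Prod>d\<in>S. mu d (count_list (remove1 e es) d)))"
    by simp
  also have "mu e (count_list (remove1 e es) e) * (\<Prod>d\<in>S. mu d (count_list (remove1 e es) d)) =
      expectation (\<lambda>\<omega>. \<Prod>d\<leftarrow>remove1 e es. X d \<omega>)"
  proof -
    have sub: "set (remove1 e es) \<subseteq> I" using es set_remove1_subset[of e es] by auto
    have "expectation (\<lambda>\<omega>. \<Prod>d\<leftarrow>remove1 e es. X d \<omega>) =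
        (\<Prod>d\<in>set (remove1 e es). mu d (count_list (remove1 e es) d))"
      unfolding mu_def by (rule expectation_prod_list_indep[OF indep sub mom])
    also have "\<dots> = mu e (count_list (remove1 e es) e) * (\<Prod>d\<in>S. mu d (count_list (remove1 e es) d))"
      by (rule ext) (use set_remove1_subset[of e es] in auto)
    finally show ?thesis ..
  qed
  finally show ?thesis .
qed

end

text \<open>
  The position on or above the diagonal that represents the entry \<open>(k, l)\<close> of a symmetric matrix.
\<close>

definition sym_pair :: "nat \<Rightarrow> nat \<Rightarrow> nat \<times> nat" where
  "sym_pair k l = (min k l, max k l)"

lemma sym_pair_eq_iff: "sym_pair k l = sym_pair i j \<longleftrightarrow> (k = i \<and> l = j) \<or> (k = j \<and> l = i)"
  by (auto simp: sym_pair_def min_def max_def split: if_splits)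

lemma deriv_monomial_sym:
  fixes Y :: "nat \<times> nat \<Rightarrow> 'w \<Rightarrow> real"
  assumes a: "\<And>k l. a k l = Y (sym_pair k l)"
  shows "deriv_monomial a i j es \<omega> = (if i = j then 2 else 1) * real (count_list (map (case_prod sym_pair) es) (sym_pair i j))
      * (\<Prod>e\<leftarrow>remove1 (sym_pair i j) (map (case_prod sym_pair) es). Y e \<omega>)"
proof (induction es)
  case (Cons e es)
  obtain k l where e: "e = (k, l)" by (cases e)
  let ?v = "if i = j then 2 else 1 :: real"
  let ?s = "sym_pair i j"
  let ?ks = "map (case_prod sym_pair) es"
  have cov: "goe_cov i j k l = (if sym_pair k l = ?s then ?v else 0)"
    by (auto simp: goe_cov_def sym_pair_eq_iff)
  have mono: "monomial a es \<omega> = (\<Prod>e\<leftarrow>?ks. Y e \<omega>)"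
    by (simp add: monomial_def a case_prod_unfold comp_def)
  have rem: "real (count_list ?ks ?s) * (Y ?s \<omega> * (\<Prod>e\<leftarrow>remove1 ?s ?ks. Y e \<omega>)) =
      real (count_list ?ks ?s) * (\<Prod>e\<leftarrow>?ks. Y e \<omega>)"
  proof (cases "?s \<in> set ?ks")
    case True
    then have "mset ?ks = mset (?s # remove1 ?s ?ks)" by (simp del: mset_map set_map)
    then have "mset (map (\<lambda>e. Y e \<omega>) ?ks) = mset (map (\<lambda>e. Y e \<omega>) (?s # remove1 ?s ?ks))"
      by (metis mset_map)
    then have "(\<Prod>e\<leftarrow>?ks. Y e \<omega>) = Y ?s \<omega> * (\<Prod>e\<leftarrow>remove1 ?s ?ks. Y e \<omega>)"
      by (metis list.simps(9) prod_list.Cons prod_mset_prod_list)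
    then show ?thesis by simp
  qed (simp add: count_list_0_iff del: set_map)
  show ?case
  proof (cases "sym_pair k l = ?s")
    case True
    have "deriv_monomial a i j (e # es) \<omega> =
        ?v * (\<Prod>e\<leftarrow>?ks. Y e \<omega>) + ?v * (real (count_list ?ks ?s) * (Y ?s \<omega> * (\<Prod>e\<leftarrow>remove1 ?s ?ks. Y e \<omega>)))"
      unfolding e deriv_monomial.simps Cons.IH using True by (simp add: cov mono a mult_ac)
    then show ?thesis unfolding rem using True by (simp add: e algebra_simps)
  next
    case False
    then show ?thesis unfolding e deriv_monomial.simps Cons.IH by (simp add: cov a mult_ac)
  qed
qed simp


text \<open>
  The entries of \<open>A\<close> are read off above the diagonal and those of \<open>B\<close> from the circulant form, so that the
  two families are symmetric everywhere, not only on the space of the probability measure.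
\<close>

lemma GOE_PTE_model:
  fixes A B :: "'w \<Rightarrow> real mat"
  assumes n: "odd n" and \<mu>: "real_distribution \<mu>" and \<mu>_moments: "\<And>k::nat. integrable \<mu> (\<lambda>x. x ^ k)"
    and GOE: "GOE M (Suc n) A" and PTE: "PTE M \<mu> (Suc n) B" and indep: "indep_matrices M (Suc n) A B"
  shows "\<exists>c. goe_pte M n (\<lambda>k l \<omega>. A \<omega> $$ sym_pair k l) (\<lambda>k l. c ((int k - int l) mod int n)) c
      (\<lambda>p. integral\<^sup>L \<mu> (\<lambda>x. x ^ p)) \<and>
    (\<forall>\<omega>\<in>space M. \<forall>k<Suc n. \<forall>l<Suc n. A \<omega> $$ sym_pair k l = A \<omega> $$ (k, l) \<and>
      c ((int k - int l) mod int n) \<omega> = B \<omega> $$ (k, l))"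
proof -
  let ?N = "Suc n"
  let ?m = "\<lambda>p. integral\<^sup>L \<mu> (\<lambda>x. x ^ p)"
  have n0: "n > 0" using n by (simp add: odd_pos)
  interpret prob_space M using GOE by (simp add: GOE_def)
  interpret \<mu>: real_distribution \<mu> by (rule \<mu>)
  obtain d where d_indep: "indep_vars (\<lambda>_. borel) d {..<?N div 2}"
    and d_distr: "\<And>k. k < ?N div 2 \<Longrightarrow> distr M borel (d k) = \<mu>"
    and B: "\<And>\<omega>. \<omega> \<in> space M \<Longrightarrow> B \<omega> = palindromic_toeplitz ?N (\<lambda>k. d k \<omega>)"
    using PTE unfolding PTE_def by blast
  define a where "a = (\<lambda>k l \<omega>. A \<omega> $$ sym_pair k l)"
  define c where "c x = d (residue_class n x)" for x
  define b where "b = (\<lambda>k l :: nat. c ((int k - int l) mod int n))"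
  define Y where "Y = (\<lambda>(i, j) \<omega>. A \<omega> $$ (i, j))"
  define I where "I = {(i, j). i \<le> j \<and> j < ?N}"
  define \<sigma> where "\<sigma> = (\<lambda>(i :: nat, j). if i = j then sqrt 2 else 1 :: real)"
  have aY: "a k l = Y (sym_pair k l)" for k l by (simp add: a_def Y_def sym_pair_def)
  have Y_indep: "indep_vars (\<lambda>_. borel) Y I" using GOE by (simp add: GOE_def Y_def I_def)
  have Y_normal: "distributed M lborel (Y e) (normal_density 0 (\<sigma> e))" if "e \<in> I" for e
    using GOE that by (cases e) (auto simp: GOE_def Y_def I_def \<sigma>_def split: if_splits)
  have \<sigma>_pos: "\<sigma> e > 0" for e by (auto simp: \<sigma>_def split: prod.split)
  have sym_I: "sym_pair k l \<in> I" if "k < ?N" "l < ?N" for k l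
    using that by (auto simp: I_def sym_pair_def)
  have a_mom: "all_moments (a k l)" if "k < ?N" "l < ?N" for k l
    unfolding aY using Y_normal \<sigma>_pos sym_I[OF that] normal_all_moments by blast
  have class_lt: "residue_class n x < ?N div 2" if "x \<in> {0..<int n}" for x
    using that n by (auto simp: residue_class_def min_def elim!: oddE)
  have d_mom: "all_moments (d k)" if "k < ?N div 2" for k
  proof -
    have meas: "d k \<in> borel_measurable M"
      using d_indep that by (auto simp: indep_vars_def)
    then show ?thesis
      using \<mu>_moments d_distr[OF that] integrable_distr_eq[OF meas, of "\<lambda>x. x ^ p" for p]
      by (auto simp: all_moments_def)
  qed
  have d_expect: "expectation (\<lambda>\<omega>. d k \<omega> ^ p) = ?m p" if "k < ?N div 2" for k p
    using d_distr[OF that] integral_distr[of "d k" M borel "\<lambda>x. x ^ p"] d_mom[OF that]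
    by (simp add: all_moments_def)
  have c_mom: "all_moments (c x)" if "x \<in> {0..<int n}" for x
    unfolding c_def by (rule d_mom[OF class_lt[OF that]])
  have b_mom: "all_moments (b k l)" for k l
    unfolding b_def using n0 by (intro c_mom) auto
  have c_expect: "expectation (\<lambda>\<omega>. \<Prod>x\<leftarrow>xs. c x \<omega>) = circ_moment ?m n xs" if "set xs \<subseteq> {0..<int n}" for xs
  proof -
    have sub: "set (map (residue_class n) xs) \<subseteq> {..<?N div 2}"
      using that class_lt by auto
    have "expectation (\<lambda>\<omega>. \<Prod>x\<leftarrow>xs. c x \<omega>) = expectation (\<lambda>\<omega>. \<Prod>k\<leftarrow>map (residue_class n) xs. d k \<omega>)"
      by (simp add: c_def comp_def)
    also have "\<dots> = (\<Prod>k\<in>set (map (residue_class n) xs). expectation (\<lambda>\<omega>. d k \<omega> ^ count_list (map (residue_class n) xs) k))"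
      using d_mom by (intro expectation_prod_list_indep[OF d_indep sub]) auto
    also have "\<dots> = circ_moment ?m n xs"
      unfolding circ_moment_def list_moment_def using sub by (intro prod.cong refl d_expect) auto
    finally show ?thesis .
  qed
  have b_sym: "b k l = b l k" for k l
  proof -
    have "residue_class n ((int k - int l) mod int n) = residue_class n ((int l - int k) mod int n)"
      using n0 by (subst residue_class_eq_iff) (auto simp: mod_simps)
    then show ?thesis by (simp add: b_def c_def)
  qed
  have A_eq: "A \<omega> $$ sym_pair k l = A \<omega> $$ (k, l)" if "\<omega> \<in> space M" "k < ?N" "l < ?N" for \<omega> k l
  proof -
    have "A \<omega> \<in> carrier_mat ?N ?N" "transpose_mat (A \<omega>) = A \<omega>"
      using GOE that(1) by (auto simp: GOE_def)
    then have "A \<omega> $$ (l, k) = A \<omega> $$ (k, l)"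
      using that by (metis carrier_matD index_transpose_mat(1))
    then show ?thesis by (auto simp: sym_pair_def min_def max_def)
  qed
  have B_eq: "c ((int k - int l) mod int n) \<omega> = B \<omega> $$ (k, l)" if "\<omega> \<in> space M" "k < ?N" "l < ?N" for \<omega> k l
  proof -
    define e where "e = nat \<bar>int k - int l\<bar>"
    have "residue_class n ((int k - int l) mod int n) = residue_class n (int e mod int n)"
    proof (cases "k \<ge> l")
      case True
      then show ?thesis by (simp add: e_def)
    next
      case False
      then have "int e = - (int k - int l)" by (simp add: e_def)
      then show ?thesis
        using n0 by (subst residue_class_eq_iff) (auto simp: mod_simps)
    qed
    also have "\<dots> = (if e < ?N div 2 then e else n - e)"
    proof -
      have "e \<le> n" using that by (auto simp: e_def)
      then consider "e < n" | "e = n" by linarith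
      then show ?thesis
        using n by cases (auto simp: residue_class_def min_def elim!: oddE)
    qed
    finally show ?thesis
      using that by (simp add: c_def B[OF that(1)] palindromic_toeplitz_def Let_def e_def[symmetric])
  qed
  have "wick_pair M ?N a b"
  proof
    show "a k l = a l k" for k l by (simp add: a_def sym_pair_def min.commute max.commute)
    show "b k l = b l k" for k l by (rule b_sym)
    show "all_moments (a k l)" if "k < ?N" "l < ?N" for k l using that by (rule a_mom)
    show "all_moments (b k l)" for k l by (rule b_mom)
    fix i j es fs
    assume ij: "i < ?N" "j < ?N" and es: "set es \<subseteq> {..<?N} \<times> {..<?N}" and fs: "set fs \<subseteq> {..<?N} \<times> {..<?N}"
    define FA where "FA xs f = (\<Prod>(k, l)\<leftarrow>xs. f (sym_pair k l))" for xs and f :: "nat \<times> nat \<Rightarrow> real"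
    define FB where "FB f = (\<Prod>(k, l)\<leftarrow>fs. f (k, l))" for f :: "nat \<times> nat \<Rightarrow> real"
    have comp: "(\<lambda>f. f (k, l)) \<in> borel_measurable (entry_space ?N)" if "k < ?N" "l < ?N" for k l
      unfolding entry_space_def using that by (intro measurable_component_singleton) auto
    have measA: "FA xs \<in> borel_measurable (entry_space ?N)" if "set xs \<subseteq> {..<?N} \<times> {..<?N}" for xs
      using that
    proof (induction xs)
      case (Cons x xs)
      obtain k l where x: "x = (k, l)" by (cases x)
      have "(\<lambda>f. f (sym_pair k l) * FA xs f) \<in> borel_measurable (entry_space ?N)"
        using Cons x by (intro borel_measurable_times) (auto simp: sym_pair_def intro!: comp)
      then show ?case by (simp add: FA_def[abs_def] x)
    next
      case Nil
      have "FA [] = (\<lambda>_. 1)" by (simp add: FA_def fun_eq_iff)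
      then show ?case by simp
    qed
    have measB: "FB \<in> borel_measurable (entry_space ?N)"
      using fs unfolding FB_def[abs_def]
    proof (induction fs)
      case (Cons x xs)
      obtain k l where x: "x = (k, l)" by (cases x)
      have "(\<lambda>f. f (k, l) * (\<Prod>(k, l)\<leftarrow>xs. f (k, l))) \<in> borel_measurable (entry_space ?N)"
        using Cons x by (intro borel_measurable_times) (auto intro!: comp)
      then show ?case by (simp add: x)
    qed simp
    \<comment> \<open>the monomials are measurable functions of the entry vectors, to which independence applies\<close>
    have evalA: "FA xs (entries ?N (A \<omega>)) = monomial a xs \<omega>" if "set xs \<subseteq> {..<?N} \<times> {..<?N}" for xs \<omega>
    proof -
      have "case_prod (\<lambda>k l. entries ?N (A \<omega>) (sym_pair k l)) x = case_prod (\<lambda>k l. a k l \<omega>) x" if "x \<in> set xs" for x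
      proof -
        obtain k l where x: "x = (k, l)" by (cases x)
        then have "k < ?N" "l < ?N"
          using that \<open>set xs \<subseteq> _\<close> by auto
        then show ?thesis by (simp add: x entries_def a_def sym_pair_def min_def max_def)
      qed
      then show ?thesis
        unfolding FA_def monomial_def by (intro arg_cong[of _ _ prod_list] map_cong refl)
    qed
    have evalB: "FB (entries ?N (B \<omega>)) = monomial b fs \<omega>" if "\<omega> \<in> space M" for \<omega>
    proof -
      have "case_prod (\<lambda>k l. entries ?N (B \<omega>) (k, l)) x = case_prod (\<lambda>k l. b k l \<omega>) x" if "x \<in> set fs" for x
      proof -
        obtain k l where x: "x = (k, l)" by (cases x)
        then have "k < ?N" "l < ?N" using that fs by auto
        then show ?thesis using B_eq[OF \<open>\<omega> \<in> space M\<close>] by (simp add: x entries_def b_def)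
      qed
      then show ?thesis
        unfolding FB_def monomial_def by (intro arg_cong[of _ _ prod_list] map_cong refl)
    qed
    have monb: "all_moments (monomial b fs)"
      unfolding monomial_def case_prod_unfold by (rule all_moments_prod_list, rule b_mom)
    have mona: "all_moments (monomial a xs)" if "set xs \<subseteq> {..<?N} \<times> {..<?N}" for xs
      unfolding monomial_def case_prod_unfold using that by (intro all_moments_prod_list a_mom) auto
    have split: "expectation (\<lambda>\<omega>. monomial a xs \<omega> * monomial b fs \<omega>) =
        expectation (monomial a xs) * expectation (monomial b fs)"
      if xs: "set xs \<subseteq> {..<?N} \<times> {..<?N}" for xs
    proof -
      let ?A = "FA xs \<circ> (\<lambda>\<omega>. entries ?N (A \<omega>))" and ?B = "FB \<circ> (\<lambda>\<omega>. entries ?N (B \<omega>))"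
      have iv: "indep_var borel ?A borel ?B"
        using indep measA[OF xs] measB unfolding indep_matrices_def by (rule indep_var_compose)
      have eqA: "?A = monomial a xs" using evalA[OF xs] by (simp add: fun_eq_iff)
      have eqB: "?B \<omega> = monomial b fs \<omega>" if "\<omega> \<in> space M" for \<omega> using evalB[OF that] by simp
      have "integrable M ?B"
        using all_moments_integrable[OF monb] by (subst Bochner_Integration.integrable_cong[OF refl eqB])
      then have "expectation (\<lambda>\<omega>. ?A \<omega> * ?B \<omega>) = expectation ?A * expectation ?B"
        using all_moments_integrable[OF mona[OF xs]] by (intro indep_var_lebesgue_integral iv) (simp_all only: eqA)
      moreover have "expectation (\<lambda>\<omega>. ?A \<omega> * ?B \<omega>) = expectation (\<lambda>\<omega>. monomial a xs \<omega> * monomial b fs \<omega>)"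
        by (intro Bochner_Integration.integral_cong refl) (simp only: eqA eqB)
      moreover have "expectation ?B = expectation (monomial b fs)"
        by (intro Bochner_Integration.integral_cong refl eqB)
      ultimately show ?thesis by (simp only: eqA)
    qed
    let ?ks = "map (case_prod sym_pair) es"
    let ?s = "sym_pair i j"
    let ?v = "if i = j then 2 else 1 :: real"
    have ms: "monomial a xs \<omega> = (\<Prod>e\<leftarrow>map (case_prod sym_pair) xs. Y e \<omega>)" for xs \<omega>
      by (simp add: monomial_def aY case_prod_unfold comp_def)
    \<comment> \<open>\<open>rs\<close> arises from \<open>es\<close> by deleting one index pair that represents the entry \<open>(i, j)\<close>\<close>
    obtain rs where rs: "real (count_list ?ks ?s) * monomial a rs \<omega> =
        real (count_list ?ks ?s) * (\<Prod>e\<leftarrow>remove1 ?s ?ks. Y e \<omega>)" "set rs \<subseteq> {..<?N} \<times> {..<?N}" for \<omega>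
    proof (cases "?s \<in> set ?ks")
      case True
      then obtain e where e: "e \<in> set es" "case_prod sym_pair e = ?s" by auto
      have "mset (map (case_prod sym_pair) (remove1 e es)) = mset (remove1 ?s ?ks)"
        using e by (simp add: image_mset_Diff)
      then have "(\<Prod>e\<leftarrow>map (case_prod sym_pair) (remove1 e es). Y e \<omega>) = (\<Prod>e\<leftarrow>remove1 ?s ?ks. Y e \<omega>)" for \<omega>
        by (metis mset_map prod_mset_prod_list)
      then show ?thesis
        using that[of "remove1 e es"] es set_remove1_subset[of e es] by (simp add: ms[of "remove1 e es"])
    next
      case False
      then show ?thesis using that[of "[]"] by (simp add: count_list_0_iff del: set_map)
    qed
    have deriv: "deriv_monomial a i j es \<omega> = ?v * real (count_list ?ks ?s) * monomial a rs \<omega>" for \<omega>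
      unfolding deriv_monomial_sym[where Y = Y, OF aY] mult.assoc rs(1) ..
    have "expectation (monomial a ((i, j) # es)) = expectation (\<lambda>\<omega>. \<Prod>e\<leftarrow>?s # ?ks. Y e \<omega>)"
      unfolding ms by simp
    also have "\<dots> = (\<sigma> ?s)\<^sup>2 * real (count_list ?ks ?s) * expectation (\<lambda>\<omega>. \<Prod>e\<leftarrow>remove1 ?s ?ks. Y e \<omega>)"
      using ij es sym_I by (intro expectation_gaussian_Cons[OF Y_indep _ Y_normal \<sigma>_pos]) auto
    also have "(\<sigma> ?s)\<^sup>2 = ?v" by (simp add: \<sigma>_def sym_pair_def min_def max_def)
    also have "?v * real (count_list ?ks ?s) * expectation (\<lambda>\<omega>. \<Prod>e\<leftarrow>remove1 ?s ?ks. Y e \<omega>) =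
        ?v * real (count_list ?ks ?s) * expectation (monomial a rs)"
    proof (cases "count_list ?ks ?s = 0")
      case False
      then have "monomial a rs \<omega> = (\<Prod>e\<leftarrow>remove1 ?s ?ks. Y e \<omega>)" for \<omega>
        using rs(1)[of \<omega>] by (simp only: mult_cancel_left of_nat_eq_0_iff) simp
      then have "monomial a rs = (\<lambda>\<omega>. \<Prod>e\<leftarrow>remove1 ?s ?ks. Y e \<omega>)" by (rule ext)
      then show ?thesis by (simp only:)
    qed (simp only: of_nat_0 mult_zero_right mult_zero_left)
    finally have key: "expectation (monomial a ((i, j) # es)) = ?v * real (count_list ?ks ?s) * expectation (monomial a rs)" .
    have "expectation (\<lambda>\<omega>. a i j \<omega> * monomial a es \<omega> * monomial b fs \<omega>) =
        expectation (monomial a ((i, j) # es)) * expectation (monomial b fs)"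
      using split[of "(i, j) # es"] ij es by simp
    also have "\<dots> = ?v * real (count_list ?ks ?s) * expectation (\<lambda>\<omega>. monomial a rs \<omega> * monomial b fs \<omega>)"
      unfolding key split[OF rs(2)] by simp
    also have "\<dots> = expectation (\<lambda>\<omega>. deriv_monomial a i j es \<omega> * monomial b fs \<omega>)"
      unfolding deriv by (simp add: mult.assoc)
    finally show "expectation (\<lambda>\<omega>. a i j \<omega> * monomial a es \<omega> * monomial b fs \<omega>) =
        expectation (\<lambda>\<omega>. deriv_monomial a i j es \<omega> * monomial b fs \<omega>)" .
  qed
  moreover have "goe_pte_axioms M n b c ?m"
    by unfold_locales (use n c_mom c_expect in \<open>auto simp: b_def\<close>)
  ultimately have "goe_pte M n a b c ?m"
    by (rule goe_pte.intro)
  then show ?thesis using A_eq B_eq unfolding a_def b_def by blast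
qed

lemma pow_mat_comm:
  assumes X: "X \<in> carrier_mat N N"
  shows "X ^\<^sub>m k * X = X * X ^\<^sub>m (k :: nat)"
proof (induction k)
  case (Suc k)
  have P: "X ^\<^sub>m k \<in> carrier_mat N N" using X by (rule pow_carrier_mat)
  have "X ^\<^sub>m Suc k * X = (X * X ^\<^sub>m k) * X" using Suc by simp
  also have "\<dots> = X * X ^\<^sub>m Suc k" using X P by (simp add: assoc_mult_mat[OF X P X])
  finally show ?case .
qed (use X in simp)

lemma (in wick_pair) anticommutator_pow_entry:
  assumes A: "A \<in> carrier_mat N N" and B: "B \<in> carrier_mat N N"
    and eqA: "\<And>k l. k < N \<Longrightarrow> l < N \<Longrightarrow> A $$ (k, l) = a k l \<omega>"
    and eqB: "\<And>k l. k < N \<Longrightarrow> l < N \<Longrightarrow> B $$ (k, l) = b k l \<omega>"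
    and "i < N" "j < N"
  shows "(anticommutator A B ^\<^sub>m k) $$ (i, j) = (\<Sum>w\<leftarrow>anticomm_words k. word_entry w i j \<omega>)"
  using assms(5,6)
proof (induction k arbitrary: i j)
  case 0
  have "dim_row (anticommutator A B) = N" using A B by (simp add: anticommutator_def)
  then show ?case using 0 by simp
next
  case (Suc k)
  let ?X = "anticommutator A B"
  have X: "?X \<in> carrier_mat N N" using A B by (simp add: anticommutator_def)
  then have P: "?X ^\<^sub>m k \<in> carrier_mat N N" by (rule pow_carrier_mat)
  have Xe: "?X $$ (i, q) = word_entry [True, False] i q \<omega> + word_entry [False, True] i q \<omega>" if "q < N" for q
  proof -
    have "?X $$ (i, q) = (\<Sum>r<N. a i r \<omega> * b r q \<omega>) + (\<Sum>r<N. b i r \<omega> * a r q \<omega>)"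
      using A B Suc.prems that
      by (simp add: anticommutator_def scalar_prod_def eqA eqB atLeast0LessThan)
    moreover have "word_entry [x, y] i q \<omega> = (\<Sum>r<N. letter x i r \<omega> * letter y r q \<omega>)" for x y
      using that by (simp add: sum_delta_lessThan)
    ultimately show ?thesis by (simp only: letter_def if_True if_False)
  qed
  have "(?X ^\<^sub>m Suc k) $$ (i, j) = (?X * ?X ^\<^sub>m k) $$ (i, j)"
    by (simp add: pow_mat_comm[OF X])
  also have "\<dots> = (\<Sum>q<N. ?X $$ (i, q) * (?X ^\<^sub>m k) $$ (q, j))"
    using X P Suc.prems by (simp add: scalar_prod_def atLeast0LessThan)
  also have "\<dots> = (\<Sum>q<N. \<Sum>w\<leftarrow>anticomm_words k.
      word_entry [True, False] i q \<omega> * word_entry w q j \<omega> + word_entry [False, True] i q \<omega> * word_entry w q j \<omega>)"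
    using Suc by (intro sum.cong refl) (simp add: Xe sum_list_const_mult[symmetric] distrib_right)
  also have "\<dots> = (\<Sum>w\<leftarrow>anticomm_words k. word_entry ([True, False] @ w) i j \<omega> + word_entry ([False, True] @ w) i j \<omega>)"
    unfolding sum_sum_list_swap sum.distrib word_entry_append[OF Suc.prems(1)] ..
  also have "\<dots> = (\<Sum>w\<leftarrow>anticomm_words (Suc k). word_entry w i j \<omega>)"
    by (simp add: sum_list_addf comp_def)
  finally show ?case .
qed

section \<open>The limiting moments\<close>

theorem theorem1p13:
  fixes \<mu> :: "real measure"
    and M :: "nat \<Rightarrow> 'w measure"
    and A B :: "nat \<Rightarrow> 'w \<Rightarrow> real mat"
    and m :: nat
  assumes "real_distribution \<mu>"
    and "\<And>k::nat. integrable \<mu> (\<lambda>x. x ^ k)"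
    and "prob_space.expectation \<mu> (\<lambda>x. x) = 0"
    and "prob_space.variance \<mu> (\<lambda>x. x) = 1"
    and "\<And>N. even N \<Longrightarrow> N > 0 \<Longrightarrow> GOE (M N) N (A N)"
    and "\<And>N. even N \<Longrightarrow> N > 0 \<Longrightarrow> PTE (M N) \<mu> N (B N)"
    and "\<And>N. even N \<Longrightarrow> N > 0 \<Longrightarrow> indep_matrices (M N) N (A N) (B N)"
  defines "moment \<equiv> \<lambda>N. 1 / real N ^ (2 * m + 1) *
      prob_space.expectation (M N)
        (\<lambda>\<omega>. mat_trace (anticommutator (A N \<omega>) (B N \<omega>) ^\<^sub>m (2 * m)))"
  shows "(\<lambda>n. moment (2 * n)) \<longlonglongrightarrow> real (sigma_array m 0)"
proof -
  interpret \<mu>: real_distribution \<mu> by (rule assms(1))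
  let ?m = "\<lambda>p. integral\<^sup>L \<mu> (\<lambda>x. x ^ p)"
  have m: "?m 0 = 1" "?m 1 = 0" "?m 2 = 1"
    using assms(3,4) \<mu>.prob_space by simp_all
  define a where "a i = (\<lambda>k l \<omega>. A (2 * i) \<omega> $$ sym_pair k l)" for i
  define R where "R i c \<longleftrightarrow>
      goe_pte (M (2 * i)) (2 * i - 1) (a i) (\<lambda>k l. c ((int k - int l) mod int (2 * i - 1))) c ?m \<and>
      (\<forall>\<omega>\<in>space (M (2 * i)). \<forall>k<2 * i. \<forall>l<2 * i. a i k l \<omega> = A (2 * i) \<omega> $$ (k, l) \<and>
        c ((int k - int l) mod int (2 * i - 1)) \<omega> = B (2 * i) \<omega> $$ (k, l))" for i c
  have "\<exists>c. R i c" if i: "i > 0" for i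
  proof -
    have N: "Suc (2 * i - 1) = 2 * i" and odd: "odd (2 * i - 1)" using i by simp_all
    have "GOE (M (2 * i)) (Suc (2 * i - 1)) (A (2 * i))" "PTE (M (2 * i)) \<mu> (Suc (2 * i - 1)) (B (2 * i))"
      "indep_matrices (M (2 * i)) (Suc (2 * i - 1)) (A (2 * i)) (B (2 * i))"
      unfolding N using i by (auto intro: assms(5-7))
    from GOE_PTE_model[OF odd assms(1,2) this] show ?thesis
      unfolding R_def a_def N .
  qed
  then obtain c where c: "\<And>i. i > 0 \<Longrightarrow> R i (c i)" by metis
  define b where "b i = (\<lambda>k l :: nat. c i ((int k - int l) mod int (2 * i - 1)))" for i
  define T where "T i ws = integral\<^sup>L (M (2 * i)) (wick_pair.trs (Suc (2 * i - 1)) (a i) (b i) ws)" for i ws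
  have model: "goe_pte (M (2 * i)) (2 * i - 1) (a i) (b i) (c i) ?m" if "i > 0" for i
    using c[OF that] unfolding R_def b_def by (rule conjunct1)
  have entry_eq: "a i k l \<omega> = A (2 * i) \<omega> $$ (k, l)" "b i k l \<omega> = B (2 * i) \<omega> $$ (k, l)"
    if "i > 0" "\<omega> \<in> space (M (2 * i))" "k < 2 * i" "l < 2 * i" for i \<omega> k l
    using c[OF that(1)] that(2-4) unfolding R_def b_def by blast+
  have moment_eq: "moment (2 * i) =
      (\<Sum>w\<leftarrow>anticomm_words (2 * m). T i [w] / sqrt (2 * real i) ^ trace_degree [w])" if i: "i > 0" for i
  proof -
    interpret goe_pte "M (2 * i)" "2 * i - 1" "a i" "b i" "c i" ?m by (rule model[OF i])
    have N: "Suc (2 * i - 1) = 2 * i" using i by simp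
    have "mat_trace (anticommutator (A (2 * i) \<omega>) (B (2 * i) \<omega>) ^\<^sub>m (2 * m)) =
        (\<Sum>w\<leftarrow>anticomm_words (2 * m). trs [w] \<omega>)" if \<omega>: "\<omega> \<in> space (M (2 * i))" for \<omega>
    proof -
      have carr: "A (2 * i) \<omega> \<in> carrier_mat (Suc (2 * i - 1)) (Suc (2 * i - 1))"
        "B (2 * i) \<omega> \<in> carrier_mat (Suc (2 * i - 1)) (Suc (2 * i - 1))"
        using assms(5)[of "2 * i"] assms(6)[of "2 * i"] i \<omega> unfolding N
        by (auto simp: GOE_def PTE_def palindromic_toeplitz_def)
      have X: "anticommutator (A (2 * i) \<omega>) (B (2 * i) \<omega>) ^\<^sub>m (2 * m) \<in> carrier_mat (Suc (2 * i - 1)) (Suc (2 * i - 1))"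
        using carr by (intro pow_carrier_mat) (simp add: anticommutator_def)
      have "mat_trace (anticommutator (A (2 * i) \<omega>) (B (2 * i) \<omega>) ^\<^sub>m (2 * m)) =
          (\<Sum>k<Suc (2 * i - 1). \<Sum>w\<leftarrow>anticomm_words (2 * m). word_entry w k k \<omega>)"
        unfolding mat_trace_def carrier_matD(1)[OF X]
      proof (rule sum.cong)
        fix k assume "k \<in> {..<Suc (2 * i - 1)}"
        then have k: "k < Suc (2 * i - 1)" by simp
        show "(anticommutator (A (2 * i) \<omega>) (B (2 * i) \<omega>) ^\<^sub>m (2 * m)) $$ (k, k) =
            (\<Sum>w\<leftarrow>anticomm_words (2 * m). word_entry w k k \<omega>)"
          by (rule anticommutator_pow_entry[OF carr _ _ k k])
            (simp_all only: N entry_eq[OF i \<omega>])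
      qed simp
      also have "\<dots> = (\<Sum>w\<leftarrow>anticomm_words (2 * m). trs [w] \<omega>)"
        by (simp only: sum_sum_list_swap trs_simps mult_1_right tr_def)
      finally show ?thesis .
    qed
    then have "expectation (\<lambda>\<omega>. mat_trace (anticommutator (A (2 * i) \<omega>) (B (2 * i) \<omega>) ^\<^sub>m (2 * m))) =
        expectation (\<lambda>\<omega>. \<Sum>w\<leftarrow>anticomm_words (2 * m). trs [w] \<omega>)"
      by (rule Bochner_Integration.integral_cong[OF refl])
    also have "\<dots> = (\<Sum>w\<leftarrow>anticomm_words (2 * m). T i [w])"
      unfolding T_def by (rule expectation_sum_list_trs)
    finally have E: "moment (2 * i) = 1 / real (2 * i) ^ (2 * m + 1) * (\<Sum>w\<leftarrow>anticomm_words (2 * m). T i [w])"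
      unfolding moment_def by simp
    have "real (2 * i) ^ (2 * m + 1) = sqrt (2 * real i) ^ trace_degree [w]"
      if "w \<in> set (anticomm_words (2 * m))" for w
    proof -
      have "length w = 2 * (2 * m)" using that by (rule length_anticomm_words)
      then have d: "trace_degree [w] = 2 * (2 * m + 1)" by (simp add: trace_degree_def)
      have "(sqrt (2 * real i))\<^sup>2 = real (2 * i)" by simp
      then show ?thesis unfolding d power_mult[of _ 2 "2 * m + 1"] by (simp only:)
    qed
    then show ?thesis
      unfolding E sum_list_const_mult[symmetric]
      by (intro arg_cong[of _ _ sum_list] map_cong refl) simp
  qed
  have "(\<lambda>i. \<Sum>w\<leftarrow>anticomm_words (2 * m). T i [w] / sqrt (2 * real i) ^ trace_degree [w])
      \<longlonglongrightarrow> (\<Sum>w\<leftarrow>anticomm_words (2 * m). real (free_moment w))"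
  proof (rule tendsto_sum_list)
    fix w
    show "(\<lambda>i. T i [w] / sqrt (2 * real i) ^ trace_degree [w]) \<longlonglongrightarrow> real (free_moment w)"
      using trace_limit[where M = "\<lambda>i. M (2 * i)" and a = a and b = b and c = c and m = ?m and ws = "[w]",
          OF model m] by (simp add: T_def)
  qed
  moreover have "(\<Sum>w\<leftarrow>anticomm_words (2 * m). real (free_moment w)) = real (sigma_array m 0)"
  proof -
    have "(\<Sum>w\<leftarrow>ws. real (free_moment w)) = real (\<Sum>w\<leftarrow>ws. free_moment w)" for ws by (induction ws) auto
    then show ?thesis using word_sum_eq_sigma_array[of m 0] by (simp add: word_sum_def)
  qed
  ultimately have "(\<lambda>i. \<Sum>w\<leftarrow>anticomm_words (2 * m). T i [w] / sqrt (2 * real i) ^ trace_degree [w])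
      \<longlonglongrightarrow> real (sigma_array m 0)"
    by simp
  moreover have "\<forall>\<^sub>F i in sequentially.
      (\<Sum>w\<leftarrow>anticomm_words (2 * m). T i [w] / sqrt (2 * real i) ^ trace_degree [w]) = moment (2 * i)"
    using eventually_gt_at_top[of 0] by eventually_elim (simp only: moment_eq)
  ultimately show ?thesis by (rule Lim_transform_eventually)
qed

end
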